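(* For any $0\leq t<1$, the connection $\widetilde{\nabla}_t$ on $L_1\oplus L_{-1}$ defined by $$\widetilde{\nabla}_t\eta:=\widetilde{\Psi}^\dag\,\mathrm{d}(\widetilde{\Psi}\eta)$$ has anti-selfdual (ASD) curvature $F=\widetilde{\Psi}^\dag(\mathrm{d}P\wedge_q\mathrm{d}P)\widetilde{\Psi}$, where $P:=\widetilde{\Psi}\widetilde{\Psi}^\dag$. Here anti-selfduality is with respect to the reversed orientation $\overline{\mathbb{C}\mathrm{P}}{}^2_q$.
   Context: **Algebras.** Fix $0<q<1$ and put $[z]=\frac{q^z-q^{-z}}{q-q^{-1}}$. $\mathcal U=\mathcal U_q(\mathfrak{su}(3))$ is the Hopf $*$-algebra generated by $K_i^{\pm1},E_i,F_i$ ($i=1,2$), with $K_i=K_i^*$, $F_i=E_i^*$, relations $[K_i,K_j]=0$, $[E_i,F_i]=\frac{K_i^2-K_i^{-2}}{q-q^{-1}}$, $[E_i,F_j]=0$ ($i\ne j$), $K_iE_iK_i^{-1}=qE_i$, $K_iE_jK_i^{-1}=q^{-1/2}E_j$ ($i\neq j$), $[E_i,[E_j,E_i]_q]_q=0$ with $[a,b]_q=ab-q^{-1}ba$; coproduct $\Delta(K_i)=K_i\otimes K_i$, $\Delta(E_i)=E_i\otimes K_i+K_i^{-1}\otimes E_i$, $\Delta(F_i)=F_i\otimes K_i+K_i^{-1}\otimes F_i$; counit $\epsilon(K_i)=1$, $\epsilon(E_i)=\epsilon(F_i)=0$; antipode $S(K_i)=K_i^{-1}$, $S(E_i)=-qE_i$,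 $S(F_i)=-q^{-1}F_i$. $\mathcal U_q(\mathfrak u(2))$ is the Hopf $*$-subalgebra generated by $K_1^{\pm1},E_1,F_1,(K_1K_2^2)^{\pm1}$. $\mathcal A(\mathrm{SU}_q(3))$ is the $*$-algebra generated by $u^i_j$ ($i,j=1,2,3$) with $u^i_ku^j_k=qu^j_ku^i_k$, $u^k_iu^k_j=qu^k_ju^k_i$ for $i<j$; $[u^i_l,u^j_k]=0$, $[u^i_k,u^j_l]=(q-q^{-1})u^i_lu^j_k$ for $i<j$, $k<l$; $\sum_{\pi\in S_3}(-q)^{l(\pi)}u^1_{\pi(1)}u^2_{\pi(2)}u^3_{\pi(3)}=1$ ($l(\pi)$ the number of inversions); and $(u^i_j)^*=(-q)^{j-i}(u^{k_1}_{l_1}u^{k_2}_{l_2}-qu^{k_1}_{l_2}u^{k_2}_{l_1})$ with $\{k_1<k_2\}=\{1,2,3\}\smallsetminus\{i\}$, $\{l_1<l_2\}=\{1,2,3\}\smallsetminus\{j\}$. It carries the right action $\triangleleft$ of $\mathcal U$ with $(ab)\triangleleft x=(a\triangleleft x_{(1)})(b\triangleleft x_{(2)})$, $a^*\triangleleft x=(a\triangleleft S(x)^* )^*$, $u^j_k\triangleleft K_i=q^{\frac12(\delta_{i+1,j}-\delta_{i,j})}u^j_k$, $u^j_k\triangleleft E_i=\delta_{i+1,j}u^i_k$, $u^j_k\triangleleft F_i=\delta_{i,j}u^{i+1}_k$. Put $\mathcal L_xa=a\triangleleft S^{-1}(x)$. $\mathcal A=\mathcal A(\mathbb{C}\mathrm{P}^2_q)$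 is the $*$-algebra of elements invariant under $\mathcal U_q(\mathfrak u(2))$ ($a\triangleleft h=\epsilon(h)a$); it is generated by $p_{ij}=z_i^*z_j$, where $z_i:=u^3_i$. **Forms.** For a $*$-representation $\sigma$ of $\mathcal U_q(\mathfrak u(2))$ on $\mathbb C^n$ let $\mathcal E(\sigma)$ be the $\mathcal A$-bimodule of $\psi\in\mathcal A(\mathrm{SU}_q(3))\otimes\mathbb C^n$ with $(\mathcal L_{h_{(1)}}\otimes\sigma(h_{(2)}))\psi=\epsilon(h)\psi$ for all $h\in\mathcal U_q(\mathfrak u(2))$. $\sigma_{\ell,N}$ is the representation of spin $\ell$ with $K_1K_2^2$ acting as the scalar $q^N$: for $\ell=0$, $K_1\mapsto1$, $E_1,F_1\mapsto0$; for $\ell=\frac12$, $K_1\mapsto\mathrm{diag}(q^{1/2},q^{-1/2})$, $E_1\mapsto e_{12}$, $F_1\mapsto e_{21}$; for $\ell=1$, $K_1\mapsto\mathrm{diag}(q,1,q^{-1})$, $E_1\mapsto[2]^{1/2}(e_{12}+e_{23})$, $F_1\mapsto[2]^{1/2}(e_{21}+e_{32})$ ($e_{ij}$ matrix units). Set $\Omega^{0,0}=\mathcal A$, $\Omega^{1,0}=\mathcal E(\sigma_{\frac12,-\frac32})$, $\Omega^{0,1}=\mathcal E(\sigma_{\frac12,\frac32})$, $\Omega^{2,0}=\mathcal E(\sigma_{0,-3})$, $\Omega^{0,2}=\mathcal E(\sigma_{0,3})$, $\Omega^{1,1}=\Omega^{1,1}_v\oplus\Omega^{1,1}_s$ with $\Omega^{1,1}_v=\mathcal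 E(\sigma_{1,0})$ (first three components) and $\Omega^{1,1}_s=\mathcal E(\sigma_{0,0})$ (fourth component), and $\Omega^k=\bigoplus_{i+j=k}\Omega^{i,j}$. The line bundles are $L_N=\mathcal E(\sigma_{0,N})$, i.e. the $\mathcal U_q(\mathfrak{su}(2))$-invariant $a$ (for $K_1^{\pm1},E_1,F_1$) with $a\triangleleft K_1K_2^2=q^{N}a$; $\Omega^{i,j}(L_N)$ (and $\Omega^{1,1}_{v}(L_N),\Omega^{1,1}_s(L_N)$) is defined as $\Omega^{i,j}$ but with every charge increased by $N$. The product of forms is $(av)\wedge_q(a'v')=aa'(v\wedge_qv')$ for $a,a'\in\mathcal A(\mathrm{SU}_q(3))$ and vectors $v,v'$, where on degree-one vectors, with $\mu_0(v,w)=[2]^{-\frac12}(q^{\frac12}v_1w_2-q^{-\frac12}v_2w_1)$ and $\mu_1(v,w)=(v_1w_1,[2]^{-\frac12}(q^{-\frac12}v_1w_2+q^{\frac12}v_2w_1),v_2w_2)$: type $(0,1)\times(0,1)$: $c_0\mu_0(v,w)$; type $(1,0)\times(1,0)$: $c_0\mu_0(v,w)$; type $(0,1)\times(1,0)$: $(c_1\mu_1(v,w),c_2\mu_0(v,w))$; type $(1,0)\times(0,1)$: $(-q^{\frac12s}c_1\mu_1(v,w),q^{-\frac32s}c_2\mu_0(v,w))$. Here $s=\pm1$ and $c_0,c_1,c_2$ are nonzero reals with $|c_1|=q^{-\frac14s}[2]^{-\frac14}\sqrt{|c_0|}$, $|c_2|=q^{\frac34s}[2]^{-\frac14}\sqrt{|c_0|}$.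 The differential is $\mathrm d=\partial+\bar\partial$ with $\partial a=\mathrm i\,q^{-\frac32}(a\triangleleft E_2,a\triangleleft E_2E_1)^t\in\Omega^{1,0}$, $\bar\partial a=\mathrm i\,(a\triangleleft F_2F_1,a\triangleleft F_2)^t\in\Omega^{0,1}$ for $a\in\mathcal A$, extended by the graded Leibniz rule and $\mathrm d^2=0$ (so $\mathrm d(a\,\mathrm db)=\mathrm da\wedge_q\mathrm db$). **Orientation/ASD.** With the reversed orientation $\overline{\mathbb{C}\mathrm{P}}{}^2_q$, the $+1$ eigenspace of the Hodge star on two-forms is $\Omega^{1,1}_v$ and the $-1$ eigenspace is $\Omega^{2,0}\oplus\Omega^{1,1}_s\oplus\Omega^{0,2}$. Thus a two-form (with coefficients in any $L_N$) is ASD iff its component in $\Omega^{1,1}_v$ (resp. $\Omega^{1,1}_v(L_N)$) is zero; a matrix of two-forms is ASD iff all its entries are. **The connection.** Let $t=\sin2\theta$ with $0\le\theta<\pi/4$ and $$\psi=(\cos2\theta\,z_1^*,\ \cos\theta\,z_2^*,\ \cos\theta\,z_3^*,\ 0,\ \sin\theta\,z_3^*,\ \sin\theta\,z_2^* )^t,$$ $$\varphi=(0,\ -\sin\theta\,z_3,\ q\sin\theta\,z_2,\ q^2\cos2\theta\,z_1,\ q\cos\theta\,z_2,\ -\cos\theta\,z_3)^t .$$ These satisfy $\psi^\dag\varphi=0$, $\psi^\dag\psi=1-t^2p_{11}$, $\varphi^\dag\varphi=1-t^2q^4p_{11}$. The $6\times2$ matrix $\widetilde\Psi$ has first column $\psi\,(1-t^2p_{11})^{-1/2}$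 and second column $\varphi\,(1-t^2q^4p_{11})^{-1/2}$, so $\widetilde\Psi^\dag\widetilde\Psi=1_2$ and $P$ is a projection. Elements $\eta\in L_1\oplus L_{-1}$ (or forms with coefficients in it) are columns $(\eta_1,\eta_2)^t$, so that $\widetilde\Psi\eta$ has entries in $\mathcal A$ (or forms). Throughout, $\mathcal A$ and all the modules are understood to be enlarged (keeping the same symbols) by adjoining the elements $(1-t^2q^kp_{11})^{\pm1/2}$, $k\ge0$, and their powers, defined as convergent power series in $p_{11}$ in the universal $C^*$-algebra (where $\|p_{11}\|\le1$), with $\partial,\bar\partial$ applied term by term. The curvature of $\widetilde\nabla_t$ is the operator $\widetilde\nabla_t^2$, which is left multiplication by the $2\times2$ matrix of two-forms $F$. *)

theory Defs
  imports
    "HOL-Analysis.Analysis"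
    "HOL-Library.Poly_Mapping"
    "HOL-Library.Function_Algebras"
begin

section \<open>The free \<open>*\<close>-algebra on the matrix coefficients\<close>

text \<open>
  The free algebra over the complex numbers on a set of letters is the monoid algebra of the
  free monoid, that is, finitely supported functions on words with the convolution product of
  \<^theory>\<open>HOL-Library.Poly_Mapping\<close>. Words are written additively because this product is only
  set up for additive monoids.
\<close>

datatype 'l word = Word (letters: "'l list")

instantiation word :: (type) monoid_add
begin

definition "0 = Word []"

definition "v + w = Word (letters v @ letters w)"

instance
  by standard (simp_all add: zero_word_def plus_word_def)

end

datatype index = I1 | I2 | I3

primrec ix :: "index \<Rightarrow> nat" where
  "ix I1 = 1"
| "ix I2 = 2"
| "ix I3 = 3"

text \<open>\<open>U i j\<close> stands for the generator with upper index \<open>i\<close> and lower index \<open>j\<close>,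
  and \<open>Us i j\<close> for its formal adjoint.\<close>

datatype letter = U index index | Us index index

type_synonym falg = "letter word \<Rightarrow>\<^sub>0 complex"

definition scal :: "complex \<Rightarrow> falg" where
  "scal c = Poly_Mapping.single 0 c"

definition rscal :: "real \<Rightarrow> falg" where
  "rscal r = scal (complex_of_real r)"

definition gen :: "letter \<Rightarrow> falg" where
  "gen l = Poly_Mapping.single (Word [l]) 1"

primrec adj :: "letter \<Rightarrow> letter" where
  "adj (U i j) = Us i j"
| "adj (Us i j) = U i j"

definition fstar :: "falg \<Rightarrow> falg" where
  "fstar a = (\<Sum>w\<in>Poly_Mapping.keys a.
     Poly_Mapping.single (Word (rev (map adj (letters w)))) (cnj (Poly_Mapping.lookup a w)))"

section \<open>The relations of the quantum group \<open>SU\<^sub>q(3)\<close>\<close>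

definition inversions :: "(index \<Rightarrow> index) \<Rightarrow> nat" where
  "inversions p = card {(i, j). ix i < ix j \<and> ix (p j) < ix (p i)}"

inductive_set suq_relators :: "real \<Rightarrow> falg set" for q :: real where
  "ix i < ix j \<Longrightarrow>
     gen (U i k) * gen (U j k) - rscal q * gen (U j k) * gen (U i k) \<in> suq_relators q"
| "ix i < ix j \<Longrightarrow>
     gen (U k i) * gen (U k j) - rscal q * gen (U k j) * gen (U k i) \<in> suq_relators q"
| "ix i < ix j \<Longrightarrow> ix k < ix l \<Longrightarrow>
     gen (U i l) * gen (U j k) - gen (U j k) * gen (U i l) \<in> suq_relators q"
| "ix i < ix j \<Longrightarrow> ix k < ix l \<Longrightarrow>
     gen (U i k) * gen (U j l) - gen (U j l) * gen (U i k)
       - rscal (q - 1 / q) * gen (U i l) * gen (U j k) \<in> suq_relators q"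
| "(\<Sum>p\<in>{p. bij p}. rscal ((- q) ^ inversions p)
       * gen (U I1 (p I1)) * gen (U I2 (p I2)) * gen (U I3 (p I3))) - 1 \<in> suq_relators q"
| "ix k1 < ix k2 \<Longrightarrow> {k1, k2} = UNIV - {i} \<Longrightarrow> ix l1 < ix l2 \<Longrightarrow> {l1, l2} = UNIV - {j} \<Longrightarrow>
     gen (Us i j) - rscal ((- q) powi (int (ix j) - int (ix i)))
       * (gen (U k1 l1) * gen (U k2 l2) - rscal q * gen (U k1 l2) * gen (U k2 l1))
     \<in> suq_relators q"

text \<open>The coordinate algebra of \<open>SU\<^sub>q(3)\<close> is the quotient of \<^typ>\<open>falg\<close> by the following
  \<open>*\<close>-ideal. The quotient is not formed as a type, since it depends on \<open>q\<close>.\<close>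

inductive_set suq_ideal :: "real \<Rightarrow> falg set" for q :: real where
  zero: "0 \<in> suq_ideal q"
| base: "r \<in> suq_relators q \<Longrightarrow> r \<in> suq_ideal q"
| star: "r \<in> suq_ideal q \<Longrightarrow> fstar r \<in> suq_ideal q"
| add: "r \<in> suq_ideal q \<Longrightarrow> r' \<in> suq_ideal q \<Longrightarrow> r + r' \<in> suq_ideal q"
| left: "r \<in> suq_ideal q \<Longrightarrow> a * r \<in> suq_ideal q"
| right: "r \<in> suq_ideal q \<Longrightarrow> r * a \<in> suq_ideal q"

section \<open>The right action of \<open>U\<^sub>q(su(3))\<close>\<close>

datatype node = N1 | N2

datatype uq = K node | Kinv node | E node | F node

text \<open>Row \<open>i\<close> and row \<open>i + 1\<close>, for the simple root \<open>i\<close>.\<close>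

primrec lo :: "node \<Rightarrow> index" where
  "lo N1 = I1"
| "lo N2 = I2"

primrec hi :: "node \<Rightarrow> index" where
  "hi N1 = I2"
| "hi N2 = I3"

primrec coproduct :: "uq \<Rightarrow> (uq \<times> uq) list" where
  "coproduct (K i) = [(K i, K i)]"
| "coproduct (Kinv i) = [(Kinv i, Kinv i)]"
| "coproduct (E i) = [(E i, K i), (Kinv i, E i)]"
| "coproduct (F i) = [(F i, K i), (Kinv i, F i)]"

primrec counit :: "uq \<Rightarrow> complex" where
  "counit (K i) = 1"
| "counit (Kinv i) = 1"
| "counit (E i) = 0"
| "counit (F i) = 0"

definition kexp :: "node \<Rightarrow> index \<Rightarrow> real" where
  "kexp i j = (of_bool (j = hi i) - of_bool (j = lo i)) / 2"

primrec uact :: "real \<Rightarrow> index \<Rightarrow> index \<Rightarrow> uq \<Rightarrow> falg" where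
  "uact q j k (K i) = rscal (q powr kexp i j) * gen (U j k)"
| "uact q j k (Kinv i) = rscal (q powr - kexp i j) * gen (U j k)"
| "uact q j k (E i) = (if j = hi i then gen (U (lo i) k) else 0)"
| "uact q j k (F i) = (if j = lo i then gen (U (hi i) k) else 0)"

text \<open>On adjoints the action is determined by \<open>a\<^sup>* \<triangleleft> x = (a \<triangleleft> S(x)\<^sup>*)\<^sup>*\<close>, where
  \<open>S(K\<^sub>i)\<^sup>* = K\<^sub>i\<^sup>-\<^sup>1\<close>, \<open>S(E\<^sub>i)\<^sup>* = - q F\<^sub>i\<close> and \<open>S(F\<^sub>i)\<^sup>* = - q\<^sup>-\<^sup>1 E\<^sub>i\<close>.\<close>

primrec usact :: "real \<Rightarrow> index \<Rightarrow> index \<Rightarrow> uq \<Rightarrow> falg" where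
  "usact q j k (K i) = fstar (uact q j k (Kinv i))"
| "usact q j k (Kinv i) = fstar (uact q j k (K i))"
| "usact q j k (E i) = fstar (rscal (- q) * uact q j k (F i))"
| "usact q j k (F i) = fstar (rscal (- 1 / q) * uact q j k (E i))"

primrec lact :: "real \<Rightarrow> letter \<Rightarrow> uq \<Rightarrow> falg" where
  "lact q (U j k) h = uact q j k h"
| "lact q (Us j k) h = usact q j k h"

primrec wact :: "real \<Rightarrow> letter list \<Rightarrow> uq \<Rightarrow> falg" where
  "wact q [] = (\<lambda>h. scal (counit h))"
| "wact q (l # w) = (\<lambda>h. \<Sum>(h1, h2)\<leftarrow>coproduct h. lact q l h1 * wact q w h2)"

definition act :: "real \<Rightarrow> uq \<Rightarrow> falg \<Rightarrow> falg" where
  "act q h a = (\<Sum>w\<in>Poly_Mapping.keys a.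
     scal (Poly_Mapping.lookup a w) * wact q (letters w) h)"

text \<open>The action of a product of generators, the first one in the list acting first.\<close>

definition acts :: "real \<Rightarrow> uq list \<Rightarrow> falg \<Rightarrow> falg" where
  "acts q hs a = fold (act q) hs a"

section \<open>The universal C*-norm and the enlarged algebra\<close>

text \<open>States of the coordinate algebra of \<open>SU\<^sub>q(3)\<close>: normalised positive functionals that
  factor through the quotient.\<close>

definition suq_state :: "real \<Rightarrow> (falg \<Rightarrow> complex) \<Rightarrow> bool" where
  "suq_state q f \<longleftrightarrow>
     (\<forall>a b. f (a + b) = f a + f b) \<and> (\<forall>c a. f (scal c * a) = c * f a) \<and>
     (\<forall>r\<in>suq_ideal q. f r = 0) \<and> f 1 = 1 \<and>
     (\<forall>a. f (fstar a * a) \<in> \<real> \<and> 0 \<le> Re (f (fstar a * a)))"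

text \<open>The norm in the universal C*-algebra is the supremum of \<open>\<parallel>\<pi>(a)\<xi>\<parallel>\<close> over all
  \<open>*\<close>-representations \<open>\<pi>\<close> and unit vectors \<open>\<xi>\<close>. The functionals
  \<open>a \<mapsto> \<langle>\<xi>, \<pi>(a)\<xi>\<rangle>\<close> are exactly the states (GNS), and \<open>\<parallel>\<pi>(a)\<xi>\<parallel>\<^sup>2\<close> is the value at
  \<open>a\<^sup>* a\<close>.\<close>

definition cnorm :: "real \<Rightarrow> falg \<Rightarrow> real" where
  "cnorm q a = Sup {sqrt (Re (f (fstar a * a))) | f. suq_state q f}"

text \<open>
  Elements of the enlarged algebra are convergent sequences in the coordinate algebra, with
  termwise operations; power series are given by their partial sums. So that the termwise
  action of the quantised enveloping algebra is compatible with equality, two sequences are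
  identified when their difference, and everything obtained from it by the action, tends to
  zero in the universal C*-norm.
\<close>

type_synonym calg = "nat \<Rightarrow> falg"

definition ceq :: "real \<Rightarrow> calg \<Rightarrow> calg \<Rightarrow> bool" where
  "ceq q x y \<longleftrightarrow> (\<forall>hs. (\<lambda>n. cnorm q (acts q hs (x n - y n))) \<longlonglongrightarrow> 0)"

definition emb :: "falg \<Rightarrow> calg" where
  "emb a = (\<lambda>n. a)"

definition csc :: "complex \<Rightarrow> calg" where
  "csc c = emb (scal c)"

definition rsc :: "real \<Rightarrow> calg" where
  "rsc r = emb (rscal r)"

definition cstar :: "calg \<Rightarrow> calg" where
  "cstar x = (\<lambda>n. fstar (x n))"

definition cact :: "real \<Rightarrow> uq \<Rightarrow> calg \<Rightarrow> calg" where
  "cact q h x = (\<lambda>n. act q h (x n))"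

definition z :: "index \<Rightarrow> falg" where
  "z i = gen (U I3 i)"

definition p11 :: falg where
  "p11 = fstar (z I1) * z I1"

text \<open>The binomial series of \<open>(1 - c p\<^sub>1\<^sub>1)\<^sup>r\<close>.\<close>

definition binser :: "real \<Rightarrow> real \<Rightarrow> calg" where
  "binser c r = (\<lambda>n. \<Sum>k\<le>n. rscal ((r gchoose k) * (- c) ^ k) * p11 ^ k)"

text \<open>The coordinate algebra of \<open>SU\<^sub>q(3)\<close> enlarged by the roots. It is also closed under the
  termwise action, so that it contains the coefficients of the differentials of its
  elements.\<close>

inductive_set enl :: "real \<Rightarrow> real \<Rightarrow> calg set" for q t :: real where
  "emb a \<in> enl q t"
| "binser (t\<^sup>2 * q ^ k) (1 / 2) \<in> enl q t"
| "binser (t\<^sup>2 * q ^ k) (- 1 / 2) \<in> enl q t"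
| "x \<in> enl q t \<Longrightarrow> y \<in> enl q t \<Longrightarrow> x + y \<in> enl q t"
| "x \<in> enl q t \<Longrightarrow> y \<in> enl q t \<Longrightarrow> x * y \<in> enl q t"
| "x \<in> enl q t \<Longrightarrow> cstar x \<in> enl q t"
| "x \<in> enl q t \<Longrightarrow> cact q h x \<in> enl q t"

section \<open>Equivariant modules and forms\<close>

definition qnum :: "real \<Rightarrow> real \<Rightarrow> real" where
  "qnum q x = (q powr x - q powr - x) / (q - 1 / q)"

text \<open>A representation of \<open>U\<^sub>q(u(2))\<close>, given on the generators \<open>K\<^sub>1\<close>, \<open>E\<^sub>1\<close>, \<open>F\<^sub>1\<close> and
  \<open>K\<^sub>1 K\<^sub>2\<^sup>2\<close>.\<close>

record 'n u2rep =
  repK :: "complex^'n^'n"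
  repE :: "complex^'n^'n"
  repF :: "complex^'n^'n"
  repC :: "complex^'n^'n"

definition sigma0 :: "real \<Rightarrow> real \<Rightarrow> 1 u2rep" where
  "sigma0 q N = \<lparr>repK = mat 1, repE = 0, repF = 0, repC = mat (complex_of_real (q powr N))\<rparr>"

definition sigma_half :: "real \<Rightarrow> real \<Rightarrow> 2 u2rep" where
  "sigma_half q N = \<lparr>
     repK = vector [vector [complex_of_real (q powr (1 / 2)), 0],
                    vector [0, complex_of_real (q powr (- 1 / 2))]],
     repE = vector [vector [0, 1], vector [0, 0]],
     repF = vector [vector [0, 0], vector [1, 0]],
     repC = mat (complex_of_real (q powr N))\<rparr>"

definition sigma1 :: "real \<Rightarrow> real \<Rightarrow> 3 u2rep" where
  "sigma1 q N = (let r = complex_of_real (sqrt (qnum q 2)) in \<lparr>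
     repK = vector [vector [complex_of_real q, 0, 0], vector [0, 1, 0],
                    vector [0, 0, complex_of_real (1 / q)]],
     repE = vector [vector [0, r, 0], vector [0, 0, r], vector [0, 0, 0]],
     repF = vector [vector [0, 0, 0], vector [r, 0, 0], vector [0, r, 0]],
     repC = mat (complex_of_real (q powr N))\<rparr>)"

text \<open>\<open>L\<^sub>x a = a \<triangleleft> S\<^sup>-\<^sup>1(x)\<close>.\<close>

primrec Lact :: "real \<Rightarrow> uq \<Rightarrow> calg \<Rightarrow> calg" where
  "Lact q (K i) = cact q (Kinv i)"
| "Lact q (Kinv i) = cact q (K i)"
| "Lact q (E i) = (\<lambda>x. rsc (- 1 / q) * cact q (E i) x)"
| "Lact q (F i) = (\<lambda>x. rsc (- q) * cact q (F i) x)"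

definition tens :: "(calg \<Rightarrow> calg) \<Rightarrow> complex^'n^'n \<Rightarrow> calg^'n \<Rightarrow> calg^('n::finite)" where
  "tens L M v = (\<chi> i. \<Sum>j\<in>UNIV. csc (M $ i $ j) * L (v $ j))"

definition veq :: "real \<Rightarrow> calg^'n \<Rightarrow> calg^'n \<Rightarrow> bool" where
  "veq q v w \<longleftrightarrow> (\<forall>i. ceq q (v $ i) (w $ i))"

text \<open>The invariance \<open>(L\<^bsub>h(1)\<^esub> \<otimes> \<sigma>(h(2)))\<psi> = \<epsilon>(h)\<psi>\<close>. Both sides are multiplicative in \<open>h\<close>,
  and it is written out for the generators; \<open>K\<^sub>1 K\<^sub>2\<^sup>2\<close> is grouplike, and for inverses of
  grouplike elements the condition follows.\<close>

definition module_of :: "real \<Rightarrow> real \<Rightarrow> 'n u2rep \<Rightarrow> (calg^('n::finite)) set" where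
  "module_of q t \<sigma> = {v. (\<forall>i. v $ i \<in> enl q t) \<and>
     veq q (tens (Lact q (K N1)) (repK \<sigma>) v) v \<and>
     veq q (tens (Lact q (K N1) \<circ> Lact q (K N2) \<circ> Lact q (K N2)) (repC \<sigma>) v) v \<and>
     veq q (tens (Lact q (E N1)) (repK \<sigma>) v + tens (Lact q (Kinv N1)) (repE \<sigma>) v) 0 \<and>
     veq q (tens (Lact q (F N1)) (repK \<sigma>) v + tens (Lact q (Kinv N1)) (repF \<sigma>) v) 0}"

definition line_bundle :: "real \<Rightarrow> real \<Rightarrow> real \<Rightarrow> calg set" where
  "line_bundle q t N = {a. (\<chi> i. a) \<in> module_of q t (sigma0 q N)}"

text \<open>The (enlarged) coordinate algebra of the quantum projective plane.\<close>

definition cp2 :: "real \<Rightarrow> real \<Rightarrow> calg set" where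
  "cp2 q t = line_bundle q t 0"

text \<open>One-forms are pairs of a \<open>(1,0)\<close>- and a \<open>(0,1)\<close>-form; two-forms have components of type
  \<open>(2,0)\<close>, \<open>(1,1)\<^sub>v\<close>, \<open>(1,1)\<^sub>s\<close> and \<open>(0,2)\<close>, in this order.\<close>

type_synonym form1 = "(calg^2) \<times> (calg^2)"
type_synonym form2 = "calg \<times> (calg^3) \<times> calg \<times> calg"

definition Omega1 :: "real \<Rightarrow> real \<Rightarrow> real \<Rightarrow> form1 set" where
  "Omega1 q t N = module_of q t (sigma_half q (N - 3 / 2)) \<times> module_of q t (sigma_half q (N + 3 / 2))"

definition Omega2 :: "real \<Rightarrow> real \<Rightarrow> real \<Rightarrow> form2 set" where
  "Omega2 q t N = line_bundle q t (N - 3) \<times> module_of q t (sigma1 q N)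
     \<times> line_bundle q t N \<times> line_bundle q t (N + 3)"

definition eq1 :: "real \<Rightarrow> form1 \<Rightarrow> form1 \<Rightarrow> bool" where
  "eq1 q \<omega> \<omega>' \<longleftrightarrow> veq q (fst \<omega>) (fst \<omega>') \<and> veq q (snd \<omega>) (snd \<omega>')"

definition eq2 :: "real \<Rightarrow> form2 \<Rightarrow> form2 \<Rightarrow> bool" where
  "eq2 q = (\<lambda>(a, v, b, c) (a', v', b', c').
     ceq q a a' \<and> veq q v v' \<and> ceq q b b' \<and> ceq q c c')"

definition lmul1 :: "calg \<Rightarrow> form1 \<Rightarrow> form1" where
  "lmul1 x = (\<lambda>(v, w). (\<chi> i. x * v $ i, \<chi> i. x * w $ i))"

definition rmul1 :: "form1 \<Rightarrow> calg \<Rightarrow> form1" where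
  "rmul1 = (\<lambda>(v, w) x. (\<chi> i. v $ i * x, \<chi> i. w $ i * x))"

definition lmul2 :: "calg \<Rightarrow> form2 \<Rightarrow> form2" where
  "lmul2 x = (\<lambda>(a, v, b, c). (x * a, \<chi> i. x * v $ i, x * b, x * c))"

definition rmul2 :: "form2 \<Rightarrow> calg \<Rightarrow> form2" where
  "rmul2 = (\<lambda>(a, v, b, c) x. (a * x, \<chi> i. v $ i * x, b * x, c * x))"

definition mu0 :: "real \<Rightarrow> calg^2 \<Rightarrow> calg^2 \<Rightarrow> calg" where
  "mu0 q v w = rsc (qnum q 2 powr (- 1 / 2))
     * (rsc (q powr (1 / 2)) * v $ 1 * w $ 2 - rsc (q powr (- 1 / 2)) * v $ 2 * w $ 1)"

definition mu1 :: "real \<Rightarrow> calg^2 \<Rightarrow> calg^2 \<Rightarrow> calg^3" where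
  "mu1 q v w = vector [v $ 1 * w $ 1,
     rsc (qnum q 2 powr (- 1 / 2))
       * (rsc (q powr (- 1 / 2)) * v $ 1 * w $ 2 + rsc (q powr (1 / 2)) * v $ 2 * w $ 1),
     v $ 2 * w $ 2]"

definition vscale :: "complex \<Rightarrow> calg^'n \<Rightarrow> calg^'n" where
  "vscale c v = (\<chi> i. csc c * v $ i)"

definition wedge :: "real \<Rightarrow> real \<Rightarrow> real \<Rightarrow> real \<Rightarrow> real \<Rightarrow> form1 \<Rightarrow> form1 \<Rightarrow> form2" where
  "wedge q s c0 c1 c2 = (\<lambda>(v, w) (v', w').
     (rsc c0 * mu0 q v v',
      vscale (complex_of_real c1) (mu1 q w v') + vscale (complex_of_real (- (q powr (s / 2)) * c1)) (mu1 q v w'),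
      rsc c2 * mu0 q w v' + rsc (q powr (- 3 / 2 * s) * c2) * mu0 q v w',
      rsc c0 * mu0 q w w'))"

section \<open>The differential\<close>

definition del :: "real \<Rightarrow> calg \<Rightarrow> calg^2" where
  "del q a = vscale (\<i> * complex_of_real (q powr (- 3 / 2))) (vector [cact q (E N2) a, cact q (E N1) (cact q (E N2) a)])"

definition delbar :: "real \<Rightarrow> calg \<Rightarrow> calg^2" where
  "delbar q a = vscale \<i> (vector [cact q (F N1) (cact q (F N2) a), cact q (F N2) a])"

definition d0 :: "real \<Rightarrow> calg \<Rightarrow> form1" where
  "d0 q a = (del q a, delbar q a)"

text \<open>Maps on one-forms that extend \<^const>\<open>d0\<close> by the graded Leibniz rule and
  \<open>d\<^sup>2 = 0\<close>.\<close>

definition is_d1 :: "real \<Rightarrow> real \<Rightarrow> real \<Rightarrow> real \<Rightarrow> real \<Rightarrow> real \<Rightarrow> (form1 \<Rightarrow> form2) \<Rightarrow> bool" where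
  "is_d1 q t s c0 c1 c2 D \<longleftrightarrow>
     (\<forall>\<omega>\<in>Omega1 q t 0. \<forall>\<omega>'\<in>Omega1 q t 0. eq1 q \<omega> \<omega>' \<longrightarrow> eq2 q (D \<omega>) (D \<omega>')) \<and>
     (\<forall>\<omega>\<in>Omega1 q t 0. \<forall>\<omega>'\<in>Omega1 q t 0. eq2 q (D (\<omega> + \<omega>')) (D \<omega> + D \<omega>')) \<and>
     (\<forall>a\<in>cp2 q t. eq2 q (D (d0 q a)) 0) \<and>
     (\<forall>a\<in>cp2 q t. \<forall>\<omega>\<in>Omega1 q t 0.
        eq2 q (D (lmul1 a \<omega>)) (wedge q s c0 c1 c2 (d0 q a) \<omega> + lmul2 a (D \<omega>)) \<and>
        eq2 q (D (rmul1 \<omega> a)) (rmul2 (D \<omega>) a - wedge q s c0 c1 c2 \<omega> (d0 q a)))"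

section \<open>The connection and its curvature\<close>

definition psi :: "real \<Rightarrow> calg^6" where
  "psi \<theta> = vector [rsc (cos (2 * \<theta>)) * emb (fstar (z I1)), rsc (cos \<theta>) * emb (fstar (z I2)),
     rsc (cos \<theta>) * emb (fstar (z I3)), 0,
     rsc (sin \<theta>) * emb (fstar (z I3)), rsc (sin \<theta>) * emb (fstar (z I2))]"

definition phi :: "real \<Rightarrow> real \<Rightarrow> calg^6" where
  "phi q \<theta> = vector [0, rsc (- sin \<theta>) * emb (z I3), rsc (q * sin \<theta>) * emb (z I2),
     rsc (q\<^sup>2 * cos (2 * \<theta>)) * emb (z I1), rsc (q * cos \<theta>) * emb (z I2),
     rsc (- cos \<theta>) * emb (z I3)]"

text \<open>The matrix with columns \<open>\<psi> (1 - t\<^sup>2 p\<^sub>1\<^sub>1)\<^sup>-\<^sup>1\<^sup>/\<^sup>2\<close> and \<open>\<phi> (1 - t\<^sup>2 q\<^sup>4 p\<^sub>1\<^sub>1)\<^sup>-\<^sup>1\<^sup>/\<^sup>2\<close>.\<close>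

definition Psi :: "real \<Rightarrow> real \<Rightarrow> real \<Rightarrow> calg^2^6" where
  "Psi q t \<theta> = (\<chi> i. vector [psi \<theta> $ i * binser (t\<^sup>2) (- 1 / 2),
                             phi q \<theta> $ i * binser (t\<^sup>2 * q ^ 4) (- 1 / 2)])"

definition dagger :: "calg^'n^'m \<Rightarrow> calg^'m^'n" where
  "dagger A = (\<chi> i j. cstar (A $ j $ i))"

definition Pmat :: "real \<Rightarrow> real \<Rightarrow> real \<Rightarrow> calg^6^6" where
  "Pmat q t \<theta> = Psi q t \<theta> ** dagger (Psi q t \<theta>)"

definition mlmul1 :: "calg^'n^'m \<Rightarrow> form1^'n \<Rightarrow> form1^'m" where
  "mlmul1 A \<omega> = (\<chi> i. \<Sum>j\<in>UNIV. lmul1 (A $ i $ j) (\<omega> $ j))"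

definition mlmul2 :: "calg^'n^'m \<Rightarrow> form2^'n \<Rightarrow> form2^'m" where
  "mlmul2 A \<omega> = (\<chi> i. \<Sum>j\<in>UNIV. lmul2 (A $ i $ j) (\<omega> $ j))"

definition dvec :: "real \<Rightarrow> calg^'n \<Rightarrow> form1^'n" where
  "dvec q v = (\<chi> i. d0 q (v $ i))"

text \<open>\<open>L\<^sub>1 \<oplus> L\<^sub>-\<^sub>1\<close>, and one-forms with coefficients in it.\<close>

definition charges :: "real^2" where
  "charges = vector [1, - 1]"

definition LL :: "real \<Rightarrow> real \<Rightarrow> (calg^2) set" where
  "LL q t = {\<eta>. \<forall>i. \<eta> $ i \<in> line_bundle q t (charges $ i)}"

definition Omega1_LL :: "real \<Rightarrow> real \<Rightarrow> (form1^2) set" where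
  "Omega1_LL q t = {\<omega>. \<forall>i. \<omega> $ i \<in> Omega1 q t (charges $ i)}"

definition nabla :: "real \<Rightarrow> real \<Rightarrow> real \<Rightarrow> calg^2 \<Rightarrow> form1^2" where
  "nabla q t \<theta> \<eta> = mlmul1 (dagger (Psi q t \<theta>)) (dvec q (Psi q t \<theta> *v \<eta>))"

text \<open>Connections on the right module \<open>L\<^sub>1 \<oplus> L\<^sub>-\<^sub>1\<close>. Linearity over the complex numbers
  is the Leibniz rule for constant \<open>a\<close>.\<close>

definition is_connection :: "real \<Rightarrow> real \<Rightarrow> (calg^2 \<Rightarrow> form1^2) \<Rightarrow> bool" where
  "is_connection q t D \<longleftrightarrow>
     (\<forall>\<eta>\<in>LL q t. D \<eta> \<in> Omega1_LL q t) \<and>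
     (\<forall>\<eta>\<in>LL q t. \<forall>\<eta>'\<in>LL q t. veq q \<eta> \<eta>' \<longrightarrow> (\<forall>i. eq1 q (D \<eta> $ i) (D \<eta>' $ i))) \<and>
     (\<forall>\<eta>\<in>LL q t. \<forall>\<eta>'\<in>LL q t. \<forall>i. eq1 q (D (\<eta> + \<eta>') $ i) (D \<eta> $ i + D \<eta>' $ i)) \<and>
     (\<forall>\<eta>\<in>LL q t. \<forall>a\<in>cp2 q t. \<forall>i.
        eq1 q (D (\<chi> j. \<eta> $ j * a) $ i) (rmul1 (D \<eta> $ i) a + lmul1 (\<eta> $ i) (d0 q a)))"

text \<open>The value of \<open>d\<close> on the column of one-forms \<open>A db\<close>, where \<open>A\<close> is a matrix and \<open>b\<close> a column
  of functions: by the Leibniz rule and \<open>d\<^sup>2 = 0\<close> it is \<open>dA \<and> db\<close>.\<close>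

definition d_of_Adb :: "real \<Rightarrow> real \<Rightarrow> real \<Rightarrow> real \<Rightarrow> real \<Rightarrow> calg^'n^'m \<Rightarrow> calg^'n \<Rightarrow> form2^'m" where
  "d_of_Adb q s c0 c1 c2 A b =
     (\<chi> i. \<Sum>k\<in>UNIV. wedge q s c0 c1 c2 (d0 q (A $ i $ k)) (d0 q (b $ k)))"

text \<open>The square of the connection,
  \<open>\<nabla>\<^sup>2 \<eta> = \<Psi>\<^sup>\<dagger> d(\<Psi> \<nabla>\<eta>) = \<Psi>\<^sup>\<dagger> d(\<Psi> \<Psi>\<^sup>\<dagger> d(\<Psi> \<eta>))\<close>, where \<open>d\<close> is applied to the expression
  \<open>(\<Psi> \<Psi>\<^sup>\<dagger>) d(\<Psi> \<eta>)\<close>, so that no map on one-forms needs to be assumed; compare \<open>nabla1\<close>.\<close>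

definition nabla_sq :: "real \<Rightarrow> real \<Rightarrow> real \<Rightarrow> real \<Rightarrow> real \<Rightarrow> real \<Rightarrow> real \<Rightarrow> calg^2 \<Rightarrow> form2^2" where
  "nabla_sq q s c0 c1 c2 t \<theta> \<eta> = mlmul2 (dagger (Psi q t \<theta>))
     (d_of_Adb q s c0 c1 c2 (Psi q t \<theta> ** dagger (Psi q t \<theta>)) (Psi q t \<theta> *v \<eta>))"

text \<open>The extension of the connection to one-forms by means of a given differential on
  one-forms.\<close>

definition nabla1 :: "(form1 \<Rightarrow> form2) \<Rightarrow> real \<Rightarrow> real \<Rightarrow> real \<Rightarrow> form1^2 \<Rightarrow> form2^2" where
  "nabla1 D q t \<theta> \<omega> = mlmul2 (dagger (Psi q t \<theta>)) (\<chi> i. D (mlmul1 (Psi q t \<theta>) \<omega> $ i))"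

text \<open>\<open>\<Psi>\<^sup>\<dagger> (dP \<and> dP) \<Psi>\<close>\<close>

definition curvF :: "real \<Rightarrow> real \<Rightarrow> real \<Rightarrow> real \<Rightarrow> real \<Rightarrow> real \<Rightarrow> real \<Rightarrow> form2^2^2" where
  "curvF q s c0 c1 c2 t \<theta> =
     (\<chi> i j. \<Sum>k\<in>UNIV. \<Sum>l\<in>UNIV. lmul2 (dagger (Psi q t \<theta>) $ i $ k)
        (rmul2 (\<Sum>m\<in>UNIV. wedge q s c0 c1 c2 (d0 q (Pmat q t \<theta> $ k $ m)) (d0 q (Pmat q t \<theta> $ m $ l)))
               (Psi q t \<theta> $ l $ j)))"

definition form2_mult :: "form2^'n^'m \<Rightarrow> calg^'n \<Rightarrow> form2^'m" where
  "form2_mult G \<eta> = (\<chi> i. \<Sum>j\<in>UNIV. rmul2 (G $ i $ j) (\<eta> $ j))"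

text \<open>The Hodge star on two-forms for the reversed orientation: \<open>+1\<close> on \<open>(1,1)\<^sub>v\<close> and
  \<open>-1\<close> on the other components.\<close>

definition hodge_rev :: "form2 \<Rightarrow> form2" where
  "hodge_rev = (\<lambda>(a, v, b, c). (- a, v, - b, - c))"

definition asd :: "real \<Rightarrow> form2 \<Rightarrow> bool" where
  "asd q \<omega> \<longleftrightarrow> eq2 q (hodge_rev \<omega>) (- \<omega>)"

end

theory Submission
  imports Defs
begin

text \<open>
  Sequences that stay bounded under the action form an algebra in which those tending to zero are
  an ideal, and in the quotient the binomial series become honest square roots \<open>B\<^sub>j\<close> of the inverses
  of \<open>1 - t\<^sup>2 p\<^sub>1\<^sub>1\<close> and \<open>1 - t\<^sup>2 q\<^sup>4 p\<^sub>1\<^sub>1\<close>. There \<open>\<Psi> = V B\<close> and \<open>\<Psi>\<^sup>\<dagger> = B W\<close>, where the entries of \<open>V\<close>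
  and \<open>W\<close> are linear in \<open>z\<^sub>i\<close> and \<open>z\<^sub>i\<^sup>*\<close>. Differentiating \<open>P V = V\<close> and \<open>W P = W\<close> gives
  \<open>\<Psi>\<^sup>\<dagger> dP = B dW (1 - P)\<close> and \<open>dP \<Psi> = (1 - P) dV B\<close> up to powers of \<open>q\<close>, so the curvature is
  \<open>B dW (1 - P) dV B\<close> and the roots are never differentiated. A column of \<open>V\<close> is killed either by
  \<open>\<partial>\<close> or by the conjugate operator, which leaves one block of the curvature for each order of the
  two types of one-forms. By the relations of \<open>SU\<^sub>q(3)\<close> that block is a multiple of the \<open>q\<close>-antisymmetric
  tensor, which the \<open>q\<close>-symmetric product \<open>\<mu>\<^sub>1\<close> annihilates.

  Boundedness rests on \<open>\<parallel>u\<^sup>i\<^sub>j\<parallel> \<le> 1\<close> in every state and on the polynomial growth in \<open>k\<close> of the norms of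
  the derivatives of \<open>p\<^sub>1\<^sub>1\<^sup>k\<close>.
\<close>

section \<open>The free algebra and the action\<close>

text \<open>Two obstacles shape the proof. Congruence depends on \<open>q\<close> and, in
  \<open>ceq\<close>, on limits, so equational rewriting needs a ring in which congruence is
  equality; in the one used, the image of 1 is only an idempotent \<open>e\<close>. Secondly,
  membership in a line bundle fixes the action of \<open>K_1 K_2^2\<close>, hence of
  \<open>K_2^2\<close>, whereas the coproducts of \<open>E_2\<close> and \<open>F_2\<close> involve
  \<open>K_2\<close> itself. The Leibniz rule on the quantum plane therefore rests on an argument
  that \<open>K_2\<close> has only positive eigenvalues on the enlarged algebra.

  The norm is a supremum over states and says something only because there is a state, the counit,
  and because unitarity of the matrix of generators bounds the supremum. Growth in \<open>k\<close>
  is polynomial since every \<open>K_i\<close> fixes \<open>p_11\<close>, so that only the letters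
  \<open>E\<close> and \<open>F\<close> of a word contribute to it.

  The cancellation in the curvature block has its origin in a third inverse, that of
  \<open>1 - t^2 q^2 p_11\<close>, halfway between the two in \<Psi>: both of these turn into it
  when moved past the matrix entries created by differentiation.\<close>

lemma scal_add: "scal (a + b) = scal a + scal b"
  by (simp add: scal_def single_add)

lemma scal_mult: "scal (a * b) = scal a * scal b"
  by (simp add: scal_def mult_single)

lemma scal_0 [simp]: "scal 0 = 0" and scal_1 [simp]: "scal 1 = 1"
  by (simp_all add: scal_def)

lemma scal_minus: "scal (- a) = - scal a"
  by (simp add: scal_def single_uminus)

lemma scal_single: "scal c * Poly_Mapping.single w d = Poly_Mapping.single w (c * d)"
  by (simp add: scal_def mult_single)

lemma gen_single: "gen l * Poly_Mapping.single (Word w) d = Poly_Mapping.single (Word (l # w)) d"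
  by (simp add: gen_def mult_single plus_word_def)

lemma falg_single_induct [case_names add single]:
  fixes a :: falg
  assumes "\<And>a b. P a \<Longrightarrow> P b \<Longrightarrow> P (a + b)" and "\<And>w c. P (Poly_Mapping.single (Word w) c)"
  shows "P a"
proof (induction a rule: update_induct)
  case const
  show ?case using assms(2)[of "[]" 0] by simp
next
  case (update f a b)
  have "Poly_Mapping.update a b f = f + Poly_Mapping.single a b"
    by (rule poly_mapping_eqI)
      (use update.hyps in \<open>auto simp: lookup_update lookup_add lookup_single when_def in_keys_iff\<close>)
  then show ?case
    using assms(1)[OF update.IH assms(2)[of "letters a" b]] by simp
qed

text \<open>Peels one letter off the left, matching the recursion of \<open>wact\<close>, so that an
  identity of the action reduces to letters and the coproduct rule
  \<open>act_gen_mult\<close>.\<close>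

lemma falg_induct [case_names add scal gen]:
  assumes "\<And>a b. P a \<Longrightarrow> P b \<Longrightarrow> P (a + b)" and "\<And>c. P (scal c)" and "\<And>l a. P a \<Longrightarrow> P (gen l * a)"
  shows "P a"
proof (induction a rule: falg_single_induct)
  case (single w c)
  show ?case
  proof (induction w)
    case Nil
    show ?case using assms(2)[of c] by (simp add: scal_def zero_word_def)
  next
    case (Cons l w)
    then show ?case using assms(3)[of _ l] by (metis gen_single)
  qed
qed (rule assms(1))

lemma scal_comm: "scal c * a = a * scal c"
proof (induction a rule: falg_single_induct)
  case (single w d)
  show ?case by (simp add: scal_def mult_single mult.commute)
qed (simp add: distrib_left distrib_right)

lemma scal_left_comm: "a * (scal c * b) = scal c * (a * b)"
  by (metis mult.assoc scal_comm)

lemma fstar_single: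
  "fstar (Poly_Mapping.single (Word w) c) = Poly_Mapping.single (Word (rev (map adj w))) (cnj c)"
  by (cases "c = 0") (simp_all add: fstar_def)

lemma fstar_add: "fstar (a + b) = fstar a + fstar b"
  unfolding fstar_def by (rule setsum_keys_plus_distrib) (simp_all add: single_add)

lemma fstar_0 [simp]: "fstar 0 = 0"
  by (simp add: fstar_def)

lemma fstar_minus: "fstar (- a) = - fstar a"
  using fstar_add[of a "- a"] by (simp add: eq_neg_iff_add_eq_0 add.commute)

lemma fstar_diff: "fstar (a - b) = fstar a - fstar b"
  using fstar_add[of a "- b"] by (simp add: fstar_minus)

lemma fstar_scal [simp]: "fstar (scal c) = scal (cnj c)"
  using fstar_single[of "[]" c] by (simp add: scal_def zero_word_def)

lemma fstar_rscal [simp]: "fstar (rscal r) = rscal r"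
  by (simp add: rscal_def)

lemma fstar_1 [simp]: "fstar 1 = 1"
  using fstar_scal[of 1] by simp

lemma fstar_gen [simp]: "fstar (gen l) = gen (adj l)"
  by (simp add: gen_def fstar_single)

lemma fstar_mult: "fstar (a * b) = fstar b * fstar a"
proof (induction a rule: falg_single_induct)
  case (single w c)
  show ?case
    by (induction b rule: falg_single_induct)
      (simp_all add: mult_single fstar_single plus_word_def fstar_add distrib_left distrib_right
        mult.commute[of "cnj c"])
qed (simp add: fstar_add distrib_left distrib_right)

lemma adj_adj [simp]: "adj (adj l) = l"
  by (cases l) simp_all

lemma fstar_fstar [simp]: "fstar (fstar a) = a"
proof (induction a rule: falg_single_induct)
  case (single w c)
  have "map (adj \<circ> adj) w = w" by (induction w) simp_all
  then show ?case by (simp add: fstar_single rev_map)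
qed (simp add: fstar_add)

lemma fstar_sum: "fstar (sum f A) = (\<Sum>x\<in>A. fstar (f x))"
  by (induction A rule: infinite_finite_induct) (simp_all add: fstar_add)

lemma fstar_power: "fstar (a ^ n) = fstar a ^ n"
  by (induction n) (simp_all add: fstar_mult power_commutes)

subsection \<open>The action\<close>

lemma act_single: "act q h (Poly_Mapping.single (Word w) c) = scal c * wact q w h"
  by (cases "c = 0") (simp_all add: act_def)

lemma act_add: "act q h (a + b) = act q h a + act q h b"
  unfolding act_def by (rule setsum_keys_plus_distrib) (simp_all add: scal_add distrib_right)

lemma act_0 [simp]: "act q h 0 = 0"
  by (simp add: act_def)

lemma act_minus: "act q h (- a) = - act q h a"
  using act_add[of q h a "- a"] by (simp add: eq_neg_iff_add_eq_0 add.commute)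

lemma act_diff: "act q h (a - b) = act q h a - act q h b"
  using act_add[of q h a "- b"] by (simp add: act_minus)

lemma act_sum: "act q h (sum f A) = (\<Sum>x\<in>A. act q h (f x))"
  by (induction A rule: infinite_finite_induct) (simp_all add: act_add)

lemma act_scal: "act q h (scal c) = scal c * scal (counit h)"
  using act_single[of q h "[]" c] by (simp add: scal_def zero_word_def)

lemma act_scal_mult: "act q h (scal c * a) = scal c * act q h a"
  by (induction a rule: falg_single_induct)
    (simp_all add: act_add distrib_left scal_single act_single scal_mult mult.assoc)

lemma act_1: "act q h 1 = scal (counit h)"
  using act_scal[of q h 1] by simp

lemma act_gen_mult:
  "act q h (gen l * a) = (\<Sum>(h1, h2)\<leftarrow>coproduct h. lact q l h1 * act q h2 a)"
proof (induction a rule: falg_single_induct)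
  case (add a b)
  then show ?case by (cases h) (simp_all add: act_add distrib_left)
next
  case (single w c)
  show ?case
    by (cases h) (simp_all add: gen_single act_single scal_left_comm distrib_left)
qed

lemma act_gen: "act q h (gen l) = lact q l h"
  using act_single[of q h "[l]" 1] by (cases h) (simp_all add: gen_def)

lemma act_mult_K: "act q (K i) (a * b) = act q (K i) a * act q (K i) b"
  and act_mult_Kinv: "act q (Kinv i) (a * b) = act q (Kinv i) a * act q (Kinv i) b"
  by (induction a rule: falg_induct)
    (simp_all add: act_add distrib_right act_scal_mult act_scal act_gen_mult mult.assoc)

text \<open>The rules for \<open>K\<close> and its inverse come before this one: in the letter step
  \<open>E\<close> splits over \<open>gen l * (a * b)\<close>, and the group-like legs then have to
  be distributed over products.\<close>

lemma act_mult_E: "act q (E i) (a * b) = act q (E i) a * act q (K i) b + act q (Kinv i) a * act q (E i) b"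
  by (induction a rule: falg_induct)
    (simp_all add: act_add distrib_right act_scal_mult act_scal act_gen_mult mult.assoc
      act_mult_K act_mult_Kinv distrib_left)

lemma act_mult_F: "act q (F i) (a * b) = act q (F i) a * act q (K i) b + act q (Kinv i) a * act q (F i) b"
  by (induction a rule: falg_induct)
    (simp_all add: act_add distrib_right act_scal_mult act_scal act_gen_mult mult.assoc
      act_mult_K act_mult_Kinv distrib_left)

lemmas act_mult = act_mult_K act_mult_Kinv act_mult_E act_mult_F

lemma rscal_add: "rscal (a + b) = rscal a + rscal b"
  and rscal_mult: "rscal (a * b) = rscal a * rscal b"
  and rscal_0 [simp]: "rscal 0 = 0" and rscal_1 [simp]: "rscal 1 = 1"
  and rscal_minus: "rscal (- a) = - rscal a"
  by (simp_all add: rscal_def scal_add scal_mult scal_minus)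

lemma rscal_comm: "rscal c * a = a * rscal c"
  and rscal_left_comm: "a * (rscal c * b) = rscal c * (a * b)"
  unfolding rscal_def by (rule scal_comm, rule scal_left_comm)

lemma act_rscal_mult: "act q h (rscal c * a) = rscal c * act q h a"
  by (simp add: rscal_def act_scal_mult)

text \<open>\<open>star_gen h\<close> and \<open>star_coeff q h\<close> encode \<open>S(h)\<^sup>*\<close> for a generator \<open>h\<close>.\<close>

primrec star_gen :: "uq \<Rightarrow> uq" where
  "star_gen (K i) = Kinv i" | "star_gen (Kinv i) = K i" | "star_gen (E i) = F i" | "star_gen (F i) = E i"

primrec star_coeff :: "real \<Rightarrow> uq \<Rightarrow> real" where
  "star_coeff q (K i) = 1" | "star_coeff q (Kinv i) = 1"
| "star_coeff q (E i) = - q" | "star_coeff q (F i) = - 1 / q"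

text \<open>For \<open>U\<close> this is the definition of \<open>usact\<close>; for
  \<open>Us\<close> it says that \<open>x \<mapsto> S(x)^*\<close> is an involution on generators,
  the coefficients \<open>-q\<close> and \<open>-1/q\<close> of a pair \<open>E\<close>,
  \<open>F\<close> having product 1.\<close>

lemma lact_adj:
  assumes "q > 0"
  shows "lact q (adj l) h = rscal (star_coeff q h) * fstar (lact q l (star_gen h))"
proof (cases l)
  case (U i j)
  then show ?thesis by (cases h) (simp_all add: fstar_mult rscal_comm)
next
  case (Us i j)
  have "rscal q * rscal (1 / q) = 1" "rscal (1 / q) * rscal q = 1"
    using assms by (simp_all flip: rscal_mult)
  then have "rscal q * (rscal (1 / q) * a) = a" "rscal (1 / q) * (rscal q * a) = a" for a
    by (simp_all flip: mult.assoc)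
  with Us show ?thesis
    by (cases h) (auto simp: fstar_mult rscal_comm[symmetric] rscal_minus fstar_minus)
qed

text \<open>The map \<open>x \<mapsto> S(x)^*\<close> flips the two legs of the coproduct just as
  \<open>fstar\<close> flips the factors of a product, so the rule extends from letters to all
  elements.\<close>

lemma act_fstar:
  assumes "q > 0"
  shows "act q h (fstar a) = rscal (star_coeff q h) * fstar (act q (star_gen h) a)"
proof (induction a arbitrary: h rule: falg_induct)
  case (add a b)
  then show ?case by (simp add: fstar_add act_add distrib_left)
next
  case (scal c)
  show ?case by (cases h) (simp_all add: act_scal fstar_mult flip: scal_mult)
next
  case (gen l a)
  have G: "act q h (gen (adj l)) = rscal (star_coeff q h) * fstar (lact q l (star_gen h))" for h
    by (simp add: act_gen lact_adj[OF assms])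
  show ?case
    by (cases h)
      (simp_all add: fstar_mult act_mult G gen act_gen_mult fstar_add distrib_left mult.assoc
        rscal_left_comm add.commute rscal_minus)
qed

subsection \<open>The relations of the quantised enveloping algebra\<close>

text \<open>Scalars are kept as powers of \<open>q\<close> with real exponents: rewriting then
  collects them by adding exponents, and half-integral weights need no square roots.\<close>

definition qs :: "real \<Rightarrow> real \<Rightarrow> falg" where
  "qs q a = rscal (q powr a)"

lemma qs_left_comm: "a * (qs q x * b) = qs q x * (a * b)"
  unfolding qs_def by (rule rscal_left_comm)

lemma qs_qs: "qs q a * qs q b = qs q (a + b)"
  and qs_qs_mult: "qs q a * (qs q b * x) = qs q (a + b) * x"
  by (simp_all add: qs_def powr_add rscal_mult mult.assoc)

lemma qs_0: "q > 0 \<Longrightarrow> qs q 0 = 1"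
  by (simp add: qs_def)

lemma act_qs_mult: "act q h (qs q a * x) = qs q a * act q h x"
  by (simp add: qs_def act_rscal_mult)

lemma rscal_eq_qs: "q > 0 \<Longrightarrow> rscal q = qs q 1" "q > 0 \<Longrightarrow> rscal (1 / q) = qs q (- 1)"
  by (simp_all add: qs_def powr_minus_divide)

lemma uact_qs:
  assumes "q > 0"
  shows "uact q j k (K i) = qs q (kexp i j) * gen (U j k)"
    "uact q j k (Kinv i) = qs q (- kexp i j) * gen (U j k)"
    "usact q j k (K i) = qs q (- kexp i j) * gen (Us j k)"
    "usact q j k (Kinv i) = qs q (kexp i j) * gen (Us j k)"
    "usact q j k (E i) = (if j = lo i then - (qs q 1 * gen (Us (hi i) k)) else 0)"
    "usact q j k (F i) = (if j = hi i then - (qs q (- 1) * gen (Us (lo i) k)) else 0)"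
  using assms
  by (simp_all add: qs_def fstar_mult rscal_comm powr_minus_divide rscal_minus fstar_minus)

lemma lact_qs:
  assumes "q > 0"
  shows "lact q (U j k) (K i) = qs q (kexp i j) * gen (U j k)"
    "lact q (U j k) (Kinv i) = qs q (- kexp i j) * gen (U j k)"
    "lact q (U j k) (E i) = (if j = hi i then gen (U (lo i) k) else 0)"
    "lact q (U j k) (F i) = (if j = lo i then gen (U (hi i) k) else 0)"
    "lact q (Us j k) (K i) = qs q (- kexp i j) * gen (Us j k)"
    "lact q (Us j k) (Kinv i) = qs q (kexp i j) * gen (Us j k)"
    "lact q (Us j k) (E i) = (if j = lo i then - (qs q 1 * gen (Us (hi i) k)) else 0)"
    "lact q (Us j k) (F i) = (if j = hi i then - (qs q (- 1) * gen (Us (lo i) k)) else 0)"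
  by (simp_all add: uact_qs[OF assms] del: uact.simps(1,2) usact.simps)

text \<open>Half the Cartan matrix of type A2: the weight of \<open>E j\<close> under
  \<open>K i\<close>.\<close>

definition kw :: "node \<Rightarrow> node \<Rightarrow> real" where
  "kw i j = (if i = j then 1 else - 1 / 2)"

declare lact.simps [simp del] uact.simps [simp del] usact.simps [simp del]

lemma act_Kinv_K: "q > 0 \<Longrightarrow> act q (Kinv i) (act q (K i) a) = a"
  and act_K_Kinv: "q > 0 \<Longrightarrow> act q (K i) (act q (Kinv i) a) = a"
  and act_K_K: "q > 0 \<Longrightarrow> act q (K i) (act q (K j) a) = act q (K j) (act q (K i) a)"
  and act_K_Kinv': "q > 0 \<Longrightarrow> act q (K i) (act q (Kinv j) a) = act q (Kinv j) (act q (K i) a)"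
  and act_Kinv_Kinv: "q > 0 \<Longrightarrow> act q (Kinv i) (act q (Kinv j) a) = act q (Kinv j) (act q (Kinv i) a)"
proof -
  assume q: "q > 0"
  note [simp] = act_add act_scal act_mult act_gen lact_qs[OF q] act_qs_mult qs_qs qs_qs_mult
  have "act q (Kinv i) (act q (K i) (gen l)) = gen l" "act q (K i) (act q (Kinv i) (gen l)) = gen l"
    "act q (K i) (act q (K j) (gen l)) = act q (K j) (act q (K i) (gen l))"
    "act q (K i) (act q (Kinv j) (gen l)) = act q (Kinv j) (act q (K i) (gen l))"
    "act q (Kinv i) (act q (Kinv j) (gen l)) = act q (Kinv j) (act q (Kinv i) (gen l))" for l
    by (cases l; simp add: qs_0[OF q] add.commute)+
  then have L: "act q (Kinv i) (lact q l (K i)) = gen l" "act q (K i) (lact q l (Kinv i)) = gen l"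
    "act q (K i) (lact q l (K j)) = act q (K j) (lact q l (K i))"
    "act q (K i) (lact q l (Kinv j)) = act q (Kinv j) (lact q l (K i))"
    "act q (Kinv i) (lact q l (Kinv j)) = act q (Kinv j) (lact q l (Kinv i))" for l
    by (simp_all only: act_gen)
  show "act q (Kinv i) (act q (K i) a) = a"
    by (induction a rule: falg_induct) (simp_all add: L)
  show "act q (K i) (act q (Kinv i) a) = a"
    by (induction a rule: falg_induct) (simp_all add: L)
  show "act q (K i) (act q (K j) a) = act q (K j) (act q (K i) a)"
    by (induction a rule: falg_induct) (simp_all add: L)
  show "act q (K i) (act q (Kinv j) a) = act q (Kinv j) (act q (K i) a)"
    by (induction a rule: falg_induct) (simp_all add: L)
  show "act q (Kinv i) (act q (Kinv j) a) = act q (Kinv j) (act q (Kinv i) a)"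
    by (induction a rule: falg_induct) (simp_all add: L)
qed


text \<open>Successive right actions compose in reversed order: the left-hand side is the action of
  \<open>E_j K_i\<close>, whence an exponent opposite to the one in
  \<open>K_i E_j K_i^{-1}\<close>.\<close>

lemma act_K_E: "q > 0 \<Longrightarrow> act q (K i) (act q (E j) a) = qs q (- kw i j) * act q (E j) (act q (K i) a)"
  and act_Kinv_E: "q > 0 \<Longrightarrow> act q (Kinv i) (act q (E j) a) = qs q (kw i j) * act q (E j) (act q (Kinv i) a)"
  and act_K_F: "q > 0 \<Longrightarrow> act q (K i) (act q (F j) a) = qs q (kw i j) * act q (F j) (act q (K i) a)"
  and act_Kinv_F: "q > 0 \<Longrightarrow> act q (Kinv i) (act q (F j) a) = qs q (- kw i j) * act q (F j) (act q (Kinv i) a)"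
proof -
  assume q: "q > 0"
  note [simp] = act_add act_scal act_mult act_gen lact_qs[OF q] act_qs_mult qs_qs qs_qs_mult
    act_K_Kinv'[OF q] act_Kinv_K[OF q] act_K_Kinv[OF q]
  have "act q (K i) (act q (E j) (gen l)) = qs q (- kw i j) * act q (E j) (act q (K i) (gen l))"
    "act q (Kinv i) (act q (E j) (gen l)) = qs q (kw i j) * act q (E j) (act q (Kinv i) (gen l))"
    "act q (K i) (act q (F j) (gen l)) = qs q (kw i j) * act q (F j) (act q (K i) (gen l))"
    "act q (Kinv i) (act q (F j) (gen l)) = qs q (- kw i j) * act q (F j) (act q (Kinv i) (gen l))" for l
    by (cases l; cases i; cases j; auto simp: kexp_def kw_def act_minus)+
  then have L: "act q (K i) (lact q l (E j)) = qs q (- kw i j) * act q (E j) (lact q l (K i))"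
    "act q (Kinv i) (lact q l (E j)) = qs q (kw i j) * act q (E j) (lact q l (Kinv i))"
    "act q (K i) (lact q l (F j)) = qs q (kw i j) * act q (F j) (lact q l (K i))"
    "act q (Kinv i) (lact q l (F j)) = qs q (- kw i j) * act q (F j) (lact q l (Kinv i))" for l
    by (simp_all only: act_gen)
  have D: "act q (K i) (act q (K j) b) = act q (K j) (act q (K i) b)"
    "act q (Kinv i) (act q (Kinv j) b) = act q (Kinv j) (act q (Kinv i) b)"
    for b
    by (fact act_K_K[OF q] act_Kinv_Kinv[OF q])+
  have D': "act q (K i) (lact q l (Kinv j)) = act q (Kinv j) (lact q l (K i))"
    "act q (K i) (lact q l (K j)) = act q (K j) (lact q l (K i))"
    "act q (Kinv i) (lact q l (Kinv j)) = act q (Kinv j) (lact q l (Kinv i))" for l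
    using act_K_Kinv'[OF q, of i j "gen l"] D[of "gen l"] by (simp_all only: act_gen)
  show "act q (K i) (act q (E j) a) = qs q (- kw i j) * act q (E j) (act q (K i) a)"
    by (induction a rule: falg_induct) (simp_all add: L distrib_left qs_left_comm mult.assoc D D')
  show "act q (Kinv i) (act q (E j) a) = qs q (kw i j) * act q (E j) (act q (Kinv i) a)"
    by (induction a rule: falg_induct) (simp_all add: L distrib_left qs_left_comm mult.assoc D D')
  show "act q (K i) (act q (F j) a) = qs q (kw i j) * act q (F j) (act q (K i) a)"
    by (induction a rule: falg_induct) (simp_all add: L distrib_left qs_left_comm mult.assoc D D')
  show "act q (Kinv i) (act q (F j) a) = qs q (- kw i j) * act q (F j) (act q (Kinv i) a)"
    by (induction a rule: falg_induct) (simp_all add: L distrib_left qs_left_comm mult.assoc D D')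
qed

text \<open>The denominator of \<open>[E_i, F_i]\<close> is cleared; as the action is on the right,
  \<open>act q (F i)\<close> applied after \<open>act q (E i)\<close> is the action of
  \<open>E_i F_i\<close>.\<close>

lemma act_EF_qs:
  assumes q: "q > 0"
  shows "(qs q 1 - qs q (- 1)) * (act q (F i) (act q (E i) a) - act q (E i) (act q (F i) a))
    = act q (K i) (act q (K i) a) - act q (Kinv i) (act q (Kinv i) a)"
proof -
  define R where "R a \<longleftrightarrow> (qs q 1 - qs q (- 1)) * (act q (F i) (act q (E i) a) - act q (E i) (act q (F i) a))
    = act q (K i) (act q (K i) a) - act q (Kinv i) (act q (Kinv i) a)" for a
  note [simp] = act_add act_scal act_mult act_gen lact_qs[OF q] act_qs_mult qs_qs qs_qs_mult
    act_K_Kinv[OF q] act_Kinv_K[OF q] act_K_Kinv'[OF q]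
    act_K_E[OF q] act_K_F[OF q] act_Kinv_E[OF q] act_Kinv_F[OF q] kw_def
  have gen: "R (gen l)" for l
    unfolding R_def
    by (cases l; cases i) (auto simp: kexp_def act_minus qs_0[OF q] algebra_simps)
  \<comment> \<open>The commutator is skew-primitive: the mixed terms of the two orders cancel,
    leaving \<open>K_i^2\<close> on the right factor and \<open>K_i^{-2}\<close> on the left
    one.\<close>
  have mult: "R (a * b)" if "R a" "R b" for a b
  proof -
    let ?d = "qs q 1 - qs q (- 1)"
    have "?d * (act q (F i) (act q (E i) (a * b)) - act q (E i) (act q (F i) (a * b)))
      = (?d * (act q (F i) (act q (E i) a) - act q (E i) (act q (F i) a))) * act q (K i) (act q (K i) b)
        + act q (Kinv i) (act q (Kinv i) a) * (?d * (act q (F i) (act q (E i) b) - act q (E i) (act q (F i) b)))"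
      by (simp add: algebra_simps qs_left_comm)
    with that show ?thesis
      unfolding R_def by (simp only: act_mult) (simp add: algebra_simps)
  qed
  have "R a"
  proof (induction a rule: falg_induct)
    case (add a b)
    then show ?case unfolding R_def
      by (simp only: act_add add_diff_add distrib_left)
  next
    case (scal c)
    show ?case by (cases i) (simp_all add: R_def act_scal_mult)
  next
    case (gen l a)
    then show ?case by (intro mult \<open>\<And>l. R (gen l)\<close>)
  qed
  then show ?thesis by (simp add: R_def)
qed

lemma act_E_F_comm:
  assumes q: "q > 0" and ij: "i \<noteq> j"
  shows "act q (F j) (act q (E i) a) = act q (E i) (act q (F j) a)"
proof -
  note [simp] = act_add act_scal act_mult act_gen lact_qs[OF q] act_qs_mult qs_qs qs_qs_mult
    act_K_Kinv[OF q] act_Kinv_K[OF q] act_K_Kinv'[OF q]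
    act_K_E[OF q] act_K_F[OF q] act_Kinv_E[OF q] act_Kinv_F[OF q] kw_def
  define R where "R a \<longleftrightarrow> act q (F j) (act q (E i) a) = act q (E i) (act q (F j) a)" for a
  have gen: "R (gen l)" for l
    unfolding R_def using ij
    by (cases l; cases i; cases j) (auto simp: act_minus)
  have mult: "R (a * b)" if "R a" "R b" for a b
    using that ij unfolding R_def
    by (simp add: algebra_simps qs_left_comm act_K_K[OF q] act_Kinv_Kinv[OF q])
  have "R a"
  proof (induction a rule: falg_induct)
    case (gen l a)
    then show ?case by (intro mult \<open>\<And>l. R (gen l)\<close>)
  qed (simp_all add: R_def act_scal_mult)
  then show ?thesis by (simp add: R_def)
qed

lemma act_qs:
  "act q (K i) (qs q a) = qs q a" "act q (Kinv i) (qs q a) = qs q a"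
  "act q (E i) (qs q a) = 0" "act q (F i) (qs q a) = 0"
  by (simp_all add: qs_def rscal_def act_scal)

text \<open>The factor \<open>[2]\<close> is written as \<open>q + q^{-1}\<close>. The relation
  later shows that \<open>E_1\<close> annihilates the second component of
  \<open>\<partial>a\<close>.\<close>

lemma act_serre_E:
  assumes q: "q > 0"
  shows "act q (E N2) (act q (E N1) (act q (E N1) a))
      - (qs q 1 + qs q (- 1)) * act q (E N1) (act q (E N2) (act q (E N1) a))
      + act q (E N1) (act q (E N1) (act q (E N2) a)) = 0" (is "?S a = 0")
proof -
  note [simp] = act_add act_scal act_mult act_gen lact_qs[OF q] act_qs act_qs_mult qs_qs qs_qs_mult
    act_K_E[OF q] act_Kinv_E[OF q] kw_def
  have gen: "?S (gen l) = 0" for l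
    by (cases l) (auto simp: act_minus)
  \<comment> \<open>The Serre element is skew-primitive, so its vanishing on letters propagates to
    products.\<close>
  have mult: "?S (a * b) = ?S a * act q (K N2) (act q (K N1) (act q (K N1) b))
      + act q (Kinv N2) (act q (Kinv N1) (act q (Kinv N1) a)) * ?S b" for a b
    by (simp only: act_add act_mult, simp add: act_K_K[OF q, of N1 N2] act_Kinv_Kinv[OF q, of N1 N2]
      act_K_Kinv'[OF q] qs_0[OF q] distrib_left distrib_right right_diff_distrib left_diff_distrib mult.assoc qs_left_comm[of "act q h u" for h u])
  show ?thesis
  proof (induction a rule: falg_induct)
    case (add a b)
    have "?S (a + b) = ?S a + ?S b" by (simp add: algebra_simps)
    with add show ?case by simp
  next
    case (scal c)
    show ?case by (simp add: act_scal_mult)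
  next
    case (gen l a)
    show ?case by (simp only: mult gen \<open>\<And>l. ?S (gen l) = 0\<close>) simp
  qed
qed

lemma act_serre_F:
  assumes q: "q > 0"
  shows "act q (F N2) (act q (F N1) (act q (F N1) a))
      - (qs q 1 + qs q (- 1)) * act q (F N1) (act q (F N2) (act q (F N1) a))
      + act q (F N1) (act q (F N1) (act q (F N2) a)) = 0" (is "?S a = 0")
proof -
  note [simp] = act_add act_scal act_mult act_gen lact_qs[OF q] act_qs act_qs_mult qs_qs qs_qs_mult
    act_K_F[OF q] act_Kinv_F[OF q] kw_def
  have gen: "?S (gen l) = 0" for l
    by (cases l) (auto simp: act_minus)
  have mult: "?S (a * b) = ?S a * act q (K N2) (act q (K N1) (act q (K N1) b))
      + act q (Kinv N2) (act q (Kinv N1) (act q (Kinv N1) a)) * ?S b" for a b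
    by (simp only: act_add act_mult, simp add: act_K_K[OF q, of N1 N2] act_Kinv_Kinv[OF q, of N1 N2]
      act_K_Kinv'[OF q] qs_0[OF q] distrib_left distrib_right right_diff_distrib left_diff_distrib mult.assoc qs_left_comm[of "act q h u" for h u])
  show ?thesis
  proof (induction a rule: falg_induct)
    case (add a b)
    have "?S (a + b) = ?S a + ?S b" by (simp add: algebra_simps)
    with add show ?case by simp
  next
    case (scal c)
    show ?case by (simp add: act_scal_mult)
  next
    case (gen l a)
    show ?case by (simp only: mult gen \<open>\<And>l. ?S (gen l) = 0\<close>) simp
  qed
qed


section \<open>A ring type containing all quotients\<close>

text \<open>A quotient by an ideal that depends on \<open>q\<close> is not a type. The product of the quotients
  \<open>S / I\<close> over \<^emph>\<open>all\<close> pairs of a subalgebra \<open>S\<close> of sequences and an ideal \<open>I\<close> of \<open>S\<close> is one, and each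
  \<open>S / I\<close> embeds into it as a factor. This makes equational reasoning modulo \<open>I\<close> available.\<close>

definition admissible :: "calg set \<times> calg set \<Rightarrow> bool" where
  "admissible p \<longleftrightarrow> (\<forall>r. rsc r \<in> fst p) \<and> (\<forall>x\<in>fst p. \<forall>y\<in>fst p. x + y \<in> fst p \<and> x * y \<in> fst p)
     \<and> snd p \<subseteq> fst p \<and> 0 \<in> snd p \<and> (\<forall>x\<in>snd p. \<forall>y\<in>snd p. x + y \<in> snd p)
     \<and> (\<forall>x\<in>fst p. \<forall>y\<in>snd p. x * y \<in> snd p \<and> y * x \<in> snd p)"

lemma rsc_simps:
  "rsc (a + b) = rsc a + rsc b" "rsc (a * b) = rsc a * rsc b" "rsc 0 = 0" "rsc 1 = 1" "rsc (- a) = - rsc a"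
  by (simp_all add: rsc_def emb_def fun_eq_iff rscal_add rscal_mult rscal_minus)

lemma rsc_comm: "rsc c * x = x * rsc c"
  and rsc_left_comm: "x * (rsc c * y) = rsc c * (x * y)"
  by (auto simp: rsc_def emb_def fun_eq_iff intro: rscal_comm rscal_left_comm)

context
  fixes p :: "calg set \<times> calg set"
  assumes p: "admissible p"
begin

lemma adm_closed:
  "rsc r \<in> fst p" "x \<in> fst p \<Longrightarrow> y \<in> fst p \<Longrightarrow> x + y \<in> fst p" "x \<in> fst p \<Longrightarrow> y \<in> fst p \<Longrightarrow> x * y \<in> fst p"
  "0 \<in> snd p" "x \<in> snd p \<Longrightarrow> x \<in> fst p" "x \<in> snd p \<Longrightarrow> y \<in> snd p \<Longrightarrow> x + y \<in> snd p"
  "x \<in> fst p \<Longrightarrow> y \<in> snd p \<Longrightarrow> x * y \<in> snd p" "x \<in> snd p \<Longrightarrow> y \<in> fst p \<Longrightarrow> x * y \<in> snd p"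
  using p by (auto simp: admissible_def)

lemma adm_0: "0 \<in> fst p" and adm_1: "1 \<in> fst p"
  using adm_closed(1)[of 0] adm_closed(1)[of 1] by (simp_all add: rsc_simps)

lemma adm_uminus: "x \<in> fst p \<Longrightarrow> - x \<in> fst p" "x \<in> snd p \<Longrightarrow> - x \<in> snd p"
  using adm_closed(3)[of "rsc (- 1)" x] adm_closed(7)[of "rsc (- 1)" x] adm_closed(1)[of "- 1"]
  by (simp_all add: rsc_simps)

lemma adm_minus: "x \<in> fst p \<Longrightarrow> y \<in> fst p \<Longrightarrow> x - y \<in> fst p"
  using adm_closed(2)[of x "- y"] adm_uminus(1) by simp

lemma adm_minus': "x \<in> snd p \<Longrightarrow> y \<in> snd p \<Longrightarrow> x - y \<in> snd p"
  using adm_closed(6)[of x "- y"] adm_uminus(2) by simp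

end

text \<open>Families with values in varying subalgebras do not form a type either, hence a partial
  equivalence: a function is related to itself exactly when its value at each admissible pair lies
  in the subalgebra.\<close>

definition qrel :: "(calg set \<times> calg set \<Rightarrow> calg) \<Rightarrow> (calg set \<times> calg set \<Rightarrow> calg) \<Rightarrow> bool" where
  "qrel x y \<longleftrightarrow> (\<forall>p. admissible p \<longrightarrow> x p \<in> fst p \<and> y p \<in> fst p \<and> x p - y p \<in> snd p)"

lemma qrelI:
  "(\<And>p. admissible p \<Longrightarrow> x p \<in> fst p) \<Longrightarrow> (\<And>p. admissible p \<Longrightarrow> y p \<in> fst p) \<Longrightarrow>
    (\<And>p. admissible p \<Longrightarrow> x p - y p \<in> snd p) \<Longrightarrow> qrel x y"
  unfolding qrel_def by blast

lemma qrelD: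
  assumes "qrel x y" "admissible p"
  shows "x p \<in> fst p" "y p \<in> fst p" "x p - y p \<in> snd p"
  using assms unfolding qrel_def by blast+

quotient_type quot = "calg set \<times> calg set \<Rightarrow> calg" / partial: qrel
proof (rule part_equivpI)
  show "\<exists>x. qrel x x"
    by (rule exI[of _ "\<lambda>p. 0"]) (simp add: qrel_def adm_0 adm_closed(4))
  show "symp qrel"
  proof (rule sympI)
    fix x y assume *: "qrel x y"
    show "qrel y x"
      by (rule qrelI) (use qrelD[OF *] adm_uminus(2) in \<open>metis minus_diff_eq\<close>)+
  qed
  show "transp qrel"
  proof (rule transpI)
    fix x y w assume *: "qrel x y" "qrel y w"
    have "x p - w p = (x p - y p) + (y p - w p)" for p
      by simp
    then show "qrel x w"
      by (intro qrelI) (use qrelD[OF *(1)] qrelD[OF *(2)] adm_closed(6) in metis)+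
  qed
qed

instantiation quot :: ring_1
begin

lift_definition zero_quot :: quot is "\<lambda>p. 0"
  by (simp add: qrel_def adm_0 adm_closed(4))

lift_definition one_quot :: quot is "\<lambda>p. 1"
  by (simp add: qrel_def adm_1 adm_closed(4))

lift_definition plus_quot :: "quot \<Rightarrow> quot \<Rightarrow> quot" is "\<lambda>x y p. x p + y p"
  by (rule qrelI) (simp_all add: adm_closed(2) qrelD add_diff_add adm_closed(6))

lift_definition uminus_quot :: "quot \<Rightarrow> quot" is "\<lambda>x p. - x p"
proof -
  fix x y :: "calg set \<times> calg set \<Rightarrow> calg"
  assume *: "qrel x y"
  have "- x p - - y p = - (x p - y p)" for p by simp
  then show "qrel (\<lambda>p. - x p) (\<lambda>p. - y p)"
    by (intro qrelI) (use qrelD[OF *] adm_uminus in metis)+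
qed

lift_definition minus_quot :: "quot \<Rightarrow> quot \<Rightarrow> quot" is "\<lambda>x y p. x p - y p"
proof -
  fix x x' y y' :: "calg set \<times> calg set \<Rightarrow> calg"
  assume *: "qrel x x'" "qrel y y'"
  have "(x p - y p) - (x' p - y' p) = (x p - x' p) - (y p - y' p)" for p
    by (simp add: algebra_simps)
  then show "qrel (\<lambda>p. x p - y p) (\<lambda>p. x' p - y' p)"
    by (intro qrelI) (use qrelD[OF *(1)] qrelD[OF *(2)] adm_minus adm_minus' in metis)+
qed

lift_definition times_quot :: "quot \<Rightarrow> quot \<Rightarrow> quot" is "\<lambda>x y p. x p * y p"
proof -
  fix x x' y y' :: "calg set \<times> calg set \<Rightarrow> calg"
  assume *: "qrel x x'" "qrel y y'"
  have "x p * y p - x' p * y' p = (x p - x' p) * y p + x' p * (y p - y' p)" for p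
    by (simp add: algebra_simps)
  then show "qrel (\<lambda>p. x p * y p) (\<lambda>p. x' p * y' p)"
    by (intro qrelI) (use qrelD[OF *(1)] qrelD[OF *(2)] adm_closed(3,6,7,8) in metis)+
qed

instance
proof
  have refl: "qrel (\<lambda>p. f p) (\<lambda>p. f p)" if "\<And>p. admissible p \<Longrightarrow> f p \<in> fst p" for f
    using that by (intro qrelI) (simp_all add: adm_closed(4))
  have S: "x p \<in> fst p" if "qrel x x" "admissible p" for x p
    using that by (rule qrelD)
  note intros = refl adm_closed(2,3) adm_uminus adm_minus S adm_0 adm_1
  show "a + b + c = a + (b + c)" for a b c :: quot
    by transfer (simp add: add.assoc intros)
  show "a + b = b + a" for a b :: quot
    by transfer (simp add: add.commute intros)
  show "0 + a = a" for a :: quot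
    by transfer (simp add: intros)
  show "- a + a = 0" for a :: quot
    by transfer (simp add: intros)
  show "a - b = a + - b" for a b :: quot
    by transfer (simp add: intros)
  show "a * b * c = a * (b * c)" for a b c :: quot
    by transfer (simp add: mult.assoc intros)
  show "1 * a = a" for a :: quot
    by transfer (simp add: intros)
  show "a * 1 = a" for a :: quot
    by transfer (simp add: intros)
  show "(a + b) * c = a * c + b * c" for a b c :: quot
    by transfer (simp add: distrib_right intros)
  show "a * (b + c) = a * b + a * c" for a b c :: quot
    by transfer (simp add: distrib_left intros)
  \<comment> \<open>One factor in which 0 and 1 differ suffices for the whole product: all sequences
    modulo the zero ideal.\<close>
  have "admissible (UNIV, {0})"
    by (simp add: admissible_def)
  then show "(0::quot) \<noteq> 1"
    by transfer (force simp: qrel_def)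
qed

end

instantiation quot :: real_algebra_1
begin

lift_definition scaleR_quot :: "real \<Rightarrow> quot \<Rightarrow> quot" is "\<lambda>r x p. rsc r * x p"
  by (rule qrelI) (simp_all add: adm_closed(1,3,7) qrelD flip: right_diff_distrib)

instance
proof
  have refl: "qrel (\<lambda>p. f p) (\<lambda>p. f p)" if "\<And>p. admissible p \<Longrightarrow> f p \<in> fst p" for f
    using that by (intro qrelI) (simp_all add: adm_closed(4))
  have S: "x p \<in> fst p" if "qrel x x" "admissible p" for x p
    using that by (rule qrelD)
  note intros = refl adm_closed(1,2,3) adm_uminus adm_minus S adm_0 adm_1
  show "r *\<^sub>R (a + b) = r *\<^sub>R a + r *\<^sub>R b" for r and a b :: quot
    by transfer (simp add: distrib_left intros)
  show "(r + s) *\<^sub>R a = r *\<^sub>R a + s *\<^sub>R a" for r s and a :: quot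
    by transfer (simp add: rsc_simps distrib_right intros)
  show "r *\<^sub>R s *\<^sub>R a = (r * s) *\<^sub>R a" for r s and a :: quot
    by transfer (simp add: rsc_simps mult.assoc intros)
  show "1 *\<^sub>R a = a" for a :: quot
    by transfer (simp add: rsc_simps intros)
  show "r *\<^sub>R a * b = r *\<^sub>R (a * b)" for r and a b :: quot
    by transfer (simp add: mult.assoc intros)
  show "a * r *\<^sub>R b = r *\<^sub>R (a * b)" for r and a b :: quot
    by transfer (simp add: rsc_left_comm intros)
qed

end

text \<open>Embeds the factor at \<open>p\<close>, with zero in all other factors. Hence
  \<open>proj p 1\<close> is an idempotent rather than 1. The guard on \<open>x\<close> makes the
  map total.\<close>

definition proj :: "calg set \<times> calg set \<Rightarrow> calg \<Rightarrow> quot" where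
  "proj p x = abs_quot (\<lambda>p'. if p' = p \<and> x \<in> fst p then x else 0)"

context
  fixes p :: "calg set \<times> calg set"
  assumes p: "admissible p"
begin

lemma proj_rel: "qrel (\<lambda>p'. if p' = p \<and> x \<in> fst p then x else 0) (\<lambda>p'. if p' = p \<and> x \<in> fst p then x else 0)"
  by (rule qrelI) (simp_all add: adm_0 adm_closed(4))

lemma proj_eqI:
  "qrel (\<lambda>p'. if p' = p \<and> x \<in> fst p then x else 0) f \<Longrightarrow> proj p x = abs_quot f"
  unfolding proj_def using Quotient_rel[OF Quotient_quot] by blast

lemma proj_eq_iff: "x \<in> fst p \<Longrightarrow> y \<in> fst p \<Longrightarrow> proj p x = proj p y \<longleftrightarrow> x - y \<in> snd p"
proof -
  assume xy: "x \<in> fst p" "y \<in> fst p"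
  have "proj p x = proj p y \<longleftrightarrow> qrel (\<lambda>p'. if p' = p \<and> x \<in> fst p then x else 0)
      (\<lambda>p'. if p' = p \<and> y \<in> fst p then y else 0)"
    unfolding proj_def using Quotient_rel[OF Quotient_quot] proj_rel by blast
  also have "\<dots> \<longleftrightarrow> x - y \<in> snd p"
  proof
    assume *: "qrel (\<lambda>p'. if p' = p \<and> x \<in> fst p then x else 0) (\<lambda>p'. if p' = p \<and> y \<in> fst p then y else 0)"
    show "x - y \<in> snd p"
      using qrelD(3)[OF * p] xy by simp
  next
    assume "x - y \<in> snd p"
    then show "qrel (\<lambda>p'. if p' = p \<and> x \<in> fst p then x else 0) (\<lambda>p'. if p' = p \<and> y \<in> fst p then y else 0)"
      using xy by (intro qrelI) (simp_all add: adm_0 adm_closed(4))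
  qed
  finally show ?thesis .
qed

lemma proj_add: "x \<in> fst p \<Longrightarrow> y \<in> fst p \<Longrightarrow> proj p (x + y) = proj p x + proj p y"
  unfolding proj_def[of p x] proj_def[of p y] plus_quot.abs_eq[OF proj_rel proj_rel]
  by (rule proj_eqI, rule qrelI) (simp_all add: p adm_0 adm_closed(2,4))

lemma proj_mult: "x \<in> fst p \<Longrightarrow> y \<in> fst p \<Longrightarrow> proj p (x * y) = proj p x * proj p y"
  unfolding proj_def[of p x] proj_def[of p y] times_quot.abs_eq[OF proj_rel proj_rel]
  by (rule proj_eqI, rule qrelI) (simp_all add: p adm_0 adm_closed(3,4))

lemma proj_minus: "x \<in> fst p \<Longrightarrow> proj p (- x) = - proj p x"
  unfolding proj_def[of p x] uminus_quot.abs_eq[OF proj_rel]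
  by (rule proj_eqI, rule qrelI) (simp_all add: p adm_0 adm_closed(4) adm_uminus)

lemma proj_diff: "x \<in> fst p \<Longrightarrow> y \<in> fst p \<Longrightarrow> proj p (x - y) = proj p x - proj p y"
  unfolding proj_def[of p x] proj_def[of p y] minus_quot.abs_eq[OF proj_rel proj_rel]
  by (rule proj_eqI, rule qrelI) (simp_all add: p adm_0 adm_closed(4) adm_minus)

lemma proj_rsc: "x \<in> fst p \<Longrightarrow> proj p (rsc r * x) = r *\<^sub>R proj p x"
  unfolding proj_def[of p x] scaleR_quot.abs_eq[OF proj_rel]
  by (rule proj_eqI, rule qrelI) (simp_all add: p adm_0 adm_closed(1,3,4))

lemma proj_0: "proj p 0 = 0"
  unfolding zero_quot_def
  by (simp add: proj_def)

end

section \<open>Quantum matrices\<close>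

text \<open>The unit \<open>e\<close> is a parameter because the relations are read inside one
  factor of \<open>quot\<close>, where the image of 1 is not the unit of the ring. The locale serves
  two quotients, by the exact ideal and by null sequences.\<close>

locale quantum_matrix =
  fixes q :: real and e :: "'b::real_algebra" and u us :: "index \<Rightarrow> index \<Rightarrow> 'b"
  assumes q_pos: "q > 0"
    and unit: "e * e = e" "e * u i j = u i j" "u i j * e = u i j"
    and col: "ix i < ix j \<Longrightarrow> u i k * u j k = q *\<^sub>R (u j k * u i k)"
    and row: "ix i < ix j \<Longrightarrow> u k i * u k j = q *\<^sub>R (u k j * u k i)"
    and anti: "ix i < ix j \<Longrightarrow> ix k < ix l \<Longrightarrow> u i l * u j k = u j k * u i l"
    and diag: "ix i < ix j \<Longrightarrow> ix k < ix l \<Longrightarrow> u i k * u j l = u j l * u i k + (q - 1 / q) *\<^sub>R (u i l * u j k)"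
    and det: "u I1 I1 * u I2 I2 * u I3 I3 - q *\<^sub>R (u I1 I1 * u I2 I3 * u I3 I2)
      - q *\<^sub>R (u I1 I2 * u I2 I1 * u I3 I3) + (q * q) *\<^sub>R (u I1 I2 * u I2 I3 * u I3 I1)
      + (q * q) *\<^sub>R (u I1 I3 * u I2 I1 * u I3 I2) - (q * q * q) *\<^sub>R (u I1 I3 * u I2 I2 * u I3 I1) = e"
    and us_minor: "ix k1 < ix k2 \<Longrightarrow> {k1, k2} = UNIV - {i} \<Longrightarrow> ix l1 < ix l2 \<Longrightarrow> {l1, l2} = UNIV - {j} \<Longrightarrow>
      us i j = ((- q) powi (int (ix j) - int (ix i))) *\<^sub>R (u k1 l1 * u k2 l2 - q *\<^sub>R (u k1 l2 * u k2 l1))"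
begin

lemma UNIV_index: "(UNIV :: index set) = {I1, I2, I3}"
  using index.exhaust by auto

definition Q :: "real \<Rightarrow> real" where "Q a = q powr a"

lemma Q_add: "Q a * Q b = Q (a + b)" and Q_0: "Q 0 = 1"
  using q_pos by (simp_all add: Q_def powr_add)

lemma scaleR_Q: "Q a *\<^sub>R (Q b *\<^sub>R (x::'b)) = Q (a + b) *\<^sub>R x"
  by (simp add: Q_add)

lemma scaleR_q:
  "q *\<^sub>R (x::'b) = Q 1 *\<^sub>R x" "(q - 1 / q) *\<^sub>R x = Q 1 *\<^sub>R x - Q (- 1) *\<^sub>R x"
  "(q * q) *\<^sub>R x = Q 2 *\<^sub>R x" "(q * q * q) *\<^sub>R x = Q 3 *\<^sub>R x"
proof -
  have "Q 1 * Q 1 = Q 2" "Q 1 * Q 1 * Q 1 = Q 3" by (simp_all add: Q_add)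
  moreover have "Q 1 = q" "Q (- 1) = 1 / q"
    using q_pos by (simp_all add: Q_def powr_minus_divide)
  ultimately show "q *\<^sub>R (x::'b) = Q 1 *\<^sub>R x" "(q - 1 / q) *\<^sub>R x = Q 1 *\<^sub>R x - Q (- 1) *\<^sub>R x"
    "(q * q) *\<^sub>R x = Q 2 *\<^sub>R x" "(q * q * q) *\<^sub>R x = Q 3 *\<^sub>R x"
    by (simp_all add: scaleR_left_diff_distrib)
qed

lemmas rels = col[unfolded scaleR_q] row[unfolded scaleR_q] anti diag[unfolded scaleR_q]

text \<open>The relations oriented so as to sort letters by row and then by column. With
  \<open>swap_mult\<close> for longer words and \<open>det_solved\<close> for the diagonal monomial
  they rewrite towards sorted words, and the identities below follow by comparing the
  results.\<close>

lemma swap: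
  "ix i < ix j \<Longrightarrow> u j k * u i k = Q (- 1) *\<^sub>R (u i k * u j k)"
  "ix i < ix j \<Longrightarrow> u k j * u k i = Q (- 1) *\<^sub>R (u k i * u k j)"
  "ix i < ix j \<Longrightarrow> ix k < ix l \<Longrightarrow> u j k * u i l = u i l * u j k"
  "ix i < ix j \<Longrightarrow> ix k < ix l \<Longrightarrow> u j l * u i k = u i k * u j l - Q 1 *\<^sub>R (u i l * u j k) + Q (- 1) *\<^sub>R (u i l * u j k)"
  by (simp_all only: rels(1,2,4)) (simp_all add: Q_add Q_0 anti[of i j k l])

lemma swap_mult:
  "ix i < ix j \<Longrightarrow> u j k * (u i k * x) = Q (- 1) *\<^sub>R (u i k * (u j k * x))"
  "ix i < ix j \<Longrightarrow> u k j * (u k i * x) = Q (- 1) *\<^sub>R (u k i * (u k j * x))"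
  "ix i < ix j \<Longrightarrow> ix k < ix l \<Longrightarrow> u j k * (u i l * x) = u i l * (u j k * x)"
  "ix i < ix j \<Longrightarrow> ix k < ix l \<Longrightarrow> u j l * (u i k * x) =
     u i k * (u j l * x) - Q 1 *\<^sub>R (u i l * (u j k * x)) + Q (- 1) *\<^sub>R (u i l * (u j k * x))"
  by (simp_all add: swap left_diff_distrib distrib_right flip: mult.assoc)

lemma det_solved: "u I1 I1 * (u I2 I2 * u I3 I3) = e + Q 1 *\<^sub>R (u I1 I1 * (u I2 I3 * u I3 I2))
      + Q 1 *\<^sub>R (u I1 I2 * (u I2 I1 * u I3 I3)) - Q 2 *\<^sub>R (u I1 I2 * (u I2 I3 * u I3 I1))
      - Q 2 *\<^sub>R (u I1 I3 * (u I2 I1 * u I3 I2)) + Q 3 *\<^sub>R (u I1 I3 * (u I2 I2 * u I3 I1))"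
  using det unfolding scaleR_q by (simp add: algebra_simps)

lemma us_explicit:
  "us I1 I1 = u I2 I2 * u I3 I3 - Q 1 *\<^sub>R (u I2 I3 * u I3 I2)"
  "us I1 I2 = - (Q 1 *\<^sub>R (u I2 I1 * u I3 I3 - Q 1 *\<^sub>R (u I2 I3 * u I3 I1)))"
  "us I1 I3 = Q 2 *\<^sub>R (u I2 I1 * u I3 I2 - Q 1 *\<^sub>R (u I2 I2 * u I3 I1))"
  "us I2 I1 = - (Q (- 1) *\<^sub>R (u I1 I2 * u I3 I3 - Q 1 *\<^sub>R (u I1 I3 * u I3 I2)))"
  "us I2 I2 = u I1 I1 * u I3 I3 - Q 1 *\<^sub>R (u I1 I3 * u I3 I1)"
  "us I2 I3 = - (Q 1 *\<^sub>R (u I1 I1 * u I3 I2 - Q 1 *\<^sub>R (u I1 I2 * u I3 I1)))"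
  "us I3 I1 = Q (- 2) *\<^sub>R (u I1 I2 * u I2 I3 - Q 1 *\<^sub>R (u I1 I3 * u I2 I2))"
  "us I3 I2 = - (Q (- 1) *\<^sub>R (u I1 I1 * u I2 I3 - Q 1 *\<^sub>R (u I1 I3 * u I2 I1)))"
  "us I3 I3 = u I1 I1 * u I2 I2 - Q 1 *\<^sub>R (u I1 I2 * u I2 I1)"
proof -
  have ix_less: "((1::nat) < 2) = True" "((2::nat) < 3) = True" "((1::nat) < 3) = True"
    by simp_all
  have ix_diff: "int 1 - int 1 = 0" "int 2 - int 1 = 1" "int 3 - int 1 = 2" "int 1 - int 2 = - 1"
    "int 2 - int 2 = 0" "int 3 - int 2 = 1" "int 1 - int 3 = - 2" "int 2 - int 3 = - 1" "int 3 - int 3 = 0"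
    by simp_all
  have 2: "(- q) powi 0 = 1" "(- q) powi 2 = Q 2" "(- q) powi (- 2) = Q (- 2)" "(- q) powi 1 = - Q 1" "(- q) powi (- 1) = - Q (- 1)"
    using q_pos by (simp_all add: Q_def power_int_minus powr_minus powr_minus_divide power_int_def field_simps)
  have "{I2, I3} = UNIV - {I1}" "{I1, I3} = UNIV - {I2}" "{I1, I2} = UNIV - {I3}"
    by (auto simp: UNIV_index)
  note us = us_minor[OF _ this(1) _ this(1)] us_minor[OF _ this(1) _ this(2)] us_minor[OF _ this(1) _ this(3)]
    us_minor[OF _ this(2) _ this(1)] us_minor[OF _ this(2) _ this(2)] us_minor[OF _ this(2) _ this(3)]
    us_minor[OF _ this(3) _ this(1)] us_minor[OF _ this(3) _ this(2)] us_minor[OF _ this(3) _ this(3)]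
  show 
  "us I1 I1 = u I2 I2 * u I3 I3 - Q 1 *\<^sub>R (u I2 I3 * u I3 I2)"
  "us I1 I2 = - (Q 1 *\<^sub>R (u I2 I1 * u I3 I3 - Q 1 *\<^sub>R (u I2 I3 * u I3 I1)))"
  "us I1 I3 = Q 2 *\<^sub>R (u I2 I1 * u I3 I2 - Q 1 *\<^sub>R (u I2 I2 * u I3 I1))"
  "us I2 I1 = - (Q (- 1) *\<^sub>R (u I1 I2 * u I3 I3 - Q 1 *\<^sub>R (u I1 I3 * u I3 I2)))"
  "us I2 I2 = u I1 I1 * u I3 I3 - Q 1 *\<^sub>R (u I1 I3 * u I3 I1)"
  "us I2 I3 = - (Q 1 *\<^sub>R (u I1 I1 * u I3 I2 - Q 1 *\<^sub>R (u I1 I2 * u I3 I1)))"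
  "us I3 I1 = Q (- 2) *\<^sub>R (u I1 I2 * u I2 I3 - Q 1 *\<^sub>R (u I1 I3 * u I2 I2))"
  "us I3 I2 = - (Q (- 1) *\<^sub>R (u I1 I1 * u I2 I3 - Q 1 *\<^sub>R (u I1 I3 * u I2 I1)))"
  "us I3 I3 = u I1 I1 * u I2 I2 - Q 1 *\<^sub>R (u I1 I2 * u I2 I1)"
    by (simp_all only: us scaleR_q ix.simps ix_less) (simp_all only: ix_diff 2 scaleR_one scaleR_minus_left)
qed

lemmas normalise = us_explicit mult.assoc swap swap_mult det_solved scaleR_Q Q_add Q_0
  scaleR_right_distrib scaleR_right_diff_distrib distrib_left distrib_right left_diff_distrib right_diff_distrib

lemma sum_u_us:
  "u i I1 * us j I1 + u i I2 * us j I2 + u i I3 * us j I3 = (if i = j then e else 0)"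
  by (cases i; cases j) (simp_all add: normalise)

lemma sum_us_u:
  "us I1 i * u I1 j + us I2 i * u I2 j + us I3 i * u I3 j = (if i = j then e else 0)"
  by (cases i; cases j) (simp_all add: normalise)

text \<open>Reversing the factors in the orthogonality of rows costs the square of the antipode,
  which is not the identity; the weights \<open>q^{6-2k}\<close> compensate for it. Their values
  \<open>q^4\<close>, \<open>q^2\<close>, 1 are the squares of the powers of \<open>q\<close> built
  into \<phi>.\<close>

lemma weighted_sum_us_u:
  "Q 4 *\<^sub>R (us i I1 * u j I1) + Q 2 *\<^sub>R (us i I2 * u j I2) + us i I3 * u j I3
    = (if i = j then Q (6 - 2 * ix i) *\<^sub>R e else 0)"
  by (cases i; cases j) (simp_all add: normalise)

lemma column_comm:
  "us I3 I1 * u I3 I1 = u I3 I1 * us I3 I1"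
  "us I3 I1 * u I1 I1 = Q (- 1) *\<^sub>R (u I1 I1 * us I3 I1)"
  "us I3 I1 * u I2 I1 = Q (- 1) *\<^sub>R (u I2 I1 * us I3 I1)"
  "us I1 I1 * u I2 I1 = Q (- 1) *\<^sub>R (u I2 I1 * us I1 I1)"
  "us I1 I1 * u I3 I1 = Q (- 1) *\<^sub>R (u I3 I1 * us I1 I1)"
  "us I2 I1 * u I1 I1 = Q (- 1) *\<^sub>R (u I1 I1 * us I2 I1)"
  by (simp_all add: normalise)

text \<open>Among the first-column identities this is the one that makes the two diagonal entries of
  each curvature block agree up to the right power of \<open>q\<close>.\<close>

lemma column_balance:
  "u I2 I1 * us I2 I1 + us I1 I1 * u I1 I1 = u I1 I1 * us I1 I1 + Q 2 *\<^sub>R (us I2 I1 * u I2 I1)"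
  by (simp add: normalise)

lemma minors:
  "u I2 I2 * u I3 I3 - Q 1 *\<^sub>R (u I2 I3 * u I3 I2) = us I1 I1"
  "u I1 I2 * u I3 I3 - Q 1 *\<^sub>R (u I1 I3 * u I3 I2) = - (Q 1 *\<^sub>R us I2 I1)"
  by (simp_all add: normalise)

end

section \<open>The ideal of \<open>SU\<^sub>q(3)\<close>\<close>

lemma UNIV_index: "(UNIV :: index set) = {I1, I2, I3}"
  using index.exhaust by auto

instance index :: finite
  by standard (simp add: UNIV_index)

lemma inversions_eq:
  "inversions p = of_bool (ix (p I2) < ix (p I1)) + of_bool (ix (p I3) < ix (p I1)) + of_bool (ix (p I3) < ix (p I2))"
proof -
  have "{(i, j). ix i < ix j \<and> ix (p j) < ix (p i)}
    = (if ix (p I2) < ix (p I1) then {(I1, I2)} else {}) \<union> (if ix (p I3) < ix (p I1) then {(I1, I3)} else {})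
      \<union> (if ix (p I3) < ix (p I2) then {(I2, I3)} else {})" (is "?L = ?R")
  proof (rule set_eqI)
    fix x :: "index \<times> index"
    show "x \<in> ?L \<longleftrightarrow> x \<in> ?R"
      by (cases x; cases "fst x"; cases "snd x") auto
  qed
  then show ?thesis
    unfolding inversions_def by simp
qed

lemma case_index_eq_iff:
  "(case_index a b c :: index \<Rightarrow> index) = case_index a' b' c' \<longleftrightarrow> a = a' \<and> b = b' \<and> c = c'"
  by (metis index.case)

lemma bij_index: "{p :: index \<Rightarrow> index. bij p} = {case_index I1 I2 I3, case_index I1 I3 I2, case_index I2 I1 I3,
    case_index I2 I3 I1, case_index I3 I1 I2, case_index I3 I2 I1}" (is "_ = ?R")
proof (rule set_eqI)
  fix p :: "index \<Rightarrow> index"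
  have p: "p = case_index (p I1) (p I2) (p I3)"
    by (rule ext) (simp split: index.split)
  have "bij p \<longleftrightarrow> inj p"
    unfolding bij_def using finite_UNIV_inj_surj[of p] finite_UNIV_surj_inj[of p] by auto
  also have "\<dots> \<longleftrightarrow> p I1 \<noteq> p I2 \<and> p I1 \<noteq> p I3 \<and> p I2 \<noteq> p I3"
    unfolding inj_on_def UNIV_index by auto
  also have "\<dots> \<longleftrightarrow> p \<in> ?R"
    by (subst (7) p) (cases "p I1"; cases "p I2"; cases "p I3"; simp add: case_index_eq_iff)
  finally show "p \<in> {p. bij p} \<longleftrightarrow> p \<in> ?R" by simp
qed

lemma complement_pair:
  "ix k1 < ix k2 \<Longrightarrow> {k1, k2} = UNIV - {i} \<longleftrightarrow>
    (i = I1 \<and> k1 = I2 \<and> k2 = I3) \<or> (i = I2 \<and> k1 = I1 \<and> k2 = I3) \<or> (i = I3 \<and> k1 = I1 \<and> k2 = I2)"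
  unfolding UNIV_index by (cases i; cases k1; cases k2) auto

lemma det_relator:
  "(\<Sum>p\<in>{p. bij p}. rscal ((- q) ^ inversions p) * gen (U I1 (p I1)) * gen (U I2 (p I2)) * gen (U I3 (p I3))) - 1
    = gen (U I1 I1) * gen (U I2 I2) * gen (U I3 I3) - rscal q * gen (U I1 I1) * gen (U I2 I3) * gen (U I3 I2)
      - rscal q * gen (U I1 I2) * gen (U I2 I1) * gen (U I3 I3)
      + rscal (q * q) * gen (U I1 I2) * gen (U I2 I3) * gen (U I3 I1)
      + rscal (q * q) * gen (U I1 I3) * gen (U I2 I1) * gen (U I3 I2)
      - rscal (q * q * q) * gen (U I1 I3) * gen (U I2 I2) * gen (U I3 I1) - 1"
  unfolding bij_index
  by (simp add: case_index_eq_iff inversions_eq rscal_minus power2_eq_square power3_eq_cube numeral_eq_Suc mult.assoc)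

lemma emb_hom: "emb (a + b) = emb a + emb b" "emb (a - b) = emb a - emb b" "emb (- a) = - emb a"
  "emb (a * b) = emb a * emb b" "emb 0 = 0" "emb 1 = 1" "emb (rscal r) = rsc r"
  by (simp_all add: emb_def rsc_def fun_eq_iff)

locale suq_quotient =
  fixes q :: real and p :: "calg set \<times> calg set"
  assumes q_pos: "q > 0" and adm: "admissible p" and emb_mem: "emb a \<in> fst p"
    and ideal_mem: "r \<in> suq_ideal q \<Longrightarrow> emb r \<in> snd p"
begin

definition P :: "falg \<Rightarrow> quot" where "P a = proj p (emb a)"

lemma P_hom: "P (a + b) = P a + P b" "P (a - b) = P a - P b" "P (- a) = - P a" "P (a * b) = P a * P b" "P 0 = 0"
  by (simp_all add: P_def emb_hom proj_add proj_diff proj_minus proj_mult proj_0 adm emb_mem)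

lemma P_rscal: "P (rscal r * a) = r *\<^sub>R P a"
  by (simp add: P_def emb_hom proj_rsc adm emb_mem)

lemma P_rscal_only: "P (rscal r) = r *\<^sub>R P 1"
  using P_rscal[of r 1] by simp

lemma P_one: "P 1 * P a = P a" "P a * P 1 = P a" "P 1 * (P a * x) = P a * x"
  by (simp_all flip: P_hom(4) mult.assoc)

lemma P_eq_0: "r \<in> suq_ideal q \<Longrightarrow> P r = 0"
  using proj_eq_iff[OF adm emb_mem, of 0 r] ideal_mem adm_0[OF adm]
  unfolding P_def by (simp add: proj_0 adm)

lemma P_relator: "r \<in> suq_relators q \<Longrightarrow> P r = 0"
  by (intro P_eq_0 suq_ideal.base)

sublocale quantum_matrix q "P 1" "\<lambda>i j. P (gen (U i j))" "\<lambda>i j. P (gen (Us i j))"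
proof
  show "q > 0" by (rule q_pos)
  show "P 1 * P 1 = P 1" "P 1 * P (gen (U i j)) = P (gen (U i j))" "P (gen (U i j)) * P 1 = P (gen (U i j))" for i j
    by (simp_all add: P_one)
  fix i j k l :: index
  note s = P_hom P_rscal_only P_one mult.assoc
  show "ix i < ix j \<Longrightarrow> P (gen (U i k)) * P (gen (U j k)) = q *\<^sub>R (P (gen (U j k)) * P (gen (U i k)))"
    using P_relator[OF suq_relators.intros(1)[of i j k q]] by (simp add: s)
  show "ix i < ix j \<Longrightarrow> P (gen (U k i)) * P (gen (U k j)) = q *\<^sub>R (P (gen (U k j)) * P (gen (U k i)))"
    using P_relator[OF suq_relators.intros(2)[of i j k q]] by (simp add: s)
  show "ix i < ix j \<Longrightarrow> ix k < ix l \<Longrightarrow> P (gen (U i l)) * P (gen (U j k)) = P (gen (U j k)) * P (gen (U i l))"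
    using P_relator[OF suq_relators.intros(3)[of i j k l q]] by (simp add: s)
  show "ix i < ix j \<Longrightarrow> ix k < ix l \<Longrightarrow> P (gen (U i k)) * P (gen (U j l)) = P (gen (U j l)) * P (gen (U i k))
      + (q - 1 / q) *\<^sub>R (P (gen (U i l)) * P (gen (U j k)))"
    using P_relator[OF suq_relators.intros(4)[of i j k l q]] by (simp add: s algebra_simps)
  show "P (gen (U I1 I1)) * P (gen (U I2 I2)) * P (gen (U I3 I3))
      - q *\<^sub>R (P (gen (U I1 I1)) * P (gen (U I2 I3)) * P (gen (U I3 I2)))
      - q *\<^sub>R (P (gen (U I1 I2)) * P (gen (U I2 I1)) * P (gen (U I3 I3)))
      + (q * q) *\<^sub>R (P (gen (U I1 I2)) * P (gen (U I2 I3)) * P (gen (U I3 I1)))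
      + (q * q) *\<^sub>R (P (gen (U I1 I3)) * P (gen (U I2 I1)) * P (gen (U I3 I2)))
      - (q * q * q) *\<^sub>R (P (gen (U I1 I3)) * P (gen (U I2 I2)) * P (gen (U I3 I1))) = P 1"
    using P_relator[OF suq_relators.intros(5)[of q]] unfolding det_relator by (simp add: s)
  fix k1 k2 l1 l2 :: index
  assume "ix k1 < ix k2" "{k1, k2} = UNIV - {i}" "ix l1 < ix l2" "{l1, l2} = UNIV - {j}"
  from P_relator[OF suq_relators.intros(6)[OF this]]
  show "P (gen (Us i j)) = (- q) powi (int (ix j) - int (ix i)) *\<^sub>R
      (P (gen (U k1 l1)) * P (gen (U k2 l2)) - q *\<^sub>R (P (gen (U k1 l2)) * P (gen (U k2 l1))))"
    by (simp add: s right_diff_distrib scaleR_right_diff_distrib mult.commute)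
qed

lemma P_qs: "P (qs q a) = Q a *\<^sub>R P 1"
  by (simp add: qs_def P_rscal_only Q_def)

end

text \<open>Constant sequences modulo this termwise ideal represent the coordinate algebra itself,
  so that membership in \<open>suq_ideal q\<close> can be proved by rewriting in
  \<open>quot\<close>.\<close>

definition ideal_pair :: "real \<Rightarrow> calg set \<times> calg set" where
  "ideal_pair q = (UNIV, {x. \<forall>n. x n \<in> suq_ideal q})"

lemma suq_quotient_ideal: "q > 0 \<Longrightarrow> suq_quotient q (ideal_pair q)"
  by unfold_locales (auto simp: ideal_pair_def admissible_def emb_def intro: suq_ideal.intros)

lemma ideal_iff_P: "q > 0 \<Longrightarrow> r \<in> suq_ideal q \<longleftrightarrow> suq_quotient.P (ideal_pair q) r = 0"
proof -
  assume q: "q > 0"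
  interpret suq_quotient q "ideal_pair q" by (rule suq_quotient_ideal[OF q])
  have "P r = 0 \<longleftrightarrow> proj (ideal_pair q) (emb r) = proj (ideal_pair q) 0"
    by (simp add: P_def proj_0 adm)
  also have "\<dots> \<longleftrightarrow> emb r - 0 \<in> snd (ideal_pair q)"
    by (rule proj_eq_iff[OF adm]) (simp_all add: ideal_pair_def)
  finally show ?thesis by (simp add: ideal_pair_def emb_def)
qed

lemma act_rscal: "act q (K i) (rscal r) = rscal r" "act q (Kinv i) (rscal r) = rscal r"
  "act q (E i) (rscal r) = 0" "act q (F i) (rscal r) = 0"
  by (simp_all add: rscal_def act_scal)
lemma rscal_qs:
  assumes "q > 0"
  shows "rscal q = qs q 1" "rscal (q - 1 / q) = qs q 1 - qs q (- 1)" "rscal (q * q) = qs q 2" "rscal (q * (q * q)) = qs q 3"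
proof -
  show *: "rscal q = qs q 1" "rscal (q - 1 / q) = qs q 1 - qs q (- 1)"
    using rscal_eq_qs[OF assms] rscal_add[of q "- (1 / q)"] by (simp_all add: rscal_minus)
  show "rscal (q * q) = qs q 2" "rscal (q * (q * q)) = qs q 3"
    by (simp_all add: rscal_mult * qs_qs)
qed

text \<open>The weights of the three rows add up to zero, so a cofactor has the weight of the
  adjoint entry that it represents.\<close>

lemma us_relator:
  assumes "ix k1 < ix k2" "{k1, k2} = UNIV - {i}" "ix l1 < ix l2" "{l1, l2} = UNIV - {j}"
  shows "kexp n k1 + kexp n k2 = - kexp n i"
  using assms(1,2) unfolding complement_pair[OF assms(1)] by (cases n) (auto simp: kexp_def)

lemma act_K_relator:
  assumes q: "q > 0" and r: "r \<in> suq_relators q"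
  shows "\<exists>a. act q (K n) r = qs q a * r" "\<exists>a. act q (Kinv n) r = qs q a * r"
proof -
  note expand = act_diff act_mult_K act_mult_Kinv act_gen act_1 lact_qs[OF q] act_rscal
  note collect = mult.assoc qs_left_comm[of "gen l" for l] qs_left_comm[of "rscal l" for l] qs_qs qs_qs_mult
    right_diff_distrib
  have "\<exists>a. act q (K n) r = qs q a * r \<and> act q (Kinv n) r = qs q (- a) * r"
    using r
  proof cases
    case (1 i j k)
    show ?thesis
      by (rule exI[of _ "kexp n i + kexp n j"]) (simp add: 1(1) expand collect add.commute)
  next
    case (2 i j k)
    show ?thesis
      by (rule exI[of _ "kexp n k + kexp n k"]) (simp add: 2(1) expand collect add.commute)
  next
    case (3 i j k l)
    show ?thesis
      by (rule exI[of _ "kexp n i + kexp n j"]) (simp add: 3(1) expand collect add.commute)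
  next
    case (4 i j k l)
    show ?thesis
      by (rule exI[of _ "kexp n i + kexp n j"]) (simp add: 4(1) expand collect add.commute)
  next
    case 5
    show ?thesis unfolding 5 det_relator
      by (intro exI[of _ 0]; cases n) (simp_all add: act_add expand collect qs_0[OF q] kexp_def)
  next
    case (6 k1 k2 i l1 l2 j)
    have "kexp n i = - kexp n k1 - kexp n k2"
      using us_relator[OF 6(2-5), of n] by simp
    then show ?thesis
      by (intro exI[of _ "kexp n k1 + kexp n k2"]) (simp add: 6(1) expand collect add.commute)
  qed
  then show "\<exists>a. act q (K n) r = qs q a * r" "\<exists>a. act q (Kinv n) r = qs q a * r"
    by blast+
qed

lemma all_index: "(\<forall>i. R i) \<longleftrightarrow> R I1 \<and> R I2 \<and> R I3"
  by (metis index.exhaust)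

text \<open>Homogeneity under the weights settles \<open>K\<close> and its inverse. For
  \<open>E\<close> and \<open>F\<close> the image of a relator is shown to vanish in the algebraic
  quotient, by rewriting for every choice of the finitely many indices.\<close>

lemma act_relator:
  assumes q: "q > 0" and r: "r \<in> suq_relators q"
  shows "act q h r \<in> suq_ideal q"
proof -
  interpret suq_quotient q "ideal_pair q" by (rule suq_quotient_ideal[OF q])
  note s = act_diff act_add act_mult act_gen lact_qs[OF q] act_rscal act_qs P_hom P_qs P_one kexp_def
    rscal_qs[OF q] normalise
  let ?EF = "\<lambda>r. P (act q (E N1) r) = 0 \<and> P (act q (E N2) r) = 0 \<and> P (act q (F N1) r) = 0 \<and> P (act q (F N2) r) = 0"
  have ix_less: "((1::nat) < 1) = False" "((1::nat) < 2) = True" "((1::nat) < 3) = True" "((2::nat) < 1) = False"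
    "((2::nat) < 2) = False" "((2::nat) < 3) = True" "((3::nat) < 1) = False" "((3::nat) < 2) = False"
    "((3::nat) < 3) = False"
    by simp_all
  have *: "\<forall>i j k. ix i < ix j \<longrightarrow> ?EF (gen (U i k) * gen (U j k) - rscal q * gen (U j k) * gen (U i k))"
    "\<forall>i j k. ix i < ix j \<longrightarrow> ?EF (gen (U k i) * gen (U k j) - rscal q * gen (U k j) * gen (U k i))"
    "\<forall>i j k l. ix i < ix j \<and> ix k < ix l \<longrightarrow> ?EF (gen (U i l) * gen (U j k) - gen (U j k) * gen (U i l))"
    "\<forall>i j k l. ix i < ix j \<and> ix k < ix l \<longrightarrow> ?EF (gen (U i k) * gen (U j l) - gen (U j l) * gen (U i k)
       - rscal (q - 1 / q) * gen (U i l) * gen (U j k))"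
    unfolding all_index ix.simps ix_less simp_thms by (intro conjI; simp add: s)+
  have ix_diff: "int 1 - int 1 = 0" "int 2 - int 1 = 1" "int 3 - int 1 = 2" "int 1 - int 2 = - 1"
    "int 2 - int 2 = 0" "int 3 - int 2 = 1" "int 1 - int 3 = - 2" "int 2 - int 3 = - 1" "int 3 - int 3 = 0"
    by simp_all
  \<comment> \<open>The two indices complementary to \<open>i\<close>, in increasing order, which
    gives all nine cofactor relations one form.\<close>
  let ?m = "\<lambda>i. case i of I1 \<Rightarrow> I2 | _ \<Rightarrow> I1" and ?n = "\<lambda>i. case i of I3 \<Rightarrow> I2 | _ \<Rightarrow> I3"
  have powi: "rscal ((- q) powi 0) = qs q 0" "rscal ((- q) powi 2) = qs q 2" "rscal ((- q) powi (- 2)) = qs q (- 2)"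
    "rscal ((- q) powi 1) = - qs q 1" "rscal ((- q) powi (- 1)) = - qs q (- 1)"
    using q by (simp_all add: qs_def rscal_minus power_int_def powr_minus divide_inverse power_inverse
        flip: rscal_minus)
  have **: "\<forall>i j. ?EF (gen (Us i j) - rscal ((- q) powi (int (ix j) - int (ix i)))
       * (gen (U (?m i) (?m j)) * gen (U (?n i) (?n j)) - rscal q * gen (U (?m i) (?n j)) * gen (U (?n i) (?m j))))"
    unfolding all_index
    by (intro conjI; simp only: index.case ix.simps ix_diff powi; simp add: s)
  have EF: "?EF r"
    using r
  proof cases
    case (1 i j k)
    then show ?thesis using *(1) by blast
  next
    case (2 i j k)
    then show ?thesis using *(2) by blast
  next
    case (3 i j k l)
    then show ?thesis using *(3) by blast
  next
    case (4 i j k l)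
    then show ?thesis using *(4) by blast
  next
    case 5
    show ?thesis unfolding 5 det_relator
      by (intro conjI; simp add: s act_1 mult.assoc[of q q q])
  next
    case (6 k1 k2 i l1 l2 j)
    have "k1 = ?m i" "k2 = ?n i" "l1 = ?m j" "l2 = ?n j"
      using 6(3,5) unfolding complement_pair[OF 6(2)] complement_pair[OF 6(4)] by auto
    then show ?thesis using **[rule_format, of i j] unfolding 6(1) by simp
  qed
  have "P (act q h r) = 0"
  proof (cases h)
    case (K n)
    then show ?thesis
      using act_K_relator(1)[OF q r, of n] P_relator[OF r] by (auto simp: P_hom)
  next
    case (Kinv n)
    then show ?thesis
      using act_K_relator(2)[OF q r, of n] P_relator[OF r] by (auto simp: P_hom)
  next
    case (E n)
    with EF show ?thesis by (cases n) simp_all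
  next
    case (F n)
    with EF show ?thesis by (cases n) simp_all
  qed
  then show ?thesis by (simp add: ideal_iff_P[OF q])
qed

text \<open>The action descends to the coordinate algebra; closure of the ideal under
  \<open>fstar\<close> is matched by \<open>act_fstar\<close>.\<close>

lemma act_ideal:
  assumes q: "q > 0" and r: "r \<in> suq_ideal q"
  shows "act q h r \<in> suq_ideal q"
  using r
proof (induction r arbitrary: h rule: suq_ideal.induct)
  case (base r)
  then show ?case by (rule act_relator[OF q])
next
  case (star r)
  then show ?case by (simp add: act_fstar[OF q] suq_ideal.star suq_ideal.left)
next
  case (left r a)
  then show ?case by (cases h) (simp_all add: act_mult suq_ideal.left suq_ideal.add)
next
  case (right r a)
  then show ?case by (cases h) (simp_all add: act_mult suq_ideal.right suq_ideal.add)
qed (simp_all add: act_add suq_ideal.zero suq_ideal.add)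

lemma acts_Nil [simp]: "acts q [] a = a" and acts_Cons: "acts q (h # hs) a = acts q hs (act q h a)"
  by (simp_all add: acts_def)

lemma acts_ideal: "q > 0 \<Longrightarrow> r \<in> suq_ideal q \<Longrightarrow> acts q hs r \<in> suq_ideal q"
  by (induction hs arbitrary: r) (simp_all add: acts_Cons act_ideal)

lemma unitary_ideal:
  assumes "q > 0"
  shows "gen (Us I1 j) * gen (U I1 j) + gen (Us I2 j) * gen (U I2 j) + gen (Us I3 j) * gen (U I3 j) - 1 \<in> suq_ideal q"
    and "gen (U i I1) * gen (Us i I1) + gen (U i I2) * gen (Us i I2) + gen (U i I3) * gen (Us i I3) - 1 \<in> suq_ideal q"
proof -
  interpret suq_quotient q "ideal_pair q" by (rule suq_quotient_ideal[OF assms])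
  show "gen (Us I1 j) * gen (U I1 j) + gen (Us I2 j) * gen (U I2 j) + gen (Us I3 j) * gen (U I3 j) - 1 \<in> suq_ideal q"
    "gen (U i I1) * gen (Us i I1) + gen (U i I2) * gen (Us i I2) + gen (U i I3) * gen (Us i I3) - 1 \<in> suq_ideal q"
    using sum_us_u[of j j] sum_u_us[of i i] by (simp_all add: ideal_iff_P[OF assms] P_hom)
qed

section \<open>States and the universal norm\<close>

primrec eps :: "letter \<Rightarrow> complex" where
  "eps (U i j) = of_bool (i = j)" | "eps (Us i j) = of_bool (i = j)"

text \<open>The counit \<open>u^i_j \<mapsto> \<delta>_ij\<close> is a character compatible with
  adjoints and hence a state. It witnesses that the supremum in \<open>cnorm\<close> is over a
  non-empty set.\<close>

definition counit_state :: "falg \<Rightarrow> complex" where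
  "counit_state a = (\<Sum>w\<in>Poly_Mapping.keys a. Poly_Mapping.lookup a w * prod_list (map eps (letters w)))"

lemma counit_state_add: "counit_state (a + b) = counit_state a + counit_state b"
  unfolding counit_state_def by (rule setsum_keys_plus_distrib) (simp_all add: distrib_right)

lemma counit_state_single: "counit_state (Poly_Mapping.single (Word w) c) = c * prod_list (map eps w)"
  by (cases "c = 0") (simp_all add: counit_state_def)

lemma counit_state_mult: "counit_state (a * b) = counit_state a * counit_state b"
proof (induction a rule: falg_single_induct)
  case (single w c)
  show ?case
    by (induction b rule: falg_single_induct)
      (simp_all add: mult_single plus_word_def counit_state_single counit_state_add distrib_left)
qed (simp add: counit_state_add distrib_right)

lemma counit_state_scal: "counit_state (scal c) = c"
  using counit_state_single[of "[]" c] by (simp add: scal_def zero_word_def)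

lemma counit_state_gen: "counit_state (gen l) = eps l"
  using counit_state_single[of "[l]" 1] by (simp add: gen_def)

lemma counit_state_simps:
  "counit_state 0 = 0" "counit_state 1 = 1" "counit_state (- a) = - counit_state a"
  "counit_state (a - b) = counit_state a - counit_state b" "counit_state (rscal r) = of_real r"
  using counit_state_scal[of 0] counit_state_scal[of 1] counit_state_scal[of "- 1"] counit_state_mult[of "scal (- 1)" a]
    counit_state_mult[of "scal (- 1)" b] counit_state_add[of a "- b"]
  by (simp_all add: counit_state_scal scal_minus rscal_def)

lemma counit_state_fstar: "counit_state (fstar a) = cnj (counit_state a)"
proof (induction a rule: falg_single_induct)
  case (single w c)
  have eps: "eps (adj l) = cnj (eps l)" for l by (cases l) simp_all
  have "prod_list (rev (map (\<lambda>l. cnj (eps l)) w)) = cnj (prod_list (map eps w))"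
    by (induction w) (simp_all add: mult.commute)
  then show ?case
    by (simp add: fstar_single counit_state_single rev_map eps comp_def)
qed (simp add: fstar_add counit_state_add)

lemma counit_state_ideal: "r \<in> suq_ideal q \<Longrightarrow> counit_state r = 0"
proof (induction r rule: suq_ideal.induct)
  case (base r)
  note s = counit_state_simps counit_state_add counit_state_mult counit_state_gen
  from base show ?case
  proof cases
    case 5
    then show ?thesis unfolding det_relator by (simp add: s)
  next
    case (6 k1 k2 i l1 l2 j)
    from 6(3,5) show ?thesis
      unfolding 6(1) complement_pair[OF 6(2)] complement_pair[OF 6(4)] by (auto simp: s)
  qed (auto simp: s)
qed (simp_all add: counit_state_simps counit_state_add counit_state_mult counit_state_fstar)

lemma suq_state_counit: "suq_state q counit_state"
  unfolding suq_state_def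
  by (auto simp: counit_state_simps counit_state_add counit_state_mult counit_state_fstar counit_state_ideal
      counit_state_scal complex_is_Real_iff)

text \<open>The length of the class of \<open>a\<close> in the GNS space of
  \<open>f\<close>.\<close>

definition state_norm :: "(falg \<Rightarrow> complex) \<Rightarrow> falg \<Rightarrow> real" where
  "state_norm f a = sqrt (Re (f (fstar a * a)))"

locale positive_state =
  fixes q :: real and f :: "falg \<Rightarrow> complex"
  assumes state: "suq_state q f"
begin

lemma add: "f (a + b) = f a + f b" and scal: "f (scal c * a) = c * f a" and ideal: "r \<in> suq_ideal q \<Longrightarrow> f r = 0"
  and one: "f 1 = 1" and pos: "0 \<le> Re (f (fstar a * a))" and real: "Im (f (fstar a * a)) = 0"
  using state by (auto simp: suq_state_def complex_is_Real_iff)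

lemma minus: "f (- a) = - f a"
  using scal[of "- 1" a] by (simp add: scal_minus)

lemma diff: "f (a - b) = f a - f b"
  using add[of a "- b"] by (simp add: minus)

lemma expand: "f (fstar (a + scal c * b) * (a + scal c * b))
  = f (fstar a * a) + c * f (fstar a * b) + cnj c * f (fstar b * a) + cnj c * c * f (fstar b * b)"
proof -
  have "fstar (a + scal c * b) * (a + scal c * b) = fstar a * a + scal c * (fstar a * b)
      + scal (cnj c) * (fstar b * a) + scal (cnj c) * (scal c * (fstar b * b))"
    by (simp add: fstar_add fstar_mult distrib_left distrib_right mult.assoc add.assoc
        scal_left_comm[of "fstar u" for u])
  then show ?thesis by (simp add: add scal)
qed

text \<open>Polarisation: the values of \<open>f\<close> at the squares of \<open>a + b\<close> and
  \<open>a + \<i> b\<close> have no imaginary part.\<close>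

lemma hermitian: "f (fstar b * a) = cnj (f (fstar a * b))"
proof -
  have "Im (f (fstar a * b)) + Im (f (fstar b * a)) = 0"
    using real[of "a + scal 1 * b"] unfolding expand by (simp add: real)
  moreover have "Re (f (fstar a * b)) = Re (f (fstar b * a))"
    using real[of "a + scal \<i> * b"] unfolding expand by (simp add: real)
  ultimately show ?thesis by (simp add: complex_eq_iff)
qed

lemma norm_sq: "(state_norm f a)\<^sup>2 = Re (f (fstar a * a))" and norm_nonneg: "state_norm f a \<ge> 0"
  by (simp_all add: state_norm_def pos)

lemma cauchy_schwarz: "cmod (f (fstar a * b)) \<le> state_norm f a * state_norm f b"
proof -
  define A B c where "A = Re (f (fstar a * a))" and "B = Re (f (fstar b * b))" and "c = f (fstar a * b)"
  \<comment> \<open>Positivity at \<open>a - s * cnj c * b\<close>, where the phase of the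
    coefficient makes the term linear in \<open>s\<close> real.\<close>
  have *: "0 \<le> A - 2 * s * (cmod c)\<^sup>2 + s\<^sup>2 * (cmod c)\<^sup>2 * B" for s
  proof -
    have "0 \<le> Re (f (fstar (a + scal (- of_real s * cnj c) * b) * (a + scal (- of_real s * cnj c) * b)))"
      by (rule pos)
    also have "\<dots> = A - 2 * s * (cmod c)\<^sup>2 + s\<^sup>2 * (cmod c)\<^sup>2 * B"
      unfolding expand hermitian[of b a] cmod_power2 using real[of b]
      by (simp add: A_def B_def c_def[symmetric] algebra_simps power2_eq_square)
    finally show ?thesis .
  qed
  have "B \<ge> 0" by (simp add: B_def pos)
  have "(cmod c)\<^sup>2 \<le> A * B"
  proof (cases "B = 0")
    case True
    show ?thesis
    proof (rule ccontr)
      assume "\<not> ?thesis"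
      with True have "(cmod c)\<^sup>2 > 0" by simp
      \<comment> \<open>For \<open>B = 0\<close> the expression is affine in \<open>s\<close>, and
        this \<open>s\<close> makes it equal to -1.\<close>
      with *[of "(A + 1) / (2 * (cmod c)\<^sup>2)"] True show False by simp
    qed
  next
    case False
    with \<open>B \<ge> 0\<close> have "B > 0" by simp
    \<comment> \<open>The minimiser of the quadratic polynomial in \<open>s\<close>.\<close>
    with *[of "1 / B"] have "0 \<le> A - (cmod c)\<^sup>2 / B"
      by (simp add: field_simps power2_eq_square)
    with \<open>B > 0\<close> show ?thesis by (simp add: field_simps)
  qed
  then have "(cmod c)\<^sup>2 \<le> (state_norm f a * state_norm f b)\<^sup>2"
    by (simp add: power_mult_distrib norm_sq A_def B_def)
  then show ?thesis
    unfolding c_def by (rule power2_le_imp_le) (simp add: norm_nonneg)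
qed

lemma norm_triangle: "state_norm f (a + b) \<le> state_norm f a + state_norm f b"
proof (rule power2_le_imp_le)
  have "Re (f (fstar a * b)) \<le> state_norm f a * state_norm f b"
    using cauchy_schwarz[of a b] complex_Re_le_cmod[of "f (fstar a * b)"] by simp
  then show "(state_norm f (a + b))\<^sup>2 \<le> (state_norm f a + state_norm f b)\<^sup>2"
    using expand[of a 1 b] hermitian[of b a]
    by (simp add: norm_sq power2_sum)
qed (simp add: norm_nonneg)

lemma norm_scal: "state_norm f (scal c * a) = cmod c * state_norm f a"
proof -
  have "fstar (scal c * a) * (scal c * a) = scal (cnj c * c) * (fstar a * a)"
    by (simp add: fstar_mult scal_mult mult.assoc scal_left_comm[of "fstar u" for u])
  moreover have "cnj c * c = of_real ((cmod c)\<^sup>2)"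
    by (metis complex_norm_square mult.commute of_real_power)
  ultimately show ?thesis
    by (simp add: state_norm_def scal real_sqrt_mult)
qed

lemma norm_one: "state_norm f 1 = 1"
  by (simp add: state_norm_def one)

lemma norm_ideal: "r \<in> suq_ideal q \<Longrightarrow> state_norm f r = 0"
  by (simp add: state_norm_def ideal suq_ideal.left)

text \<open>The vector state at the normalised vector \<open>b\<close> of the GNS space; it converts
  the supremum over states in \<open>cnorm\<close> into a bound at every vector.\<close>

lemma cond_state:
  assumes "state_norm f b > 0"
  shows "suq_state q (\<lambda>a. f (fstar b * (a * b)) / of_real ((state_norm f b)\<^sup>2))"
proof -
  have b: "f (fstar b * b) = of_real ((state_norm f b)\<^sup>2)"
    by (simp add: complex_eq_iff norm_sq real)
  have "f (fstar b * (fstar a * a * b)) = f (fstar (a * b) * (a * b))" for a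
    by (simp add: fstar_mult mult.assoc)
  moreover have "f (fstar b * (scal c * a * b)) = c * f (fstar b * (a * b))" for c a
    by (simp add: scal_left_comm[of "fstar u" for u] mult.assoc scal)
  ultimately show ?thesis
    using assms unfolding suq_state_def
    by (auto simp: distrib_right distrib_left add add_divide_distrib ideal suq_ideal.left suq_ideal.right b
        complex_is_Real_iff real pos)
qed

end

section \<open>The norm of the universal C*-algebra\<close>

locale suq =
  fixes q :: real
  assumes q_pos: "q > 0"
begin

definition op_bound :: "falg \<Rightarrow> real \<Rightarrow> bool" where
  "op_bound a C \<longleftrightarrow> C \<ge> 0 \<and> (\<forall>f b. suq_state q f \<longrightarrow> state_norm f (a * b) \<le> C * state_norm f b)"

text \<open>Unitarity of the matrix of generators: the letter is one of three elements with
  \<open>x_1^* x_1 + x_2^* x_2 + x_3^* x_3 = 1\<close> modulo the ideal, so the squared lengths of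
  the \<open>x_i b\<close> add up to that of \<open>b\<close>.\<close>

lemma op_bound_gen: "op_bound (gen l) 1"
  unfolding op_bound_def
proof (intro conjI allI impI)
  fix f b assume "suq_state q f"
  then interpret positive_state q f by unfold_locales
  obtain x1 x2 x3 where x: "gen l \<in> {x1, x2, x3}" "fstar x1 * x1 + fstar x2 * x2 + fstar x3 * x3 - 1 \<in> suq_ideal q"
  proof (cases l)
    case (U i j)
    show thesis
      by (rule that[of "gen (U I1 j)" "gen (U I2 j)" "gen (U I3 j)"])
        (use unitary_ideal(1)[OF q_pos, of j] in \<open>cases i; simp add: U\<close>)+
  next
    case (Us i j)
    show thesis
      by (rule that[of "gen (Us i I1)" "gen (Us i I2)" "gen (Us i I3)"])
        (use unitary_ideal(2)[OF q_pos, of i] in \<open>cases j; simp add: Us\<close>)+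
  qed
  have "fstar b * ((fstar x1 * x1 + fstar x2 * x2 + fstar x3 * x3 - 1) * b) \<in> suq_ideal q"
    by (intro suq_ideal.left suq_ideal.right x)
  from ideal[OF this] have "f (fstar (x1 * b) * (x1 * b)) + f (fstar (x2 * b) * (x2 * b)) + f (fstar (x3 * b) * (x3 * b))
    = f (fstar b * b)"
    by (simp add: algebra_simps fstar_mult add diff)
  from arg_cong[OF this, of Re] have "(state_norm f (x1 * b))\<^sup>2 + (state_norm f (x2 * b))\<^sup>2 + (state_norm f (x3 * b))\<^sup>2
    = (state_norm f b)\<^sup>2"
    by (simp add: norm_sq)
  then have "(state_norm f (x1 * b))\<^sup>2 \<le> (state_norm f b)\<^sup>2" "(state_norm f (x2 * b))\<^sup>2 \<le> (state_norm f b)\<^sup>2"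
    "(state_norm f (x3 * b))\<^sup>2 \<le> (state_norm f b)\<^sup>2"
    using zero_le_power2[of "state_norm f (x1 * b)"] zero_le_power2[of "state_norm f (x2 * b)"]
      zero_le_power2[of "state_norm f (x3 * b)"] by linarith+
  then have "(state_norm f (gen l * b))\<^sup>2 \<le> (state_norm f b)\<^sup>2"
    using x(1) by auto
  then show "state_norm f (gen l * b) \<le> 1 * state_norm f b"
    by (simp add: norm_nonneg power2_le_iff_abs_le)
qed simp

lemma op_bound_exists: "\<exists>C. op_bound a C"
proof (induction a rule: falg_induct)
  case (add a b)
  then obtain C D where CD: "op_bound a C" "op_bound b D" by blast
  have "op_bound (a + b) (C + D)"
    unfolding op_bound_def
  proof (intro conjI allI impI)
    fix f x assume f: "suq_state q f"
    then interpret positive_state q f by unfold_locales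
    show "state_norm f ((a + b) * x) \<le> (C + D) * state_norm f x"
      using norm_triangle[of "a * x" "b * x"] CD f unfolding op_bound_def distrib_right by (meson add_mono order_trans)
  qed (use CD in \<open>simp add: op_bound_def\<close>)
  then show ?case by blast
next
  case (scal c)
  have "op_bound (scal c) (cmod c)"
    unfolding op_bound_def using positive_state.norm_scal positive_state.intro by fastforce
  then show ?case by blast
next
  case (gen l a)
  then obtain C where C: "op_bound a C" by blast
  have "op_bound (gen l * a) C"
    using C op_bound_gen[of l] unfolding op_bound_def mult.assoc mult_1 by (meson order_trans)
  then show ?case by blast
qed

lemma state_norm_set: "bdd_above {sqrt (Re (f (fstar a * a))) | f. suq_state q f}"
proof -
  obtain C where C: "op_bound a C" using op_bound_exists by blast
  show ?thesis
  proof (rule bdd_aboveI)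
    fix x assume "x \<in> {sqrt (Re (f (fstar a * a))) | f. suq_state q f}"
    then obtain f where f: "suq_state q f" "x = state_norm f a" by (auto simp: state_norm_def)
    then show "x \<le> C"
      using C positive_state.norm_one[of q f] unfolding op_bound_def suq_state_def positive_state.intro
      by (metis f(1) mult.right_neutral positive_state.intro)
  qed
qed

lemma state_norm_le_cnorm: "suq_state q f \<Longrightarrow> state_norm f a \<le> cnorm q a"
  unfolding cnorm_def state_norm_def by (rule cSup_upper[OF _ state_norm_set]) blast

lemma cnorm_least: "(\<And>f. suq_state q f \<Longrightarrow> state_norm f a \<le> C) \<Longrightarrow> cnorm q a \<le> C"
  unfolding cnorm_def state_norm_def by (rule cSup_least) (use suq_state_counit in auto)

lemma cnorm_nonneg: "cnorm q a \<ge> 0"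
  using state_norm_le_cnorm[OF suq_state_counit, of a]
    positive_state.norm_nonneg[OF positive_state.intro[OF suq_state_counit], of a] by simp

lemma op_bound_cnorm: "suq_state q f \<Longrightarrow> state_norm f (a * b) \<le> cnorm q a * state_norm f b"
proof -
  assume f: "suq_state q f"
  then interpret positive_state q f by unfold_locales
  show ?thesis
  proof (cases "state_norm f b = 0")
    \<comment> \<open>A null vector cannot be normalised; some operator bound exists, and it makes
      the image a null vector as well.\<close>
    case True
    obtain C where "op_bound a C" using op_bound_exists by blast
    with f True show ?thesis unfolding op_bound_def by (metis mult_zero_right)
  next
    case False
    then have b: "state_norm f b > 0" using norm_nonneg[of b] by simp
    have "state_norm f (a * b) / state_norm f b
      = state_norm (\<lambda>a. f (fstar b * (a * b)) / of_real ((state_norm f b)\<^sup>2)) a"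
      using b by (simp add: state_norm_def[of _ a] state_norm_def[of f "a * b"] fstar_mult mult.assoc
          real_sqrt_divide Re_divide_of_real flip: of_real_power)
    also have "\<dots> \<le> cnorm q a"
      by (rule state_norm_le_cnorm[OF cond_state[OF b]])
    finally show ?thesis using b by (simp add: field_simps)
  qed
qed

lemma cnorm_mult: "cnorm q (a * b) \<le> cnorm q a * cnorm q b"
  using op_bound_cnorm state_norm_le_cnorm cnorm_nonneg
  by (intro cnorm_least) (meson mult_left_mono order_trans)

lemma cnorm_add: "cnorm q (a + b) \<le> cnorm q a + cnorm q b"
  by (rule cnorm_least) (meson positive_state.norm_triangle positive_state.intro state_norm_le_cnorm add_mono order_trans)

lemma cnorm_scal: "cnorm q (scal c * a) \<le> cmod c * cnorm q a"
proof (rule cnorm_least)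
  fix f assume f: "suq_state q f"
  then interpret positive_state q f by unfold_locales
  show "state_norm f (scal c * a) \<le> cmod c * cnorm q a"
    using state_norm_le_cnorm[OF f] by (simp add: norm_scal mult_left_mono)
qed

lemma cnorm_rscal: "cnorm q (rscal r * a) \<le> \<bar>r\<bar> * cnorm q a"
  using cnorm_scal[of "of_real r" a] by (simp add: rscal_def)

lemma cnorm_ideal: "r \<in> suq_ideal q \<Longrightarrow> cnorm q r = 0"
  using cnorm_nonneg[of r] cnorm_least[of r 0] positive_state.norm_ideal positive_state.intro by fastforce

lemma cnorm_0 [simp]: "cnorm q 0 = 0"
  by (simp add: cnorm_ideal suq_ideal.zero)

lemma cnorm_gen: "cnorm q (gen l) \<le> 1"
proof (rule cnorm_least)
  fix f assume f: "suq_state q f"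
  then have "state_norm f (gen l * 1) \<le> 1 * state_norm f 1"
    using op_bound_gen unfolding op_bound_def by blast
  then show "state_norm f (gen l) \<le> 1"
    by (simp add: positive_state.norm_one[OF positive_state.intro[OF f]])
qed

text \<open>The C*-estimate \<open>|a|^2 \<le> |a^* a| \<le> |a^*| |a|\<close>, the first step by
  Cauchy-Schwarz for the vectors 1 and \<open>a^* a\<close>. Applied to the adjoint as well it gives
  equality.\<close>

lemma cnorm_fstar_le: "cnorm q a \<le> cnorm q (fstar a)"
proof (cases "cnorm q a = 0")
  case False
  then have a: "cnorm q a > 0" using cnorm_nonneg[of a] by simp
  have "cnorm q a \<le> sqrt (cnorm q (fstar a) * cnorm q a)"
  proof (rule cnorm_least)
    fix f assume f: "suq_state q f"
    then interpret positive_state q f by unfold_locales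
    have "(state_norm f a)\<^sup>2 \<le> cmod (f (fstar 1 * (fstar a * a)))"
      using complex_Re_le_cmod by (simp add: norm_sq)
    also have "\<dots> \<le> state_norm f (fstar a * a)"
      using cauchy_schwarz[of 1 "fstar a * a"] by (simp add: norm_one)
    also have "\<dots> \<le> cnorm q (fstar a) * cnorm q a"
      using cnorm_mult state_norm_le_cnorm[OF f] order_trans by blast
    finally show "state_norm f a \<le> sqrt (cnorm q (fstar a) * cnorm q a)"
      by (rule real_le_rsqrt)
  qed
  then have "(cnorm q a)\<^sup>2 \<le> cnorm q (fstar a) * cnorm q a"
    using a cnorm_nonneg[of "fstar a"] power_mono[of "cnorm q a" "sqrt (cnorm q (fstar a) * cnorm q a)" 2] by simp
  with a show ?thesis by (simp add: power2_eq_square)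
qed (simp add: cnorm_nonneg)

lemma cnorm_fstar: "cnorm q (fstar a) = cnorm q a"
  using cnorm_fstar_le[of a] cnorm_fstar_le[of "fstar a"] by simp

end

section \<open>Bounded sequences\<close>

lemma acts_add: "acts q hs (a + b) = acts q hs a + acts q hs b"
  and acts_0 [simp]: "acts q hs 0 = 0"
  and acts_rscal_mult: "acts q hs (rscal r * a) = rscal r * acts q hs a"
  by (induction hs arbitrary: a b)
    (simp_all add: acts_Cons act_add act_rscal_mult)

lemma acts_sum: "acts q hs (sum f A) = (\<Sum>x\<in>A. acts q hs (f x))"
  by (induction A rule: infinite_finite_induct) (simp_all add: acts_add)

lemma acts_fstar:
  assumes "q > 0"
  shows "\<exists>c. \<forall>a. acts q hs (fstar a) = rscal c * fstar (acts q (map star_gen hs) a)"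
proof (induction hs)
  case (Cons h hs)
  then obtain c where c: "\<forall>a. acts q hs (fstar a) = rscal c * fstar (acts q (map star_gen hs) a)" by blast
  show ?case
    by (rule exI[of _ "star_coeff q h * c"])
      (simp add: acts_Cons act_fstar[OF assms] acts_rscal_mult c rscal_mult mult.assoc)
qed (auto intro!: exI[of _ 1])

context suq
begin

text \<open>Boundedness of all derivatives is what makes \<open>null\<close> a two-sided ideal
  stable under the action; the product of a null sequence with an unbounded one need not tend to
  zero.\<close>

definition bdd :: "calg set" where
  "bdd = {x. \<forall>hs. \<exists>C. \<forall>n. cnorm q (acts q hs (x n)) \<le> C}"

definition null :: "calg set" where
  "null = {x \<in> bdd. \<forall>hs. (\<lambda>n. cnorm q (acts q hs (x n))) \<longlonglongrightarrow> 0}"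

lemma bdd_emb: "emb a \<in> bdd"
  by (auto simp: bdd_def emb_def)

lemma bdd_cact: "x \<in> bdd \<Longrightarrow> cact q h x \<in> bdd"
  by (auto simp: bdd_def cact_def simp flip: acts_Cons)

lemma null_cact: "x \<in> null \<Longrightarrow> cact q h x \<in> null"
  using bdd_cact by (auto simp: null_def cact_def simp flip: acts_Cons)

lemma bdd_add:
  assumes "x \<in> bdd" "y \<in> bdd"
  shows "x + y \<in> bdd"
  unfolding bdd_def
proof safe
  fix hs
  obtain C D where "\<forall>n. cnorm q (acts q hs (x n)) \<le> C" "\<forall>n. cnorm q (acts q hs (y n)) \<le> D"
    using assms unfolding bdd_def by blast
  then have "cnorm q (acts q hs ((x + y) n)) \<le> C + D" for n
    using cnorm_add[of "acts q hs (x n)" "acts q hs (y n)"] by (simp add: acts_add) (meson add_mono order_trans)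
  then show "\<exists>C. \<forall>n. cnorm q (acts q hs ((x + y) n)) \<le> C" by blast
qed

lemma bdd_mult: "x \<in> bdd \<Longrightarrow> y \<in> bdd \<Longrightarrow> x * y \<in> bdd"
proof -
  \<comment> \<open>Induction on the word with both factors arbitrary, since the coproduct replaces
    them by their derivatives.\<close>
  have "\<exists>C. \<forall>n. cnorm q (acts q hs (x n * y n)) \<le> C" if "x \<in> bdd" "y \<in> bdd" for x y hs
    using that
  proof (induction hs arbitrary: x y)
    case Nil
    obtain C D where C: "\<forall>n. cnorm q (acts q [] (x n)) \<le> C" and D: "\<forall>n. cnorm q (acts q [] (y n)) \<le> D"
      using Nil unfolding bdd_def by blast
    have "cnorm q (x n * y n) \<le> C * D" for n
    proof -
      have "0 \<le> C" using C cnorm_nonneg order_trans by blast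
      have "cnorm q (x n * y n) \<le> cnorm q (x n) * cnorm q (y n)" by (rule cnorm_mult)
      also have "\<dots> \<le> C * D"
        using C D \<open>0 \<le> C\<close> by (intro mult_mono) (simp_all add: cnorm_nonneg)
      finally show ?thesis .
    qed
    then show ?case by auto
  next
    case (Cons h hs)
    have IH: "\<exists>C. \<forall>n. cnorm q (acts q hs (act q h1 (x n) * act q h2 (y n))) \<le> C" for h1 h2
      using Cons.IH[OF bdd_cact[OF Cons.prems(1)] bdd_cact[OF Cons.prems(2)]] by (simp add: cact_def)
    have sum: "\<exists>C. \<forall>n. cnorm q (acts q hs (f n + g n)) \<le> C"
      if fg: "\<exists>C. \<forall>n. cnorm q (acts q hs (f n)) \<le> C" "\<exists>C. \<forall>n. cnorm q (acts q hs (g n)) \<le> C" for f g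
    proof -
      from fg obtain C D where C: "\<forall>n. cnorm q (acts q hs (f n)) \<le> C" and D: "\<forall>n. cnorm q (acts q hs (g n)) \<le> D"
        by blast
      show ?thesis unfolding acts_add
        by (rule exI[of _ "C + D"]) (meson C D cnorm_add add_mono order_trans)
    qed
    show ?case
      by (cases h) (simp_all add: acts_Cons act_mult IH sum)
  qed
  then show "x \<in> bdd \<Longrightarrow> y \<in> bdd \<Longrightarrow> x * y \<in> bdd"
    by (auto simp: bdd_def)
qed

lemma null_add:
  assumes "x \<in> null" "y \<in> null"
  shows "x + y \<in> null"
proof -
  have "(\<lambda>n. cnorm q (acts q hs ((x + y) n))) \<longlonglongrightarrow> 0" for hs
  proof (rule tendsto_sandwich[OF _ _ tendsto_const])
    have "(\<lambda>n. cnorm q (acts q hs (x n)) + cnorm q (acts q hs (y n))) \<longlonglongrightarrow> 0 + 0"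
      using assms unfolding null_def by (intro tendsto_add) auto
    then show "(\<lambda>n. cnorm q (acts q hs (x n)) + cnorm q (acts q hs (y n))) \<longlonglongrightarrow> 0" by simp
  qed (auto simp: acts_add cnorm_add cnorm_nonneg)
  with assms bdd_add show ?thesis by (auto simp: null_def)
qed

lemma null_mult:
  assumes "x \<in> bdd" "y \<in> null"
  shows "x * y \<in> null" "y * x \<in> null"
proof -
  define lim0 where "lim0 hs u \<longleftrightarrow> (\<lambda>n. cnorm q (acts q hs (u n))) \<longlonglongrightarrow> 0" for hs u
  have sum: "lim0 hs (\<lambda>n. f n + g n)" if "lim0 hs f" "lim0 hs g" for hs f g
    unfolding lim0_def
  proof (rule tendsto_sandwich[OF _ _ tendsto_const])
    show "(\<lambda>n. cnorm q (acts q hs (f n)) + cnorm q (acts q hs (g n))) \<longlonglongrightarrow> 0"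
      using tendsto_add[of _ 0 sequentially _ 0] that unfolding lim0_def by fastforce
  qed (auto simp: acts_add cnorm_add cnorm_nonneg)
  have "lim0 hs (\<lambda>n. x n * y n) \<and> lim0 hs (\<lambda>n. y n * x n)" if "x \<in> bdd" "y \<in> null" for x y hs
    using that
  proof (induction hs arbitrary: x y)
    case Nil
    have "\<exists>C. \<forall>n. cnorm q (acts q [] (x n)) \<le> C"
      using Nil(1) unfolding bdd_def by blast
    then obtain C where C: "\<And>n. cnorm q (x n) \<le> C" by auto
    have y: "(\<lambda>n. C * cnorm q (y n)) \<longlonglongrightarrow> C * 0"
    proof (rule tendsto_mult_left)
      have "(\<lambda>n. cnorm q (acts q [] (y n))) \<longlonglongrightarrow> 0"
        using Nil(2) unfolding null_def by blast
      then show "(\<lambda>n. cnorm q (y n)) \<longlonglongrightarrow> 0" by simp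
    qed
    have "cnorm q (x n * y n) \<le> C * cnorm q (y n)" "cnorm q (y n * x n) \<le> C * cnorm q (y n)" for n
      using cnorm_mult[of "x n" "y n"] cnorm_mult[of "y n" "x n"] mult_right_mono[OF C[of n] cnorm_nonneg[of "y n"]]
      by (simp_all add: mult.commute)
    have *: "(\<lambda>n. cnorm q (u n)) \<longlonglongrightarrow> 0" if "\<And>n. cnorm q (u n) \<le> C * cnorm q (y n)" for u
    proof (rule tendsto_sandwich[OF _ _ tendsto_const])
      show "(\<lambda>n. C * cnorm q (y n)) \<longlonglongrightarrow> 0" using y by simp
    qed (simp_all add: that cnorm_nonneg)
    show ?case
      unfolding lim0_def acts_Nil by (intro conjI *) fact+
  next
    case (Cons h hs)
    have IH: "lim0 hs (\<lambda>n. act q h1 (x n) * act q h2 (y n))" "lim0 hs (\<lambda>n. act q h2 (y n) * act q h1 (x n))" for h1 h2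
      using Cons.IH[OF bdd_cact[OF Cons.prems(1)] null_cact[OF Cons.prems(2)]] by (simp_all add: cact_def)
    have C: "lim0 (h # hs) u = lim0 hs (\<lambda>n. act q h (u n))" for u
      by (simp add: lim0_def acts_Cons)
    show ?case
      unfolding C by (cases h) (simp_all add: act_mult IH sum)
  qed
  with assms bdd_mult show "x * y \<in> null" "y * x \<in> null"
    by (auto simp: null_def lim0_def)
qed

lemma bdd_cstar: "x \<in> bdd \<Longrightarrow> cstar x \<in> bdd"
  unfolding bdd_def
proof safe
  fix hs assume x: "\<forall>hs. \<exists>C. \<forall>n. cnorm q (acts q hs (x n)) \<le> C"
  obtain c where c: "\<forall>a. acts q hs (fstar a) = rscal c * fstar (acts q (map star_gen hs) a)"
    using acts_fstar[OF q_pos] by blast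
  obtain C where "\<forall>n. cnorm q (acts q (map star_gen hs) (x n)) \<le> C" using x by blast
  then have "cnorm q (acts q hs (cstar x n)) \<le> \<bar>c\<bar> * C" for n
    using cnorm_rscal[of c "fstar (acts q (map star_gen hs) (x n))"]
    by (simp add: cstar_def c cnorm_fstar) (meson abs_ge_zero mult_left_mono order_trans)
  then show "\<exists>C. \<forall>n. cnorm q (acts q hs (cstar x n)) \<le> C" by blast
qed

lemma rsc_bdd: "rsc r \<in> bdd" and csc_bdd: "csc c \<in> bdd"
  by (simp_all add: rsc_def csc_def bdd_emb)

lemma null_0: "0 \<in> null"
  using bdd_emb[of 0] by (simp add: null_def emb_hom)

lemma admissible_bdd: "admissible (bdd, null)"
  by (auto simp: admissible_def rsc_bdd bdd_add bdd_mult null_0 null_add null_mult null_def[THEN eq_refl, THEN subsetD])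
    (auto simp: null_def)

lemma emb_ideal_null: "r \<in> suq_ideal q \<Longrightarrow> emb r \<in> null"
  using bdd_emb[of r] acts_ideal[OF q_pos] by (simp add: null_def emb_def cnorm_ideal)

sublocale quo: suq_quotient q "(bdd, null)"
  by unfold_locales (simp_all add: q_pos admissible_bdd bdd_emb emb_ideal_null)

lemma bdd_diff: "x \<in> bdd \<Longrightarrow> y \<in> bdd \<Longrightarrow> x - y \<in> bdd"
  using adm_minus[OF admissible_bdd] by simp

lemma proj_eq_ceq: "x \<in> bdd \<Longrightarrow> y \<in> bdd \<Longrightarrow> proj (bdd, null) x = proj (bdd, null) y \<longleftrightarrow> ceq q x y"
  using proj_eq_iff[OF admissible_bdd] bdd_diff[of x y] by (auto simp: null_def ceq_def)

section \<open>Power series in \<open>p\<^sub>1\<^sub>1\<close>\<close>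

text \<open>Only \<open>E\<close> and \<open>F\<close> raise the growth of the derivatives of powers
  of \<open>p11\<close>, as the \<open>K\<close>s fix \<open>p11\<close>; \<open>ef\<close> is the
  resulting degree.\<close>

definition ef :: "uq list \<Rightarrow> nat" where
  "ef hs = length (filter (\<lambda>h. case h of E _ \<Rightarrow> True | F _ \<Rightarrow> True | _ \<Rightarrow> False) hs)"

lemma ef_Cons: "ef (K i # hs) = ef hs" "ef (Kinv i # hs) = ef hs" "ef (E i # hs) = Suc (ef hs)" "ef (F i # hs) = Suc (ef hs)"
  by (simp_all add: ef_def)

text \<open>Iterated Leibniz rule: derivatives of \<open>a\<close> become the coefficients, and no
  term applies more letters \<open>E\<close> or \<open>F\<close> to \<open>b\<close> than the word
  contains.\<close>

lemma acts_mult_exp: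
  "\<exists>L. (\<forall>(c, ks) \<in> set L. ef ks \<le> ef hs) \<and> (\<forall>b. acts q hs (a * b) = (\<Sum>(c, ks)\<leftarrow>L. c * acts q ks b))"
proof (induction hs arbitrary: a)
  case Nil
  show ?case by (rule exI[of _ "[(a, [])]"]) simp
next
  case (Cons h hs)
  have one: "\<exists>L. (\<forall>(c, ks) \<in> set L. ef ks \<le> ef (h2 # hs)) \<and>
      (\<forall>b. acts q hs (act q h1 a * act q h2 b) = (\<Sum>(c, ks)\<leftarrow>L. c * acts q ks b))" for h1 h2
  proof -
    obtain L where L: "\<forall>(c, ks) \<in> set L. ef ks \<le> ef hs"
      "\<And>b. acts q hs (act q h1 a * b) = (\<Sum>(c, ks)\<leftarrow>L. c * acts q ks b)"
      using Cons.IH[of "act q h1 a"] by blast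
    show ?thesis
      by (rule exI[of _ "map (\<lambda>(c, ks). (c, h2 # ks)) L"])
        (use L(1) in \<open>cases h2; auto simp: L(2) ef_Cons comp_def case_prod_unfold acts_Cons\<close>)
  qed
  have two: "\<exists>L. (\<forall>(c, ks) \<in> set L. ef ks \<le> n) \<and>
      (\<forall>b. acts q hs (act q h1 a * act q h2 b) + acts q hs (act q h3 a * act q h4 b) = (\<Sum>(c, ks)\<leftarrow>L. c * acts q ks b))"
    if n: "ef (h2 # hs) \<le> n" "ef (h4 # hs) \<le> n" for h1 h2 h3 h4 n
  proof -
    obtain L1 L2 where "\<forall>(c, ks) \<in> set L1. ef ks \<le> ef (h2 # hs)"
      "\<And>b. acts q hs (act q h1 a * act q h2 b) = (\<Sum>(c, ks)\<leftarrow>L1. c * acts q ks b)"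
      "\<forall>(c, ks) \<in> set L2. ef ks \<le> ef (h4 # hs)"
      "\<And>b. acts q hs (act q h3 a * act q h4 b) = (\<Sum>(c, ks)\<leftarrow>L2. c * acts q ks b)"
      using one by meson
    then show ?thesis
      using n by (intro exI[of _ "L1 @ L2"]) fastforce
  qed
  show ?case
  proof (cases h)
    case (K i)
    show ?thesis using one[of "K i" "K i"] by (simp only: K acts_Cons act_mult)
  next
    case (Kinv i)
    show ?thesis using one[of "Kinv i" "Kinv i"] by (simp only: Kinv acts_Cons act_mult)
  next
    case (E i)
    show ?thesis using two[of "K i" "ef (E i # hs)" "E i" "E i" "Kinv i"]
      by (simp only: E acts_Cons act_mult acts_add ef_Cons le_SucI order_refl)
  next
    case (F i)
    show ?thesis using two[of "K i" "ef (F i # hs)" "F i" "F i" "Kinv i"]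
      by (simp only: F acts_Cons act_mult acts_add ef_Cons le_SucI order_refl)
  qed
qed

lemma act_p11: "act q (K i) p11 = p11" "act q (Kinv i) p11 = p11"
proof -
  have "qs q x * a * (qs q (- x) * b) = a * b" for x a b
    by (simp add: mult.assoc qs_left_comm[of a] qs_qs_mult qs_0[OF q_pos])
  moreover have "qs q (- x) * a * (qs q x * b) = a * b" for x a b
    by (simp add: mult.assoc qs_left_comm[of a] qs_qs_mult qs_0[OF q_pos])
  ultimately show "act q (K i) p11 = p11" "act q (Kinv i) p11 = p11"
    by (simp_all add: p11_def z_def act_mult act_gen lact_qs[OF q_pos])
qed

text \<open>Since the \<open>K\<close>s fix \<open>p11\<close>, the term in which no
  \<open>E\<close> or \<open>F\<close> falls on the factor \<open>p11\<close> is exactly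
  \<open>p11 * acts q hs b\<close>; every other term has spent such a letter there.\<close>

lemma acts_p11_mult_exp:
  "\<exists>L. (\<forall>(c, ks) \<in> set L. ef ks < ef hs) \<and>
    (\<forall>b. acts q hs (p11 * b) = p11 * acts q hs b + (\<Sum>(c, ks)\<leftarrow>L. c * acts q ks b))"
proof (induction hs)
  case Nil
  show ?case by (rule exI[of _ "[]"]) simp
next
  case (Cons h hs)
  then obtain L where L: "\<forall>(c, ks) \<in> set L. ef ks < ef hs"
    "\<And>b. acts q hs (p11 * b) = p11 * acts q hs b + (\<Sum>(c, ks)\<leftarrow>L. c * acts q ks b)" by blast
  have "\<exists>L. (\<forall>(c, ks) \<in> set L. ef ks < ef (h # hs)) \<and>
    (\<forall>b. acts q hs (act q h p11 * act q (K i) b) + acts q hs (p11 * act q h b)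
      = p11 * acts q (h # hs) b + (\<Sum>(c, ks)\<leftarrow>L. c * acts q ks b))" if h: "h = E i \<or> h = F i" for i
  proof -
    obtain M where M: "\<forall>(c, ks) \<in> set M. ef ks \<le> ef hs"
      "\<And>b. acts q hs (act q h p11 * b) = (\<Sum>(c, ks)\<leftarrow>M. c * acts q ks b)"
      using acts_mult_exp[of hs "act q h p11"] by blast
    show ?thesis
      by (rule exI[of _ "map (\<lambda>(c, ks). (c, K i # ks)) M @ map (\<lambda>(c, ks). (c, h # ks)) L"])
        (use h L(1) M(1) in \<open>auto simp: L(2) M(2) ef_Cons comp_def case_prod_unfold acts_Cons add_ac\<close>)
  qed
  note EF = this
  have KK: "\<exists>L. (\<forall>(c, ks) \<in> set L. ef ks < ef (h # hs)) \<and>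
    (\<forall>b. acts q hs (p11 * act q h b) = p11 * acts q (h # hs) b + (\<Sum>(c, ks)\<leftarrow>L. c * acts q ks b))"
    if "h = K i \<or> h = Kinv i" for i
    by (rule exI[of _ "map (\<lambda>(c, ks). (c, h # ks)) L"])
      (use that L(1) in \<open>auto simp: L(2) ef_Cons comp_def case_prod_unfold acts_Cons\<close>)
  show ?case
  proof (cases h)
    case (K i)
    with KK[of i] show ?thesis by (simp only: acts_Cons[of q _ _ "_ * _"] act_mult act_p11 simp_thms)
  next
    case (Kinv i)
    with KK[of i] show ?thesis by (simp only: acts_Cons[of q _ _ "_ * _"] act_mult act_p11 simp_thms)
  next
    case (E i)
    with EF[of i] show ?thesis by (simp only: acts_Cons[of q _ _ "_ * _"] act_mult acts_add act_p11 simp_thms)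
  next
    case (F i)
    with EF[of i] show ?thesis by (simp only: acts_Cons[of q _ _ "_ * _"] act_mult acts_add act_p11 simp_thms)
  qed
qed

lemma cnorm_p11: "cnorm q p11 \<le> 1"
  using cnorm_mult[of "fstar (z I1)" "z I1"] mult_mono[OF cnorm_gen[of "Us I3 I1"] cnorm_gen[of "U I3 I1"]]
  by (simp add: p11_def z_def cnorm_nonneg)

lemma cnorm_sum_list: "cnorm q (\<Sum>x\<leftarrow>L. f x) \<le> (\<Sum>x\<leftarrow>L. cnorm q (f x))"
  by (induction L) (auto intro: order_trans[OF cnorm_add])

lemma cnorm_sum: "cnorm q (\<Sum>x\<in>A. f x) \<le> (\<Sum>x\<in>A. cnorm q (f x))"
  by (induction A rule: infinite_finite_induct) (auto intro: order_trans[OF cnorm_add])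

text \<open>With \<open>m = ef hs\<close>, the expansion above and
  \<open>cnorm q p11 \<le> 1\<close> give a recursion in \<open>k\<close> with increment
  \<open>D (k + 1)^(m - 1)\<close>; summing it raises the degree to \<open>m\<close>. The induction
  on \<open>ef hs\<close> provides \<open>D\<close>.\<close>

lemma p11_power_growth: "\<exists>C\<ge>0. \<forall>k. cnorm q (acts q hs (p11 ^ k)) \<le> C * (real k + 1) ^ ef hs"
proof (induction "ef hs" arbitrary: hs rule: less_induct)
  case less
  obtain L where L: "\<And>c ks. (c, ks) \<in> set L \<Longrightarrow> ef ks < ef hs"
    "\<And>b. acts q hs (p11 * b) = p11 * acts q hs b + (\<Sum>(c, ks)\<leftarrow>L. c * acts q ks b)"
    using acts_p11_mult_exp[of hs] by blast
  define m where "m = ef hs"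
  have "\<exists>D\<ge>0. \<forall>k. (\<Sum>(c, ks)\<leftarrow>M. cnorm q (c * acts q ks (p11 ^ k))) \<le> D * (real k + 1) ^ (m - 1)"
    if "set M \<subseteq> set L" for M
    using that
  proof (induction M)
    case Nil
    show ?case by (rule exI[of _ 0]) simp
  next
    case (Cons x M)
    obtain c ks where x: "x = (c, ks)" by (cases x)
    with Cons.prems L(1) have ks: "ef ks < ef hs" by auto
    obtain C where C: "C \<ge> 0" "\<And>k. cnorm q (acts q ks (p11 ^ k)) \<le> C * (real k + 1) ^ ef ks"
      using less[OF ks] by blast
    obtain D where D: "D \<ge> 0" "\<And>k. (\<Sum>(c, ks)\<leftarrow>M. cnorm q (c * acts q ks (p11 ^ k))) \<le> D * (real k + 1) ^ (m - 1)"
      using Cons by auto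
    show ?case
    proof (intro exI[of _ "cnorm q c * C + D"] conjI allI)
      fix k
      have "cnorm q (c * acts q ks (p11 ^ k)) \<le> cnorm q c * (C * (real k + 1) ^ ef ks)"
        by (rule order_trans[OF cnorm_mult]) (simp add: C(2) cnorm_nonneg mult_left_mono)
      also have "\<dots> \<le> cnorm q c * (C * (real k + 1) ^ (m - 1))"
        using ks C(1) by (intro mult_left_mono power_increasing) (auto simp: m_def cnorm_nonneg)
      finally show "(\<Sum>(c, ks)\<leftarrow>x # M. cnorm q (c * acts q ks (p11 ^ k))) \<le> (cnorm q c * C + D) * (real k + 1) ^ (m - 1)"
        using D(2)[of k] by (simp add: x algebra_simps)
    qed (simp add: C D cnorm_nonneg)
  qed
  then obtain D where D: "D \<ge> 0"
    "\<And>k. (\<Sum>(c, ks)\<leftarrow>L. cnorm q (c * acts q ks (p11 ^ k))) \<le> D * (real k + 1) ^ (m - 1)" by blast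
  \<comment> \<open>For \<open>m = 0\<close> the truncated exponent \<open>m - 1\<close> is 0. The
    increment is then absent altogether, because no word has fewer than zero letters
    \<open>E\<close> and \<open>F\<close>.\<close>
  have L0: "L = []" if "m = 0"
    using L(1) that by (cases L) (auto simp: m_def)
  have step: "cnorm q (acts q hs (p11 ^ Suc k)) \<le> cnorm q (acts q hs (p11 ^ k))
      + (if m = 0 then 0 else D * (real k + 1) ^ (m - 1))" for k
  proof -
    have "cnorm q (acts q hs (p11 ^ Suc k)) \<le> cnorm q (p11 * acts q hs (p11 ^ k))
      + cnorm q (\<Sum>(c, ks)\<leftarrow>L. c * acts q ks (p11 ^ k))"
      by (simp add: L(2) cnorm_add)
    also have "cnorm q (p11 * acts q hs (p11 ^ k)) \<le> cnorm q (acts q hs (p11 ^ k))"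
      using cnorm_mult[of p11 "acts q hs (p11 ^ k)"]
        mult_right_mono[OF cnorm_p11 cnorm_nonneg, of "acts q hs (p11 ^ k)"] by simp
    also have "cnorm q (\<Sum>(c, ks)\<leftarrow>L. c * acts q ks (p11 ^ k)) \<le> (if m = 0 then 0 else D * (real k + 1) ^ (m - 1))"
      using order_trans[OF cnorm_sum_list D(2)[of k, unfolded case_prod_unfold]] L0 by (simp add: case_prod_unfold)
    finally show ?thesis by simp
  qed
  define C where "C = cnorm q (acts q hs 1) + D"
  have "cnorm q (acts q hs (p11 ^ k)) \<le> C * (real k + 1) ^ m" for k
  proof (induction k)
    case 0
    show ?case using D(1) by (simp add: C_def)
  next
    case (Suc k)
    have "C \<ge> D" "C \<ge> 0" using D(1) by (simp_all add: C_def cnorm_nonneg)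
    have "C * (real k + 1) ^ m + (if m = 0 then 0 else D * (real k + 1) ^ (m - 1)) \<le> C * (real (Suc k) + 1) ^ m"
    proof (cases m)
      case (Suc m')
      have "(real k + 1) ^ m + (real k + 1) ^ m' = (real k + 2) * (real k + 1) ^ m'"
        by (simp add: Suc algebra_simps)
      also have "\<dots> \<le> (real k + 2) * (real k + 2) ^ m'"
        by (intro mult_left_mono power_mono) simp_all
      finally have "C * ((real k + 1) ^ m + (real k + 1) ^ m') \<le> C * (real k + 2) ^ m"
        using \<open>C \<ge> 0\<close> by (intro mult_left_mono) (simp_all add: Suc)
      moreover have "D * (real k + 1) ^ m' \<le> C * (real k + 1) ^ m'"
        using \<open>C \<ge> D\<close> by (intro mult_right_mono) simp_all
      moreover have "C * ((real k + 1) ^ m + (real k + 1) ^ m') = C * (real k + 1) ^ m + C * (real k + 1) ^ m'"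
        by (rule distrib_left)
      moreover have "real (Suc k) + 1 = real k + 2" "m - 1 = m'" "m \<noteq> 0"
        by (simp_all add: Suc)
      ultimately show ?thesis by (simp only: if_False)
    qed simp
    with step[of k] Suc show ?case by linarith
  qed
  moreover have "C \<ge> 0" using D(1) by (simp add: C_def cnorm_nonneg)
  ultimately show ?case unfolding m_def by blast
qed

section \<open>Products of power series and the binomial series\<close>

definition pser :: "(nat \<Rightarrow> real) \<Rightarrow> calg" where
  "pser a = (\<lambda>n. \<Sum>k\<le>n. rscal (a k) * p11 ^ k)"

text \<open>All polynomial weights are required because a word with \<open>m\<close> letters
  \<open>E\<close> or \<open>F\<close> costs a factor of degree \<open>m\<close> in
  \<open>k\<close>.\<close>

definition psum :: "(nat \<Rightarrow> real) \<Rightarrow> bool" where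
  "psum a \<longleftrightarrow> (\<forall>m. summable (\<lambda>k. \<bar>a k\<bar> * (real k + 1) ^ m))"

text \<open>Arbitrary index sets and exponents are allowed, so that the estimate serves both partial
  sums and the region between a square and a triangle of index pairs.\<close>

lemma cnorm_power_sum:
  "\<exists>C\<ge>0. \<forall>A a e. cnorm q (acts q hs (\<Sum>x\<in>A. rscal (a x) * p11 ^ e x)) \<le> C * (\<Sum>x\<in>A. \<bar>a x\<bar> * (real (e x) + 1) ^ ef hs)"
proof -
  obtain C where C: "C \<ge> 0" "\<And>k. cnorm q (acts q hs (p11 ^ k)) \<le> C * (real k + 1) ^ ef hs"
    using p11_power_growth by blast
  have "cnorm q (acts q hs (\<Sum>x\<in>A. rscal (a x) * p11 ^ e x)) \<le> C * (\<Sum>x\<in>A. \<bar>a x\<bar> * (real (e x) + 1) ^ ef hs)"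
    for A a e
  proof -
    have "cnorm q (acts q hs (\<Sum>x\<in>A. rscal (a x) * p11 ^ e x)) \<le> (\<Sum>x\<in>A. cnorm q (rscal (a x) * acts q hs (p11 ^ e x)))"
      unfolding acts_sum acts_rscal_mult by (rule cnorm_sum)
    also have "\<dots> \<le> (\<Sum>x\<in>A. \<bar>a x\<bar> * (C * (real (e x) + 1) ^ ef hs))"
      by (intro sum_mono order_trans[OF cnorm_rscal] mult_left_mono C(2)) simp
    finally show ?thesis by (simp add: sum_distrib_left mult_ac)
  qed
  with C(1) show ?thesis by blast
qed

lemma pser_bdd:
  assumes "psum a"
  shows "pser a \<in> bdd"
  unfolding bdd_def
proof safe
  fix hs
  obtain C where C: "C \<ge> 0" "\<And>(A :: nat set) a e. cnorm q (acts q hs (\<Sum>x\<in>A. rscal (a x) * p11 ^ e x))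
      \<le> C * (\<Sum>x\<in>A. \<bar>a x\<bar> * (real (e x) + 1) ^ ef hs)"
    using cnorm_power_sum by blast
  have "cnorm q (acts q hs (pser a n)) \<le> C * suminf (\<lambda>k. \<bar>a k\<bar> * (real k + 1) ^ ef hs)" for n
  proof -
    have "(\<Sum>k\<le>n. \<bar>a k\<bar> * (real k + 1) ^ ef hs) \<le> suminf (\<lambda>k. \<bar>a k\<bar> * (real k + 1) ^ ef hs)"
      using assms unfolding psum_def by (intro sum_le_suminf) auto
    then show ?thesis
      using C(2)[of a "\<lambda>k. k" "{..n}"] C(1) unfolding pser_def
      by (meson mult_left_mono order_trans)
  qed
  then show "\<exists>C. \<forall>n. cnorm q (acts q hs (pser a n)) \<le> C" by blast
qed

text \<open>The difference at \<open>n\<close> is the sum over the index pairs in the square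
  \<open>S n\<close> outside the triangle \<open>T n\<close>. As
  \<open>i + j + 1 \<le> (i + 1)(j + 1)\<close>, the weights split, and the bound becomes the gap
  between a product of partial sums and the partial Cauchy product of two absolutely convergent
  scalar series.\<close>

lemma pser_mult_null:
  assumes "psum a" "psum b" "psum (\<lambda>k. \<Sum>i\<le>k. a i * b (k - i))"
  shows "pser a * pser b - pser (\<lambda>k. \<Sum>i\<le>k. a i * b (k - i)) \<in> null"
proof -
  have "(\<lambda>n. cnorm q (acts q hs ((pser a * pser b - pser (\<lambda>k. \<Sum>i\<le>k. a i * b (k - i))) n))) \<longlonglongrightarrow> 0" for hs
  proof -
    define m where "m = ef hs"
    define \<alpha> \<beta> where "\<alpha> = (\<lambda>k. \<bar>a k\<bar> * (real k + 1) ^ m)" and "\<beta> = (\<lambda>k. \<bar>b k\<bar> * (real k + 1) ^ m)"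
    have \<alpha>: "summable (\<lambda>k. norm (\<alpha> k))" and \<beta>: "summable (\<lambda>k. norm (\<beta> k))"
      using assms(1,2) by (simp_all add: psum_def \<alpha>_def \<beta>_def)
    obtain C where C: "C \<ge> 0" "\<And>(A :: (nat \<times> nat) set) a e. cnorm q (acts q hs (\<Sum>x\<in>A. rscal (a x) * p11 ^ e x))
        \<le> C * (\<Sum>x\<in>A. \<bar>a x\<bar> * (real (e x) + 1) ^ m)"
      using cnorm_power_sum unfolding m_def by blast
    define S T where "S = (\<lambda>n::nat. {..n} \<times> {..n})" and "T = (\<lambda>n::nat. {(i, j). i + j \<le> n})"
    have TS: "T n \<subseteq> S n" and fin: "finite (S n)" for n by (auto simp: S_def T_def)
    have bound: "cnorm q (acts q hs ((pser a * pser b - pser (\<lambda>k. \<Sum>i\<le>k. a i * b (k - i))) n))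
      \<le> C * ((\<Sum>i\<le>n. \<alpha> i) * (\<Sum>j\<le>n. \<beta> j) - (\<Sum>k\<le>n. \<Sum>i\<le>k. \<alpha> i * \<beta> (k - i)))" for n
    proof -
      have prod: "pser a n * pser b n = (\<Sum>(i, j)\<in>S n. rscal (a i * b j) * p11 ^ (i + j))"
        unfolding pser_def S_def sum_product sum.cartesian_product
        by (intro sum.cong refl) (auto simp: rscal_mult power_add mult.assoc rscal_left_comm[of "p11 ^ k" for k])
      have tri: "pser (\<lambda>k. \<Sum>i\<le>k. a i * b (k - i)) n = (\<Sum>(i, j)\<in>T n. rscal (a i * b j) * p11 ^ (i + j))"
      proof -
        have "rscal (sum f A) = (\<Sum>x\<in>A. rscal (f x))" for f and A :: "nat set"
          by (induction A rule: infinite_finite_induct) (simp_all add: rscal_add)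
        then show ?thesis
          unfolding pser_def T_def sum.triangle_reindex_eq by (simp add: sum_distrib_right)
      qed
      have "(pser a * pser b - pser (\<lambda>k. \<Sum>i\<le>k. a i * b (k - i))) n
        = (\<Sum>x\<in>S n - T n. rscal (a (fst x) * b (snd x)) * p11 ^ (fst x + snd x))"
        by (simp add: prod tri case_prod_unfold sum_diff[OF fin TS])
      then have "cnorm q (acts q hs ((pser a * pser b - pser (\<lambda>k. \<Sum>i\<le>k. a i * b (k - i))) n))
        \<le> C * (\<Sum>x\<in>S n - T n. \<bar>a (fst x) * b (snd x)\<bar> * (real (fst x + snd x) + 1) ^ m)"
        by (simp only: C(2))
      also have "\<dots> \<le> C * (\<Sum>x\<in>S n - T n. \<alpha> (fst x) * \<beta> (snd x))"
      proof (intro mult_left_mono sum_mono)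
        fix x :: "nat \<times> nat"
        have "(real (fst x + snd x) + 1) ^ m \<le> ((real (fst x) + 1) * (real (snd x) + 1)) ^ m"
          by (intro power_mono) (simp_all add: algebra_simps)
        then have "\<bar>a (fst x) * b (snd x)\<bar> * (real (fst x + snd x) + 1) ^ m
          \<le> \<bar>a (fst x) * b (snd x)\<bar> * ((real (fst x) + 1) * (real (snd x) + 1)) ^ m"
          by (intro mult_left_mono) simp_all
        then show "\<bar>a (fst x) * b (snd x)\<bar> * (real (fst x + snd x) + 1) ^ m \<le> \<alpha> (fst x) * \<beta> (snd x)"
          by (simp add: \<alpha>_def \<beta>_def power_mult_distrib abs_mult mult_ac)
      qed (fact C(1))
      also have "(\<Sum>x\<in>S n - T n. \<alpha> (fst x) * \<beta> (snd x)) = (\<Sum>i\<le>n. \<alpha> i) * (\<Sum>j\<le>n. \<beta> j) - (\<Sum>k\<le>n. \<Sum>i\<le>k. \<alpha> i * \<beta> (k - i))"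
        unfolding sum_diff[OF fin TS] using sum.triangle_reindex_eq[of "\<lambda>i j. \<alpha> i * \<beta> j" n]
        by (simp add: S_def T_def sum_product sum.cartesian_product case_prod_unfold)
      finally show ?thesis .
    qed
    have "(\<lambda>n. (\<Sum>i\<le>n. \<alpha> i) * (\<Sum>j\<le>n. \<beta> j) - (\<Sum>k\<le>n. \<Sum>i\<le>k. \<alpha> i * \<beta> (k - i)))
      \<longlonglongrightarrow> suminf \<alpha> * suminf \<beta> - suminf \<alpha> * suminf \<beta>"
    proof (intro tendsto_diff tendsto_mult)
      have "summable \<alpha>" "summable \<beta>" using \<alpha> \<beta> summable_norm_cancel by blast+
      then show "(\<lambda>n. \<Sum>i\<le>n. \<alpha> i) \<longlonglongrightarrow> suminf \<alpha>" "(\<lambda>n. \<Sum>i\<le>n. \<beta> i) \<longlonglongrightarrow> suminf \<beta>"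
        by (simp_all add: summable_LIMSEQ')
      show "(\<lambda>n. \<Sum>k\<le>n. \<Sum>i\<le>k. \<alpha> i * \<beta> (k - i)) \<longlonglongrightarrow> suminf \<alpha> * suminf \<beta>"
        using Cauchy_product_sums[OF \<alpha> \<beta>] by (simp add: sums_def_le)
    qed
    then have "(\<lambda>n. C * ((\<Sum>i\<le>n. \<alpha> i) * (\<Sum>j\<le>n. \<beta> j) - (\<Sum>k\<le>n. \<Sum>i\<le>k. \<alpha> i * \<beta> (k - i)))) \<longlonglongrightarrow> 0"
      using tendsto_mult_left[of _ 0 sequentially C] by simp
    then show ?thesis
      by (rule tendsto_sandwich[OF _ _ tendsto_const, rotated 2]) (use bound cnorm_nonneg in auto)
  qed
  then show ?thesis
    using bdd_diff[OF bdd_mult[OF pser_bdd pser_bdd] pser_bdd] assms by (simp add: null_def)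
qed

text \<open>Consecutive coefficients have the ratio \<open>(r - k) / (k + 1)\<close>, of modulus at
  most 1.\<close>

lemma gchoose_le_1:
  fixes r :: real
  assumes "\<bar>r\<bar> \<le> 1"
  shows "\<bar>r gchoose k\<bar> \<le> 1"
proof (induction k)
  case (Suc k)
  have "r gchoose Suc k = (r gchoose k) * ((r - real k) / (real k + 1))"
    using gbinomial_absorb_comp[of r k] gbinomial_absorption[of k r] by (simp add: field_simps)
  moreover have "\<bar>(r - real k) / (real k + 1)\<bar> \<le> 1"
    using assms by (simp add: abs_le_iff)
  ultimately show ?case
    using Suc mult_mono[of "\<bar>r gchoose k\<bar>" 1 "\<bar>(r - real k) / (real k + 1)\<bar>" 1] by (simp add: abs_mult)
qed simp

text \<open>Termwise differentiation raises the degree of the weight by one inside the same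
  disc.\<close>

lemma summable_poly_geometric:
  fixes x :: real
  assumes "\<bar>x\<bar> < 1"
  shows "summable (\<lambda>k. (real k + 1) ^ m * x ^ k)"
  using assms
proof (induction m arbitrary: x)
  case 0
  then show ?case by (simp add: summable_geometric)
next
  case (Suc m)
  have "summable (\<lambda>n. diffs (\<lambda>n. real n ^ m) n * x ^ n)"
  proof (rule termdiff_converges[of x 1])
    fix y :: real
    assume y: "norm y < 1"
    show "summable (\<lambda>n. real n ^ m * y ^ n)"
      by (rule summable_comparison_test'[OF Suc.IH[of "\<bar>y\<bar>"], of 0])
        (use y in \<open>auto simp: abs_mult power_abs intro!: mult_right_mono power_mono\<close>)
  qed (use Suc.prems in simp)
  then show ?case by (simp add: diffs_def add.commute)
qed

lemma psum_binomial:
  assumes "\<bar>r\<bar> \<le> 1" "0 \<le> c" "c < 1"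
  shows "psum (\<lambda>k. (r gchoose k) * (- c) ^ k)"
  unfolding psum_def
proof
  fix m
  have "summable (\<lambda>k. c ^ k * (real k + 1) ^ m)"
    using summable_poly_geometric[of c m] assms by (simp add: mult.commute)
  then show "summable (\<lambda>k. \<bar>(r gchoose k) * (- c) ^ k\<bar> * (real k + 1) ^ m)"
  proof (rule summable_comparison_test'[of _ 0])
    fix k
    have "\<bar>(r gchoose k) * (- c) ^ k\<bar> \<le> 1 * c ^ k"
      unfolding abs_mult using gchoose_le_1[OF assms(1)] assms(2) by (intro mult_mono) (simp_all add: power_abs)
    then show "norm (\<bar>(r gchoose k) * (- c) ^ k\<bar> * (real k + 1) ^ m) \<le> c ^ k * (real k + 1) ^ m"
      by (simp add: mult_right_mono)
  qed
qed

lemma binser_pser: "binser c r = pser (\<lambda>k. (r gchoose k) * (- c) ^ k)"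
  by (simp add: binser_def pser_def)

lemma binser_bdd: "\<bar>r\<bar> \<le> 1 \<Longrightarrow> 0 \<le> c \<Longrightarrow> c < 1 \<Longrightarrow> binser c r \<in> bdd"
  unfolding binser_pser by (intro pser_bdd psum_binomial)

lemma binser_mult:
  assumes "\<bar>r\<bar> \<le> 1" "\<bar>r'\<bar> \<le> 1" "\<bar>r + r'\<bar> \<le> 1" "0 \<le> c" "c < 1"
  shows "binser c r * binser c r' - binser c (r + r') \<in> null"
proof -
  have "(\<Sum>i\<le>k. ((r gchoose i) * (- c) ^ i) * ((r' gchoose (k - i)) * (- c) ^ (k - i))) = ((r + r') gchoose k) * (- c) ^ k" for k
  proof -
    have "(\<Sum>i\<le>k. ((r gchoose i) * (- c) ^ i) * ((r' gchoose (k - i)) * (- c) ^ (k - i)))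
      = (\<Sum>i\<le>k. (r gchoose i) * (r' gchoose (k - i))) * (- c) ^ k"
      unfolding sum_distrib_right
    proof (intro sum.cong refl)
      fix i assume "i \<in> {..k}"
      then have "(- c) ^ i * (- c) ^ (k - i) = (- c) ^ k" by (simp flip: power_add)
      then show "((r gchoose i) * (- c) ^ i) * ((r' gchoose (k - i)) * (- c) ^ (k - i))
        = (r gchoose i) * (r' gchoose (k - i)) * (- c) ^ k"
        by (metis (no_types, lifting) mult.assoc mult.left_commute)
    qed
    then show ?thesis by (simp add: gbinomial_Vandermonde atMost_atLeast0)
  qed
  then show ?thesis
    using pser_mult_null[OF psum_binomial[OF assms(1,4,5)] psum_binomial[OF assms(2,4,5)]] psum_binomial[OF assms(3-5)]
    by (simp add: binser_pser)
qed

text \<open>Serves the exponent 1, where the binomial series is exact from \<open>n = 1\<close> on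
  while the partial sum at \<open>n = 0\<close> lacks the linear term.\<close>

lemma eventually_null:
  assumes "x \<in> bdd" "\<And>n. n \<ge> 1 \<Longrightarrow> x n = 0"
  shows "x \<in> null"
proof -
  have "eventually (\<lambda>n. cnorm q (acts q hs (x n)) = 0) sequentially" for hs
    using eventually_ge_at_top[of 1] by eventually_elim (simp add: assms(2))
  then show ?thesis
    using assms(1) tendsto_eventually[of "\<lambda>n. cnorm q (acts q hs (x n))" 0 sequentially for hs]
    unfolding null_def by simp
qed

lemma binser_1: "0 \<le> c \<Longrightarrow> c < 1 \<Longrightarrow> binser c 1 - (1 - rsc c * emb p11) \<in> null"
proof (rule eventually_null)
  fix n :: nat
  assume "n \<ge> 1"
  then obtain n' where n: "n = Suc n'" by (cases n) auto
  have "(1::real) gchoose k = of_nat (1 choose k)" for k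
    using binomial_gbinomial[of 1 k, where ?'a = real] by simp
  then have "binser c 1 n = (\<Sum>k\<in>{0, 1}. rscal ((1 gchoose k) * (- c) ^ k) * p11 ^ k)"
    unfolding binser_def n by (intro sum.mono_neutral_right) (auto simp: binomial_eq_0)
  then show "(binser c 1 - (1 - rsc c * emb p11)) n = 0"
    by (simp add: rsc_def emb_def rscal_minus)
next
  assume "0 \<le> c" "c < 1"
  then show "binser c 1 - (1 - rsc c * emb p11) \<in> bdd"
    using bdd_emb[of 1] by (intro bdd_diff binser_bdd bdd_mult rsc_bdd bdd_emb) (simp_all add: emb_hom)
qed

lemma binser_0: "binser c 0 = 1"
proof
  fix n
  have "(0::real) gchoose k = of_bool (k = 0)" for k by (cases k) simp_all
  then have "binser c 0 n = (\<Sum>k\<in>{0}. rscal ((0 gchoose k) * (- c) ^ k) * p11 ^ k)"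
    unfolding binser_def by (intro sum.mono_neutral_right) auto
  then show "binser c 0 n = 1 n" by simp
qed

lemma cstar_binser: "cstar (binser c r) = binser c r"
proof -
  have "fstar p11 = p11" by (simp add: p11_def fstar_mult)
  then show ?thesis
    by (simp add: cstar_def binser_def fstar_sum fstar_mult fstar_power flip: rscal_comm)
qed

lemma act_p11_power: "act q (K i) (p11 ^ k) = p11 ^ k" "act q (Kinv i) (p11 ^ k) = p11 ^ k"
  by (induction k) (simp_all add: act_mult act_p11 act_1)

lemma cact_binser: "cact q (K i) (binser c r) = binser c r" "cact q (Kinv i) (binser c r) = binser c r"
  by (simp_all add: cact_def binser_def act_sum act_rscal_mult act_p11_power)

text \<open>The bound \<open>q < 1\<close> keeps every coefficient \<open>t^2 q^k\<close> below 1,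
  inside the disc of convergence of the binomial series.\<close>

lemma enl_bdd:
  assumes "x \<in> enl q t" "t\<^sup>2 < 1" "q < 1"
  shows "x \<in> bdd"
proof -
  have c: "0 \<le> t\<^sup>2 * q ^ k" "t\<^sup>2 * q ^ k < 1" for k
  proof -
    show "0 \<le> t\<^sup>2 * q ^ k" using q_pos by simp
    have "t\<^sup>2 * q ^ k \<le> t\<^sup>2 * 1"
      using q_pos assms(3) by (intro mult_left_mono power_le_one) simp_all
    then show "t\<^sup>2 * q ^ k < 1" using assms(2) by simp
  qed
  show ?thesis
    using assms(1)
    by induction (simp_all add: bdd_emb bdd_add[unfolded plus_fun_def] bdd_mult[unfolded times_fun_def]
        bdd_cstar bdd_cact binser_bdd c)
qed

end

section \<open>The enlarged algebra modulo null sequences\<close>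

context suq
begin

definition cls :: "calg \<Rightarrow> quot" where "cls x = proj (bdd, null) x"

definition R :: "quot set" where "R = cls ` bdd"

text \<open>The action on classes through a chosen bounded representative; the choice is harmless
  because \<open>null\<close> is stable under the action, see \<open>A_cls\<close>.\<close>

definition A :: "uq \<Rightarrow> quot \<Rightarrow> quot" where
  "A h X = cls (cact q h (SOME x. x \<in> bdd \<and> cls x = X))"

abbreviation "\<Q> \<equiv> quo.Q"

lemma cls_eq_iff: "x \<in> bdd \<Longrightarrow> y \<in> bdd \<Longrightarrow> cls x = cls y \<longleftrightarrow> ceq q x y"
  by (simp add: cls_def proj_eq_ceq)

lemma cls_eq_null: "x \<in> bdd \<Longrightarrow> y \<in> bdd \<Longrightarrow> cls x = cls y \<longleftrightarrow> x - y \<in> null"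
  using proj_eq_iff[OF admissible_bdd, of x y] by (simp add: cls_def)

lemma bdd_uminus: "x \<in> bdd \<Longrightarrow> - x \<in> bdd"
  using adm_uminus(1)[OF admissible_bdd] by simp

lemma bdd_0: "0 \<in> bdd" and bdd_1: "1 \<in> bdd"
  using adm_0[OF admissible_bdd] adm_1[OF admissible_bdd] by simp_all

lemma bdd_sum: "(\<And>i. i \<in> I \<Longrightarrow> f i \<in> bdd) \<Longrightarrow> sum f I \<in> bdd"
  by (induction I rule: infinite_finite_induct) (simp_all add: bdd_0 bdd_add)

lemmas bdd_intros [simp, intro] = bdd_0 bdd_1 bdd_add bdd_mult bdd_diff bdd_uminus bdd_cact bdd_sum rsc_bdd csc_bdd
  bdd_emb bdd_cstar

lemma cls_hom:
  "x \<in> bdd \<Longrightarrow> y \<in> bdd \<Longrightarrow> cls (x + y) = cls x + cls y"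
  "x \<in> bdd \<Longrightarrow> y \<in> bdd \<Longrightarrow> cls (x - y) = cls x - cls y"
  "x \<in> bdd \<Longrightarrow> y \<in> bdd \<Longrightarrow> cls (x * y) = cls x * cls y"
  "x \<in> bdd \<Longrightarrow> cls (- x) = - cls x"
  "cls 0 = 0"
  by (simp_all add: cls_def proj_add proj_diff proj_mult proj_minus proj_0 admissible_bdd)

lemma cls_rsc: "x \<in> bdd \<Longrightarrow> cls (rsc r * x) = r *\<^sub>R cls x"
  using proj_rsc[OF admissible_bdd, of x] by (simp add: cls_def)

lemma cls_rsc_only: "cls (rsc r) = r *\<^sub>R cls 1"
  using cls_rsc[OF bdd_1, of r] by simp

lemma cls_sum: "(\<And>i. i \<in> I \<Longrightarrow> f i \<in> bdd) \<Longrightarrow> cls (sum f I) = (\<Sum>i\<in>I. cls (f i))"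
  by (induction I rule: infinite_finite_induct) (simp_all add: cls_hom)

lemma cls_emb: "cls (emb a) = quo.P a"
  by (simp add: cls_def quo.P_def)

lemma R_cls [simp, intro]: "x \<in> bdd \<Longrightarrow> cls x \<in> R"
  by (simp add: R_def)

lemma R_cases: assumes "X \<in> R" obtains x where "x \<in> bdd" "X = cls x"
  using assms by (auto simp: R_def)

lemma A_cls: "x \<in> bdd \<Longrightarrow> A h (cls x) = cls (cact q h x)"
proof -
  assume x: "x \<in> bdd"
  define y where "y = (SOME y. y \<in> bdd \<and> cls y = cls x)"
  have "y \<in> bdd \<and> cls y = cls x" unfolding y_def by (rule someI[of _ x]) (simp add: x)
  then have "y - x \<in> null" and y: "y \<in> bdd" using x by (auto simp: cls_eq_null)
  then have "cact q h (y - x) \<in> null" by (simp add: null_cact)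
  moreover have "cact q h (y - x) = cact q h y - cact q h x" by (simp add: cact_def act_diff fun_eq_iff)
  ultimately have "cls (cact q h y) = cls (cact q h x)" using x y by (simp add: cls_eq_null)
  then show ?thesis by (simp add: A_def y_def)
qed

lemma R_0 [simp]: "0 \<in> R" and R_add [simp, intro]: "X \<in> R \<Longrightarrow> Y \<in> R \<Longrightarrow> X + Y \<in> R"
  and R_diff [simp, intro]: "X \<in> R \<Longrightarrow> Y \<in> R \<Longrightarrow> X - Y \<in> R"
  and R_mult [simp, intro]: "X \<in> R \<Longrightarrow> Y \<in> R \<Longrightarrow> X * Y \<in> R"
  and R_uminus [simp, intro]: "X \<in> R \<Longrightarrow> - X \<in> R"
  and R_scaleR [simp, intro]: "X \<in> R \<Longrightarrow> r *\<^sub>R X \<in> R"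
  and R_A [simp, intro]: "X \<in> R \<Longrightarrow> A h X \<in> R"
proof -
  show "0 \<in> R" using R_cls[of 0] by (simp add: cls_hom)
  show "X \<in> R \<Longrightarrow> Y \<in> R \<Longrightarrow> X + Y \<in> R" "X \<in> R \<Longrightarrow> Y \<in> R \<Longrightarrow> X - Y \<in> R" "X \<in> R \<Longrightarrow> Y \<in> R \<Longrightarrow> X * Y \<in> R"
    by (auto elim!: R_cases simp flip: cls_hom)
  show "X \<in> R \<Longrightarrow> - X \<in> R" "X \<in> R \<Longrightarrow> r *\<^sub>R X \<in> R" by (auto elim!: R_cases simp flip: cls_hom cls_rsc)
  show "X \<in> R \<Longrightarrow> A h X \<in> R" by (auto elim!: R_cases simp: A_cls)
qed

lemma R_sum [simp, intro]: "(\<And>i. i \<in> I \<Longrightarrow> f i \<in> R) \<Longrightarrow> sum f I \<in> R"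
  by (induction I rule: infinite_finite_induct) simp_all

lemma R_unit [simp]: "X \<in> R \<Longrightarrow> cls 1 * X = X" "X \<in> R \<Longrightarrow> X * cls 1 = X"
  by (auto elim!: R_cases simp flip: cls_hom)

definition Cc :: "complex \<Rightarrow> quot" where "Cc c = cls (csc c)"

lemma R_Cc [simp]: "Cc c \<in> R" by (simp add: Cc_def)

lemma csc_comm: "csc c * x = x * csc c"
  by (auto simp: csc_def emb_def fun_eq_iff intro: scal_comm)

lemma Cc_comm: "X \<in> R \<Longrightarrow> Cc c * X = X * Cc c"
  by (auto elim!: R_cases simp: Cc_def csc_comm simp flip: cls_hom)

lemma Cc_left_comm: "X \<in> R \<Longrightarrow> X * (Cc c * Y) = Cc c * (X * Y)"
  by (metis Cc_comm mult.assoc)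

lemma Cc_real: "X \<in> R \<Longrightarrow> Cc (complex_of_real r) * X = r *\<^sub>R X"
proof -
  have "csc (complex_of_real r) = rsc r" by (simp add: csc_def rsc_def rscal_def)
  then show "X \<in> R \<Longrightarrow> Cc (complex_of_real r) * X = r *\<^sub>R X"
    by (auto elim!: R_cases simp: Cc_def simp flip: cls_hom(3) cls_rsc)
qed

lemma Cc_mult: "Cc c * Cc d = Cc (c * d)"
proof -
  have "csc c * csc d = csc (c * d)" by (simp add: csc_def scal_mult emb_hom)
  then show ?thesis unfolding Cc_def by (simp flip: cls_hom)
qed

lemma Cc_0: "Cc 0 = 0" and Cc_1: "X \<in> R \<Longrightarrow> Cc 1 * X = X"
proof -
  have "csc 0 = 0" by (simp add: csc_def emb_hom)
  then show "Cc 0 = 0" by (simp add: Cc_def cls_hom)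
  show "X \<in> R \<Longrightarrow> Cc 1 * X = X" using Cc_real[of X 1] by simp
qed

lemma A_add: "X \<in> R \<Longrightarrow> Y \<in> R \<Longrightarrow> A h (X + Y) = A h X + A h Y"
  and A_diff: "X \<in> R \<Longrightarrow> Y \<in> R \<Longrightarrow> A h (X - Y) = A h X - A h Y"
  and A_uminus: "X \<in> R \<Longrightarrow> A h (- X) = - A h X"
  and A_0 [simp]: "A h 0 = 0"
  and A_scaleR: "X \<in> R \<Longrightarrow> A h (r *\<^sub>R X) = r *\<^sub>R A h X"
  and A_Cc: "X \<in> R \<Longrightarrow> A h (Cc c * X) = Cc c * A h X"
proof -
  have c: "cact q h (x + y) = cact q h x + cact q h y" "cact q h (x - y) = cact q h x - cact q h y"
    "cact q h (- x) = - cact q h x" "cact q h (rsc r * x) = rsc r * cact q h x"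
    "cact q h (csc c * x) = csc c * cact q h x" "cact q h 0 = 0" for x y r c
    by (simp_all add: cact_def fun_eq_iff act_add act_diff act_minus rsc_def csc_def emb_def act_rscal_mult act_scal_mult)
  show "X \<in> R \<Longrightarrow> Y \<in> R \<Longrightarrow> A h (X + Y) = A h X + A h Y"
    by (elim R_cases) (simp add: A_cls c flip: cls_hom)
  show "X \<in> R \<Longrightarrow> Y \<in> R \<Longrightarrow> A h (X - Y) = A h X - A h Y"
    by (elim R_cases) (simp add: A_cls c flip: cls_hom)
  show "X \<in> R \<Longrightarrow> A h (- X) = - A h X"
    by (elim R_cases) (simp add: A_cls c flip: cls_hom)
  show "A h 0 = 0"
    using A_cls[OF bdd_0, of h] by (simp add: c cls_hom)
  show "X \<in> R \<Longrightarrow> A h (r *\<^sub>R X) = r *\<^sub>R A h X"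
    by (elim R_cases) (simp add: A_cls c flip: cls_rsc)
  show "X \<in> R \<Longrightarrow> A h (Cc c * X) = Cc c * A h X"
    by (elim R_cases) (simp add: A_cls c Cc_def flip: cls_hom)
qed

lemma A_mult_K: "X \<in> R \<Longrightarrow> Y \<in> R \<Longrightarrow> A (K i) (X * Y) = A (K i) X * A (K i) Y"
  and A_mult_E: "X \<in> R \<Longrightarrow> Y \<in> R \<Longrightarrow> A (E i) (X * Y) = A (E i) X * A (K i) Y + A (Kinv i) X * A (E i) Y"
  and A_mult_F: "X \<in> R \<Longrightarrow> Y \<in> R \<Longrightarrow> A (F i) (X * Y) = A (F i) X * A (K i) Y + A (Kinv i) X * A (F i) Y"
proof -
  have c: "cact q (K i) (x * y) = cact q (K i) x * cact q (K i) y"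
    "cact q (E i) (x * y) = cact q (E i) x * cact q (K i) y + cact q (Kinv i) x * cact q (E i) y"
    "cact q (F i) (x * y) = cact q (F i) x * cact q (K i) y + cact q (Kinv i) x * cact q (F i) y" for x y
    by (simp_all add: cact_def fun_eq_iff act_mult)
  show "X \<in> R \<Longrightarrow> Y \<in> R \<Longrightarrow> A (K i) (X * Y) = A (K i) X * A (K i) Y"
    "X \<in> R \<Longrightarrow> Y \<in> R \<Longrightarrow> A (E i) (X * Y) = A (E i) X * A (K i) Y + A (Kinv i) X * A (E i) Y"
    "X \<in> R \<Longrightarrow> Y \<in> R \<Longrightarrow> A (F i) (X * Y) = A (F i) X * A (K i) Y + A (Kinv i) X * A (F i) Y"
    by (elim R_cases; simp add: A_cls c flip: cls_hom)+
qed

lemmas A_mult = A_mult_K A_mult_E A_mult_F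

lemma A_K_Kinv [simp]: "X \<in> R \<Longrightarrow> A (K i) (A (Kinv i) X) = X"
  and A_Kinv_K [simp]: "X \<in> R \<Longrightarrow> A (Kinv i) (A (K i) X) = X"
proof -
  have c: "cact q (K i) (cact q (Kinv i) x) = x" "cact q (Kinv i) (cact q (K i) x) = x" for x
    by (simp_all add: cact_def act_K_Kinv[OF q_pos] act_Kinv_K[OF q_pos])
  show "X \<in> R \<Longrightarrow> A (K i) (A (Kinv i) X) = X" "X \<in> R \<Longrightarrow> A (Kinv i) (A (K i) X) = X"
    by (auto elim!: R_cases simp: A_cls c)
qed

lemma cls_qs: "x \<in> bdd \<Longrightarrow> cls (\<lambda>n. qs q a * x n) = \<Q> a *\<^sub>R cls x"
proof -
  have "(\<lambda>n. qs q a * x n) = rsc (q powr a) * x" by (simp add: qs_def rsc_def emb_def fun_eq_iff)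
  then show "x \<in> bdd \<Longrightarrow> cls (\<lambda>n. qs q a * x n) = \<Q> a *\<^sub>R cls x" by (simp add: cls_rsc quo.Q_def)
qed

lemma A_K_E: "X \<in> R \<Longrightarrow> A (K i) (A (E j) X) = \<Q> (- kw i j) *\<^sub>R A (E j) (A (K i) X)"
  and A_K_F: "X \<in> R \<Longrightarrow> A (K i) (A (F j) X) = \<Q> (kw i j) *\<^sub>R A (F j) (A (K i) X)"
proof -
  have c: "cact q (K i) (cact q (E j) x) = (\<lambda>n. qs q (- kw i j) * cact q (E j) (cact q (K i) x) n)"
    "cact q (K i) (cact q (F j) x) = (\<lambda>n. qs q (kw i j) * cact q (F j) (cact q (K i) x) n)" for x
    by (simp_all add: cact_def act_K_E[OF q_pos] act_K_F[OF q_pos])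
  show "X \<in> R \<Longrightarrow> A (K i) (A (E j) X) = \<Q> (- kw i j) *\<^sub>R A (E j) (A (K i) X)"
    "X \<in> R \<Longrightarrow> A (K i) (A (F j) X) = \<Q> (kw i j) *\<^sub>R A (F j) (A (K i) X)"
    by (auto elim!: R_cases simp: A_cls c cls_qs)
qed

lemma A_E_F_comm: "i \<noteq> j \<Longrightarrow> X \<in> R \<Longrightarrow> A (F j) (A (E i) X) = A (E i) (A (F j) X)"
proof -
  have "i \<noteq> j \<Longrightarrow> cact q (F j) (cact q (E i) x) = cact q (E i) (cact q (F j) x)" for x
    by (simp add: cact_def act_E_F_comm q_pos)
  then show "i \<noteq> j \<Longrightarrow> X \<in> R \<Longrightarrow> A (F j) (A (E i) X) = A (E i) (A (F j) X)"
    by (auto elim!: R_cases simp: A_cls)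
qed

lemma cls_expr:
  assumes "x \<in> bdd" "y \<in> bdd" "w \<in> bdd"
  shows "cls (\<lambda>n. x n - (qs q 1 + qs q (- 1)) * y n + w n) = cls x - (\<Q> 1 + \<Q> (- 1)) *\<^sub>R cls y + cls w"
    and "cls (\<lambda>n. (qs q 1 - qs q (- 1)) * (x n - y n)) = (\<Q> 1 - \<Q> (- 1)) *\<^sub>R (cls x - cls y)"
proof -
  have "(\<lambda>n. x n - (qs q 1 + qs q (- 1)) * y n + w n) = x - (rsc (q powr 1 + q powr - 1) * y) + w"
    "(\<lambda>n. (qs q 1 - qs q (- 1)) * (x n - y n)) = rsc (q powr 1 - q powr - 1) * (x - y)"
    using rscal_add[of "q powr 1" "- (q powr - 1)"]
    by (simp_all add: qs_def rsc_def emb_def fun_eq_iff rscal_add rscal_minus)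
  then show "cls (\<lambda>n. x n - (qs q 1 + qs q (- 1)) * y n + w n) = cls x - (\<Q> 1 + \<Q> (- 1)) *\<^sub>R cls y + cls w"
    "cls (\<lambda>n. (qs q 1 - qs q (- 1)) * (x n - y n)) = (\<Q> 1 - \<Q> (- 1)) *\<^sub>R (cls x - cls y)"
    using assms by (simp_all add: cls_hom cls_rsc_only quo.Q_def)
qed

lemma A_EF: "X \<in> R \<Longrightarrow> (\<Q> 1 - \<Q> (- 1)) *\<^sub>R (A (F i) (A (E i) X) - A (E i) (A (F i) X))
    = A (K i) (A (K i) X) - A (Kinv i) (A (Kinv i) X)"
proof (elim R_cases)
  fix x assume x: "x \<in> bdd" "X = cls x"
  have "(\<Q> 1 - \<Q> (- 1)) *\<^sub>R (A (F i) (A (E i) X) - A (E i) (A (F i) X))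
    = cls (\<lambda>n. (qs q 1 - qs q (- 1)) * (cact q (F i) (cact q (E i) x) n - cact q (E i) (cact q (F i) x) n))"
    using x by (subst cls_expr(2)[of _ _ 0]) (simp_all add: A_cls)
  also have "\<dots> = cls (cact q (K i) (cact q (K i) x) - cact q (Kinv i) (cact q (Kinv i) x))"
    by (rule arg_cong[of _ _ cls]) (simp add: cact_def act_EF_qs[OF q_pos] fun_eq_iff)
  finally show ?thesis using x by (simp add: cls_hom A_cls)
qed

lemma A_serre_E: "X \<in> R \<Longrightarrow> A (E N2) (A (E N1) (A (E N1) X)) - (\<Q> 1 + \<Q> (- 1)) *\<^sub>R A (E N1) (A (E N2) (A (E N1) X))
    + A (E N1) (A (E N1) (A (E N2) X)) = 0"
proof (elim R_cases)
  fix x assume x: "x \<in> bdd" "X = cls x"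
  have "A (E N2) (A (E N1) (A (E N1) X)) - (\<Q> 1 + \<Q> (- 1)) *\<^sub>R A (E N1) (A (E N2) (A (E N1) X))
    + A (E N1) (A (E N1) (A (E N2) X)) = cls (\<lambda>n. cact q (E N2) (cact q (E N1) (cact q (E N1) x)) n
     - (qs q 1 + qs q (- 1)) * cact q (E N1) (cact q (E N2) (cact q (E N1) x)) n + cact q (E N1) (cact q (E N1) (cact q (E N2) x)) n)"
    using x by (subst cls_expr(1)) (simp_all add: A_cls)
  also have "\<dots> = cls 0"
    by (rule arg_cong[of _ _ cls]) (simp add: cact_def act_serre_E[OF q_pos] fun_eq_iff)
  finally show ?thesis by (simp add: cls_hom)
qed

lemma A_serre_F: "X \<in> R \<Longrightarrow> A (F N2) (A (F N1) (A (F N1) X)) - (\<Q> 1 + \<Q> (- 1)) *\<^sub>R A (F N1) (A (F N2) (A (F N1) X))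
    + A (F N1) (A (F N1) (A (F N2) X)) = 0"
proof (elim R_cases)
  fix x assume x: "x \<in> bdd" "X = cls x"
  have "A (F N2) (A (F N1) (A (F N1) X)) - (\<Q> 1 + \<Q> (- 1)) *\<^sub>R A (F N1) (A (F N2) (A (F N1) X))
    + A (F N1) (A (F N1) (A (F N2) X)) = cls (\<lambda>n. cact q (F N2) (cact q (F N1) (cact q (F N1) x)) n
     - (qs q 1 + qs q (- 1)) * cact q (F N1) (cact q (F N2) (cact q (F N1) x)) n + cact q (F N1) (cact q (F N1) (cact q (F N2) x)) n)"
    using x by (subst cls_expr(1)) (simp_all add: A_cls)
  also have "\<dots> = cls 0"
    by (rule arg_cong[of _ _ cls]) (simp add: cact_def act_serre_F[OF q_pos] fun_eq_iff)
  finally show ?thesis by (simp add: cls_hom)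
qed

subsection \<open>Positivity of \<open>K\<^sub>2\<close>\<close>

(* Unification eta-expands sums and products of sequences, which these rules would then unfold. *)
declare plus_fun_apply [simp del] times_fun_apply [simp del]

text \<open>Sums of weight vectors of \<open>K_2\<close> with positive eigenvalues. Such
  decompositions pass through products, adjoints (which invert the eigenvalue) and the action, and
  so exist on the whole enlarged algebra.\<close>

inductive wsum :: "calg \<Rightarrow> bool" where
  base: "x \<in> bdd \<Longrightarrow> l > 0 \<Longrightarrow> cact q (K N2) x = rsc l * x \<Longrightarrow> wsum x"
| sum: "wsum x \<Longrightarrow> wsum y \<Longrightarrow> wsum (x + y)"

lemma wsum_base: "x \<in> bdd \<Longrightarrow> l > 0 \<Longrightarrow> cact q (K N2) x = rsc l * x \<Longrightarrow> wsum x"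
  by (rule wsum.base) (simp_all add: times_fun_def)

lemma wsum_sum: "wsum x \<Longrightarrow> wsum y \<Longrightarrow> wsum (x + y)"
  by (rule wsum.sum)

lemma wsum_induct [consumes 1, case_names base sum]:
  assumes "wsum x" and "\<And>x l. x \<in> bdd \<Longrightarrow> l > 0 \<Longrightarrow> cact q (K N2) x = rsc l * x \<Longrightarrow> P x"
    and "\<And>x y. wsum x \<Longrightarrow> P x \<Longrightarrow> wsum y \<Longrightarrow> P y \<Longrightarrow> P (x + y)"
  shows "P x"
  using assms(1)
proof (induction rule: wsum.induct)
  case (base x l)
  then show ?case using assms(2)[of x l] by (simp add: times_fun_def)
next
  case (sum x y)
  then show ?case using assms(3)[of x y] by (simp add: plus_fun_def)
qed

lemma wsum_mult: "wsum x \<Longrightarrow> wsum y \<Longrightarrow> wsum (x * y)"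
proof (erule wsum_induct, goal_cases base sum)
  case (base x l)
  note x = base(2-4)
  from base(1) show ?case
  proof (rule wsum_induct, goal_cases base sum)
    case (base y m)
    have "cact q (K N2) (x * y) = cact q (K N2) x * cact q (K N2) y"
      by (simp add: cact_def act_mult fun_eq_iff plus_fun_apply times_fun_apply)
    then have "cact q (K N2) (x * y) = rsc (l * m) * (x * y)"
      by (simp add: base x rsc_simps mult.assoc rsc_left_comm[of x])
    with base x show ?case by (intro wsum_base[of _ "l * m"]) simp_all
  qed (simp add: distrib_left wsum_sum)
qed (simp add: distrib_right wsum_sum)

lemma cact_Kinv_eigen:
  assumes "l > 0" "cact q (K N2) x = rsc l * x"
  shows "cact q (Kinv N2) x = rsc (1 / l) * x"
proof -
  have "x = rsc (1 / l) * (rsc l * x)"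
    using assms(1) by (simp add: rsc_simps(4) flip: mult.assoc rsc_simps(2))
  then have "cact q (Kinv N2) x = cact q (Kinv N2) (rsc (1 / l) * cact q (K N2) x)"
    by (simp add: assms(2))
  also have "\<dots> = rsc (1 / l) * x"
    by (simp add: cact_def rsc_def emb_def fun_eq_iff plus_fun_apply times_fun_apply act_rscal_mult act_Kinv_K[OF q_pos])
  finally show ?thesis .
qed

lemma wsum_cstar: "wsum x \<Longrightarrow> wsum (cstar x)"
proof (erule wsum_induct, goal_cases base sum)
  case (base x l)
  have "cact q (K N2) (cstar x) = cstar (cact q (Kinv N2) x)"
    by (simp add: cact_def cstar_def fun_eq_iff plus_fun_apply times_fun_apply act_fstar[OF q_pos])
  also have "\<dots> = rsc (1 / l) * cstar x"
    unfolding cact_Kinv_eigen[OF base(2,3)]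
    by (simp add: cstar_def rsc_def emb_def fun_eq_iff plus_fun_apply times_fun_apply fstar_mult rscal_comm)
  finally show ?case using base by (intro wsum_base[of _ "1 / l"]) simp_all
next
  case (sum x y)
  moreover have "cstar (x + y) = cstar x + cstar y" by (simp add: cstar_def fun_eq_iff plus_fun_apply times_fun_apply fstar_add)
  ultimately show ?case by (simp add: wsum_sum)
qed

lemma wsum_cact: "wsum x \<Longrightarrow> wsum (cact q h x)"
proof (erule wsum_induct, goal_cases base sum)
  case (base x l)
  have "\<exists>a. cact q (K N2) (cact q h x) = rsc (q powr a) * cact q h (cact q (K N2) x)"
  proof (cases h)
    case (K i)
    then show ?thesis using act_K_K[OF q_pos, of N2 i] q_pos
      by (intro exI[of _ 0]) (simp add: cact_def fun_eq_iff plus_fun_apply times_fun_apply rsc_simps)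
  next
    case (Kinv i)
    then show ?thesis using act_K_Kinv'[OF q_pos, of N2 i] q_pos
      by (intro exI[of _ 0]) (simp add: cact_def fun_eq_iff plus_fun_apply times_fun_apply rsc_simps)
  next
    case (E i)
    then show ?thesis using act_K_E[OF q_pos, of N2 i]
      by (intro exI[of _ "- kw N2 i"]) (simp add: cact_def fun_eq_iff plus_fun_apply times_fun_apply rsc_def emb_def qs_def)
  next
    case (F i)
    then show ?thesis using act_K_F[OF q_pos, of N2 i]
      by (intro exI[of _ "kw N2 i"]) (simp add: cact_def fun_eq_iff plus_fun_apply times_fun_apply rsc_def emb_def qs_def)
  qed
  then obtain a where "cact q (K N2) (cact q h x) = rsc (q powr a) * cact q h (cact q (K N2) x)" by blast
  also have "\<dots> = rsc (q powr a * l) * cact q h x"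
    unfolding base(3) by (simp add: cact_def rsc_def emb_def fun_eq_iff plus_fun_apply times_fun_apply act_rscal_mult rscal_mult mult.assoc)
  finally show ?case using base q_pos by (intro wsum_base[of _ "q powr a * l"]) simp_all
next
  case (sum x y)
  moreover have "cact q h (x + y) = cact q h x + cact q h y" by (simp add: cact_def fun_eq_iff plus_fun_apply times_fun_apply act_add)
  ultimately show ?case by (simp add: wsum_sum)
qed

lemma wsum_emb: "wsum (emb a)"
proof (rule falg_induct[of "\<lambda>a. wsum (emb a)"], goal_cases add scal gen)
  case (add a b)
  then show ?case unfolding emb_hom by (rule wsum_sum)
next
  case (scal c)
  show ?case by (rule wsum_base[of _ 1]) (simp_all add: rsc_simps cact_def act_scal bdd_emb[unfolded emb_def] emb_def)
next
  case (gen l a)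
  have "wsum (emb (gen l))"
  proof (cases l)
    case (U i j)
    show ?thesis
      by (rule wsum_base[of _ "q powr kexp N2 i"])
        (use q_pos bdd_emb[of "gen (U i j)"] in \<open>simp_all add: U rsc_def cact_def emb_def act_gen lact_qs qs_def fun_eq_iff plus_fun_apply times_fun_apply\<close>)
  next
    case (Us i j)
    show ?thesis
      by (rule wsum_base[of _ "q powr (- kexp N2 i)"])
        (use q_pos bdd_emb[of "gen (Us i j)"] in \<open>simp_all add: Us rsc_def cact_def emb_def act_gen lact_qs qs_def fun_eq_iff plus_fun_apply times_fun_apply\<close>)
  qed
  with gen show ?case unfolding emb_hom by (intro wsum_mult)
qed

lemma enl_wsum:
  assumes "x \<in> enl q t" "t\<^sup>2 < 1" "q < 1"
  shows "wsum x"
  using assms(1)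
proof induction
  case (2 k)
  show ?case
    using enl_bdd[OF enl.intros(2) assms(2,3)] by (intro wsum_base[of _ 1]) (simp_all add: cact_binser rsc_simps)
next
  case (3 k)
  then show ?case
    using enl_bdd[OF enl.intros(3) assms(2,3)] by (intro wsum_base[of _ 1]) (simp_all add: cact_binser rsc_simps)
next
  case (4 x y)
  then show ?case using wsum_sum[of x y] by (simp add: plus_fun_def)
next
  case (5 x y)
  then show ?case using wsum_mult[of x y] by (simp add: times_fun_def)
qed (simp_all add: wsum_emb wsum_cstar wsum_cact)

definition Dl :: "real \<Rightarrow> quot \<Rightarrow> quot" where "Dl l X = A (K N2) X - l *\<^sub>R X"

lemma Dl_R [simp]: "X \<in> R \<Longrightarrow> Dl l X \<in> R"
  by (simp add: Dl_def)

lemma Dl_add: "X \<in> R \<Longrightarrow> Y \<in> R \<Longrightarrow> Dl l (X + Y) = Dl l X + Dl l Y"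
  and Dl_diff: "X \<in> R \<Longrightarrow> Y \<in> R \<Longrightarrow> Dl l (X - Y) = Dl l X - Dl l Y"
  and Dl_K: "X \<in> R \<Longrightarrow> Dl l (A (K N2) X) = A (K N2) (Dl l X)"
  and Dl_comm: "X \<in> R \<Longrightarrow> Dl l (Dl m X) = Dl m (Dl l X)"
  by (simp_all add: Dl_def A_add A_diff A_scaleR algebra_simps)

lemma foldr_Dl_R [simp]: "X \<in> R \<Longrightarrow> foldr Dl ls X \<in> R"
  by (induction ls) simp_all

lemma foldr_Dl:
  "X \<in> R \<Longrightarrow> Y \<in> R \<Longrightarrow> foldr Dl ls (X + Y) = foldr Dl ls X + foldr Dl ls Y"
  "X \<in> R \<Longrightarrow> Y \<in> R \<Longrightarrow> foldr Dl ls (X - Y) = foldr Dl ls X - foldr Dl ls Y"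
  "X \<in> R \<Longrightarrow> foldr Dl ls (A (K N2) X) = A (K N2) (foldr Dl ls X)"
  "X \<in> R \<Longrightarrow> foldr Dl ls (Dl m X) = Dl m (foldr Dl ls X)"
  "foldr Dl ls 0 = 0"
  by (induction ls) (simp_all add: Dl_add Dl_diff Dl_K Dl_comm[of _ m], simp_all add: Dl_def)

lemma foldr_Dl_comm: "X \<in> R \<Longrightarrow> foldr Dl ls (foldr Dl ms X) = foldr Dl ms (foldr Dl ls X)"
  by (induction ms) (simp_all add: foldr_Dl)

lemma wsum_bdd: "wsum x \<Longrightarrow> x \<in> bdd"
  by (erule wsum_induct) simp_all

text \<open>Each summand is killed by its own factor \<open>K_2 - l\<close>; the factors commute, so
  the product of all of them kills the sum.\<close>

lemma wsum_annihilated: "wsum x \<Longrightarrow> \<exists>ls. (\<forall>l\<in>set ls. l > 0) \<and> foldr Dl ls (cls x) = 0"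
proof (erule wsum_induct, goal_cases base sum)
  case (base x l)
  then show ?case by (intro exI[of _ "[l]"]) (simp add: Dl_def A_cls cls_hom cls_rsc_only)
next
  case (sum x y)
  then obtain ls ms where *: "\<forall>l\<in>set ls. l > 0" "foldr Dl ls (cls x) = 0" "\<forall>l\<in>set ms. l > 0" "foldr Dl ms (cls y) = 0"
    by blast
  have "foldr Dl (ls @ ms) (cls (x + y)) = 0"
    using sum(1,3) by (simp add: wsum_bdd cls_hom foldr_Dl * foldr_Dl_comm[of "cls x" ls ms])
  with * show ?case by (intro exI[of _ "ls @ ms"]) auto
qed

text \<open>\<open>K\<^sub>2\<close> acts diagonalisably with positive eigenvalues, so \<open>K\<^sub>2 + 1\<close> is injective.\<close>

lemma K2_fixed:
  assumes "x \<in> enl q t" "t\<^sup>2 < 1" "q < 1" and K2: "A (K N2) (A (K N2) (cls x)) = cls x"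
  shows "A (K N2) (cls x) = cls x"
proof -
  have x: "cls x \<in> R" using enl_bdd[OF assms(1-3)] by simp
  \<comment> \<open>Since \<open>K_2^2\<close> fixes the class, this difference is multiplied by -1
    under \<open>K_2\<close>.\<close>
  define Z where "Z = A (K N2) (cls x) - cls x"
  have Z: "Z \<in> R" "A (K N2) Z = - Z"
    using x by (simp_all add: Z_def A_diff K2)
  obtain ls where ls: "\<forall>l\<in>set ls. l > 0" "foldr Dl ls (cls x) = 0"
    using wsum_annihilated[OF enl_wsum[OF assms(1-3)]] by blast
  \<comment> \<open>On \<open>Z\<close> a factor \<open>K_2 - l\<close> is the scalar
    \<open>-(1 + l)\<close>, nonzero because \<open>l > 0\<close>.\<close>
  have "\<exists>c. c \<noteq> 0 \<and> foldr Dl ms Z = c *\<^sub>R Z" if "\<forall>l\<in>set ms. l > 0" for ms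
    using that
  proof (induction ms)
    case Nil
    show ?case by (rule exI[of _ 1]) simp
  next
    case (Cons l ms)
    then obtain c where c: "c \<noteq> 0" "foldr Dl ms Z = c *\<^sub>R Z" by auto
    have "foldr Dl (l # ms) Z = (- c * (1 + l)) *\<^sub>R Z"
      by (simp add: c Dl_def A_scaleR Z algebra_simps)
    with c(1) Cons.prems show ?case by (intro exI[of _ "- c * (1 + l)"]) auto
  qed
  then obtain c where c: "c \<noteq> 0" "foldr Dl ls Z = c *\<^sub>R Z" using ls by blast
  have "foldr Dl ls Z = 0" using x ls by (simp add: Z_def foldr_Dl)
  with c show ?thesis by (simp add: Z_def)
qed

end

section \<open>Equivariant elements\<close>

locale suq_lt = suq +
  assumes q_lt: "q < 1"
begin

lemma Q_simps: "\<Q> a * \<Q> b = \<Q> (a + b)" "\<Q> 0 = 1" "\<Q> a *\<^sub>R \<Q> b *\<^sub>R (X :: quot) = \<Q> (a + b) *\<^sub>R X"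
  using quo.Q_add quo.Q_0 by (simp_all add: quo.Q_add)

lemma Q_pos [simp]: "\<Q> a > 0" and Q_nz [simp]: "\<Q> a \<noteq> 0"
  using q_pos by (simp_all add: quo.Q_def)

text \<open>Allows the cleared denominator of \<open>[E_1, F_1]\<close> to be cancelled.\<close>

lemma Q_diff: "\<Q> 1 - \<Q> (- 1) \<noteq> 0"
proof -
  have "\<Q> 1 < \<Q> 0" "\<Q> 0 < \<Q> (- 1)"
    unfolding quo.Q_def using q_pos q_lt by (intro powr_less_mono'; simp)+
  then show ?thesis by simp
qed

lemma Kinv_eigen: "X \<in> R \<Longrightarrow> A (K i) X = \<Q> a *\<^sub>R X \<Longrightarrow> A (Kinv i) X = \<Q> (- a) *\<^sub>R X"
proof -
  assume X: "X \<in> R" "A (K i) X = \<Q> a *\<^sub>R X"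
  have "A (Kinv i) X = A (Kinv i) (\<Q> (- a) *\<^sub>R A (K i) X)" by (simp add: X(2) Q_simps)
  also have "\<dots> = \<Q> (- a) *\<^sub>R X" using X(1) by (simp add: A_scaleR)
  finally show ?thesis .
qed

lemma scaled_Kinv_iff: "X \<in> R \<Longrightarrow> \<Q> a *\<^sub>R A (Kinv i) X = X \<longleftrightarrow> A (K i) X = \<Q> a *\<^sub>R X"
proof
  assume X: "X \<in> R" "\<Q> a *\<^sub>R A (Kinv i) X = X"
  have "A (K i) (\<Q> a *\<^sub>R A (Kinv i) X) = \<Q> a *\<^sub>R X" using X(1) by (simp add: A_scaleR)
  then show "A (K i) X = \<Q> a *\<^sub>R X" by (simp add: X(2))
next
  assume "X \<in> R" "A (K i) X = \<Q> a *\<^sub>R X"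
  then have "A (Kinv i) X = \<Q> (- a) *\<^sub>R X" by (rule Kinv_eigen)
  then show "\<Q> a *\<^sub>R A (Kinv i) X = X" by (simp add: Q_simps)
qed

section \<open>Invariants, doublets and triplets of \<open>U_q(su(2))\<close>\<close>

definition LB :: "real \<Rightarrow> quot \<Rightarrow> bool" where
  "LB N X \<longleftrightarrow> X \<in> R \<and> A (K N1) X = X \<and> A (K N2) (A (K N2) X) = \<Q> N *\<^sub>R X \<and> A (E N1) X = 0 \<and> A (F N1) X = 0"

text \<open>\<open>K_2^2\<close> acts by the scalar of \<open>K_1 K_2^2\<close> divided by the
  eigenvalue of \<open>K_1\<close>, hence the shifts of \<open>N\<close> by one half.\<close>

definition HALF :: "real \<Rightarrow> quot \<Rightarrow> quot \<Rightarrow> bool" where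
  "HALF N v w \<longleftrightarrow> v \<in> R \<and> w \<in> R \<and> A (K N1) v = \<Q> (1/2) *\<^sub>R v \<and> A (K N1) w = \<Q> (- 1/2) *\<^sub>R w \<and>
     A (K N2) (A (K N2) v) = \<Q> (N - 1/2) *\<^sub>R v \<and> A (K N2) (A (K N2) w) = \<Q> (N + 1/2) *\<^sub>R w \<and>
     A (E N1) v = w \<and> A (E N1) w = 0 \<and> A (F N1) v = 0 \<and> A (F N1) w = v"

definition rt :: real where "rt = sqrt (\<Q> 1 + \<Q> (- 1))"

lemma rt_pos: "rt > 0" and rt_sq: "rt * rt = \<Q> 1 + \<Q> (- 1)"
  by (simp_all add: rt_def add_pos_pos) (simp add: less_imp_le add_nonneg_nonneg)

definition SPIN1 :: "real \<Rightarrow> quot \<Rightarrow> quot \<Rightarrow> quot \<Rightarrow> bool" where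
  "SPIN1 N u v w \<longleftrightarrow> u \<in> R \<and> v \<in> R \<and> w \<in> R \<and> A (K N1) u = \<Q> 1 *\<^sub>R u \<and> A (K N1) v = v \<and> A (K N1) w = \<Q> (- 1) *\<^sub>R w \<and>
     A (K N2) (A (K N2) u) = \<Q> (N - 1) *\<^sub>R u \<and> A (K N2) (A (K N2) v) = \<Q> N *\<^sub>R v \<and>
     A (K N2) (A (K N2) w) = \<Q> (N + 1) *\<^sub>R w \<and>
     A (E N1) u = rt *\<^sub>R v \<and> A (E N1) v = rt *\<^sub>R w \<and> A (E N1) w = 0 \<and>
     A (F N1) u = 0 \<and> A (F N1) v = rt *\<^sub>R u \<and> A (F N1) w = rt *\<^sub>R v"

lemma LBD:
  assumes "LB N X"
  shows "X \<in> R" "A (K N1) X = X" "A (Kinv N1) X = X" "A (K N2) (A (K N2) X) = \<Q> N *\<^sub>R X" "A (E N1) X = 0" "A (F N1) X = 0"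
  using assms Kinv_eigen[of X N1 0] by (simp_all add: LB_def Q_simps)

lemma HALFD:
  assumes "HALF N v w"
  shows "v \<in> R" "w \<in> R" "A (K N1) v = \<Q> (1/2) *\<^sub>R v" "A (K N1) w = \<Q> (- 1/2) *\<^sub>R w"
    "A (Kinv N1) v = \<Q> (- 1/2) *\<^sub>R v" "A (Kinv N1) w = \<Q> (1/2) *\<^sub>R w"
    "A (K N2) (A (K N2) v) = \<Q> (N - 1/2) *\<^sub>R v" "A (K N2) (A (K N2) w) = \<Q> (N + 1/2) *\<^sub>R w"
    "A (E N1) v = w" "A (E N1) w = 0" "A (F N1) v = 0" "A (F N1) w = v"
  using assms Kinv_eigen[of v N1 "1/2"] Kinv_eigen[of w N1 "- 1/2"] by (simp_all add: HALF_def)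

lemma SPIN1D:
  assumes "SPIN1 N u v w"
  shows "u \<in> R" "v \<in> R" "w \<in> R" "A (K N1) u = \<Q> 1 *\<^sub>R u" "A (K N1) v = v" "A (K N1) w = \<Q> (- 1) *\<^sub>R w"
    "A (Kinv N1) u = \<Q> (- 1) *\<^sub>R u" "A (Kinv N1) v = v" "A (Kinv N1) w = \<Q> 1 *\<^sub>R w"
    "A (K N2) (A (K N2) u) = \<Q> (N - 1) *\<^sub>R u" "A (K N2) (A (K N2) v) = \<Q> N *\<^sub>R v"
    "A (K N2) (A (K N2) w) = \<Q> (N + 1) *\<^sub>R w"
    "A (E N1) u = rt *\<^sub>R v" "A (E N1) v = rt *\<^sub>R w" "A (E N1) w = 0"
    "A (F N1) u = 0" "A (F N1) v = rt *\<^sub>R u" "A (F N1) w = rt *\<^sub>R v"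
  using assms Kinv_eigen[of u N1 1] Kinv_eigen[of v N1 0] Kinv_eigen[of w N1 "- 1"]
  by (simp_all add: SPIN1_def Q_simps)

lemma LB_mult: "LB N X \<Longrightarrow> LB M Y \<Longrightarrow> LB (N + M) (X * Y)"
  using LBD[of N X] LBD[of M Y] unfolding LB_def[of "N + M"] by (simp add: A_mult Q_simps add_ac)

lemma LB_add: "LB N X \<Longrightarrow> LB N Y \<Longrightarrow> LB N (X + Y)"
  using LBD[of N X] LBD[of N Y] unfolding LB_def[of N "X + Y"] by (simp add: A_add scaleR_right_distrib)

lemma LB_0: "LB N 0"
  by (simp add: LB_def)

lemma LB_sum: "(\<And>i. i \<in> I \<Longrightarrow> LB N (f i)) \<Longrightarrow> LB N (sum f I)"
  by (induction I rule: infinite_finite_induct) (simp_all add: LB_0 LB_add)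

lemma LB_scaleR: "LB N X \<Longrightarrow> LB N (r *\<^sub>R X)"
  using LBD[of N X] unfolding LB_def[of N "r *\<^sub>R X"] by (simp add: A_scaleR)

lemma HALF_mult: "LB M X \<Longrightarrow> HALF N v w \<Longrightarrow> HALF (M + N) (X * v) (X * w)"
  using LBD[of M X] HALFD[of N v w] unfolding HALF_def[of "M + N"]
  by (simp add: A_mult Q_simps add_ac add_diff_eq)

lemma HALF_add: "HALF N v w \<Longrightarrow> HALF N v' w' \<Longrightarrow> HALF N (v + v') (w + w')"
  using HALFD[of N v w] HALFD[of N v' w'] unfolding HALF_def[of N "v + v'"] by (simp add: A_add scaleR_right_distrib)

lemma HALF_0: "HALF N 0 0"
  by (simp add: HALF_def)

lemma HALF_sum: "(\<And>i. i \<in> I \<Longrightarrow> HALF N (f i) (g i)) \<Longrightarrow> HALF N (sum f I) (sum g I)"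
  by (induction I rule: infinite_finite_induct) (simp_all add: HALF_0 HALF_add)

lemma HALF_Cc: "HALF N v w \<Longrightarrow> HALF N (Cc c * v) (Cc c * w)"
  using HALFD[of N v w] unfolding HALF_def[of N "Cc c * v"] by (simp add: A_Cc)

lemma SPIN1_mult: "LB M X \<Longrightarrow> SPIN1 N u v w \<Longrightarrow> SPIN1 (M + N) (X * u) (X * v) (X * w)"
  and SPIN1_mult': "SPIN1 N u v w \<Longrightarrow> LB M X \<Longrightarrow> SPIN1 (N + M) (u * X) (v * X) (w * X)"
  using LBD[of M X] SPIN1D[of N u v w] unfolding SPIN1_def[of "M + N"] SPIN1_def[of "N + M"]
  by (simp_all add: A_mult Q_simps add_ac add_diff_eq)

lemma SPIN1_add: "SPIN1 N u v w \<Longrightarrow> SPIN1 N u' v' w' \<Longrightarrow> SPIN1 N (u + u') (v + v') (w + w')"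
  using SPIN1D[of N u v w] SPIN1D[of N u' v' w'] unfolding SPIN1_def[of N "u + u'"] by (simp add: A_add scaleR_right_distrib)

lemma SPIN1_0: "SPIN1 N 0 0 0"
  by (simp add: SPIN1_def)

lemma SPIN1_sum: "(\<And>i. i \<in> I \<Longrightarrow> SPIN1 N (f i) (g i) (h i)) \<Longrightarrow> SPIN1 N (sum f I) (sum g I) (sum h I)"
  by (induction I rule: infinite_finite_induct) (simp_all add: SPIN1_0 SPIN1_add)

lemma SPIN1_scaleR: "SPIN1 N u v w \<Longrightarrow> SPIN1 N (r *\<^sub>R u) (r *\<^sub>R v) (r *\<^sub>R w)"
  using SPIN1D[of N u v w] unfolding SPIN1_def[of N "r *\<^sub>R u"] by (simp add: A_scaleR mult.commute)

lemma LB_mu0: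
  assumes "HALF N v w" "HALF M v' w'"
  shows "LB (N + M) (\<Q> (1/2) *\<^sub>R (v * w') - \<Q> (- 1/2) *\<^sub>R (w * v'))"
  using HALFD[OF assms(1)] HALFD[OF assms(2)]
  by (simp add: LB_def A_diff A_scaleR A_mult Q_simps scaleR_right_diff_distrib add_ac add_diff_eq)

text \<open>The triplet in the product of two doublets. By \<open>(q + q^{-1}) / rt = rt\<close>,
  the operators \<open>E_1\<close> and \<open>F_1\<close> carry the middle component to
  \<open>rt\<close> times the outer ones.\<close>

lemma SPIN1_mu1:
  assumes "HALF N v w" "HALF M v' w'"
  shows "SPIN1 (N + M) (v * v') ((1 / rt) *\<^sub>R (\<Q> (- 1/2) *\<^sub>R (v * w') + \<Q> (1/2) *\<^sub>R (w * v'))) (w * w')"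
proof -
  have r: "rt \<noteq> 0" using rt_pos by simp
  have E: "(\<Q> 1 / rt) *\<^sub>R X + (\<Q> (- 1) / rt) *\<^sub>R X = rt *\<^sub>R X" for X :: quot
    using r rt_sq by (simp add: field_simps flip: scaleR_left_distrib)
  show ?thesis
    using HALFD[OF assms(1)] HALFD[OF assms(2)] r
    by (simp add: SPIN1_def A_add A_scaleR A_mult Q_simps scaleR_right_distrib E
        add_ac add_diff_eq)
qed

text \<open>The pair is a doublet: \<open>F_1\<close> kills the first entry because it commutes with
  \<open>E_2\<close>, the commutator \<open>[E_1, F_1]\<close> is the identity on weight 1/2, and
  the Serre relation makes a further \<open>E_1\<close> vanish.\<close>

lemma LB_HALF_E:
  assumes "LB 0 X"
  shows "HALF (- 3/2) (A (E N2) X) (A (E N1) (A (E N2) X))"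
proof -
  note X = LBD[OF assms]
  let ?Y = "A (E N2) X"
  have K: "A (K N1) ?Y = \<Q> (1/2) *\<^sub>R ?Y" using X by (simp add: A_K_E kw_def)
  have F: "A (F N1) ?Y = 0" using X by (simp add: A_E_F_comm)
  have "(\<Q> 1 - \<Q> (- 1)) *\<^sub>R A (F N1) (A (E N1) ?Y) = (\<Q> 1 - \<Q> (- 1)) *\<^sub>R ?Y"
    using A_EF[of ?Y N1] X K F Kinv_eigen[OF _ K] by (simp add: A_scaleR Q_simps scaleR_left_diff_distrib)
  then have FE: "A (F N1) (A (E N1) ?Y) = ?Y" using Q_diff by simp
  have EE: "A (E N1) (A (E N1) ?Y) = 0" using A_serre_E[of X] X by simp
  show ?thesis
    using X K F FE EE by (simp add: HALF_def A_K_E A_scaleR kw_def Q_simps)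
qed

lemma LB_HALF_F:
  assumes "LB 0 X"
  shows "HALF (3/2) (A (F N1) (A (F N2) X)) (A (F N2) X)"
proof -
  note X = LBD[OF assms]
  let ?Y = "A (F N2) X"
  have K: "A (K N1) ?Y = \<Q> (- 1/2) *\<^sub>R ?Y" using X by (simp add: A_K_F kw_def)
  have E: "A (E N1) ?Y = 0" using X A_E_F_comm[of N1 N2 X] by simp
  have "(\<Q> 1 - \<Q> (- 1)) *\<^sub>R A (E N1) (A (F N1) ?Y) = (\<Q> 1 - \<Q> (- 1)) *\<^sub>R ?Y"
    using A_EF[of ?Y N1] X K E Kinv_eigen[OF _ K] by (simp add: A_scaleR Q_simps scaleR_left_diff_distrib algebra_simps)
  then have EF: "A (E N1) (A (F N1) ?Y) = ?Y" using Q_diff by simp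
  have FF: "A (F N1) (A (F N1) ?Y) = 0" using A_serre_F[of X] X by simp
  show ?thesis
    using X K E EF FF by (simp add: HALF_def A_K_F A_scaleR kw_def Q_simps)
qed

text \<open>The components of \<open>\<partial>\<close> (\<open>Inl\<close>) and of the conjugate
  operator (\<open>Inr\<close>) without their scalar prefactors, which reappear as
  \<open>dc\<close>.\<close>

definition D :: "2 + 2 \<Rightarrow> quot \<Rightarrow> quot" where
  "D a X = (case a of Inl i \<Rightarrow> if i = 1 then A (E N2) X else A (E N1) (A (E N2) X)
     | Inr i \<Rightarrow> if i = 1 then A (F N1) (A (F N2) X) else A (F N2) X)"

text \<open>Sections of charge \<open>a\<close> of a line bundle, with the square root of \<open>K\<^sub>1 K\<^sub>2\<^sup>2\<close> fixed.\<close>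

definition charged :: "real \<Rightarrow> quot \<Rightarrow> bool" where
  "charged a X \<longleftrightarrow> X \<in> R \<and> A (K N1) X = X \<and> A (K N2) X = \<Q> a *\<^sub>R X \<and> A (E N1) X = 0 \<and> A (F N1) X = 0"

lemma chargedD:
  assumes "charged a X"
  shows "X \<in> R" "A (K N1) X = X" "A (Kinv N1) X = X" "A (K N2) X = \<Q> a *\<^sub>R X" "A (Kinv N2) X = \<Q> (- a) *\<^sub>R X"
    "A (E N1) X = 0" "A (F N1) X = 0"
  using assms Kinv_eigen[of X N1 0] Kinv_eigen[of X N2 a] by (simp_all add: charged_def Q_simps)

lemma charged_LB: "charged a X \<Longrightarrow> LB (2 * a) X"
  using chargedD[of a X] by (simp add: LB_def A_scaleR Q_simps)

lemma charged_mult: "charged a X \<Longrightarrow> charged b Y \<Longrightarrow> charged (a + b) (X * Y)"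
  using chargedD[of a X] chargedD[of b Y] unfolding charged_def[of "a + b"] by (simp add: A_mult Q_simps add_ac)

lemma charged_scaleR: "charged a X \<Longrightarrow> charged a (r *\<^sub>R X)"
  using chargedD[of a X] unfolding charged_def[of a "r *\<^sub>R X"] by (simp add: A_scaleR)

lemma charged_add: "charged a X \<Longrightarrow> charged a Y \<Longrightarrow> charged a (X + Y)"
  using chargedD[of a X] chargedD[of a Y] unfolding charged_def[of a "X + Y"] by (simp add: A_add scaleR_right_distrib)

lemma charged_0: "charged a 0"
  by (simp add: charged_def)

lemma charged_sum: "(\<And>i. i \<in> I \<Longrightarrow> charged a (f i)) \<Longrightarrow> charged a (sum f I)"
  by (induction I rule: infinite_finite_induct) (simp_all add: charged_0 charged_add)

lemma R_D [simp, intro]: "X \<in> R \<Longrightarrow> D a X \<in> R"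
  by (auto simp: D_def split: sum.split)

lemma D_add: "X \<in> R \<Longrightarrow> Y \<in> R \<Longrightarrow> D a (X + Y) = D a X + D a Y"
  and D_0 [simp]: "D a 0 = 0"
  and D_scaleR: "X \<in> R \<Longrightarrow> D a (r *\<^sub>R X) = r *\<^sub>R D a X"
  by (auto simp: D_def A_add A_scaleR split: sum.split)

lemma D_uminus: "X \<in> R \<Longrightarrow> D a (- X) = - D a X"
  using D_scaleR[of X a "- 1"] by simp

lemma charged_uminus: "charged a X \<Longrightarrow> charged a (- X)"
  using charged_scaleR[of a X "- 1"] by simp

lemma D_sum: "(\<And>i. i \<in> I \<Longrightarrow> f i \<in> R) \<Longrightarrow> D a (sum f I) = (\<Sum>i\<in>I. D a (f i))"
  by (induction I rule: infinite_finite_induct) (simp_all add: D_add)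

text \<open>Because \<open>E_1\<close> and \<open>F_1\<close> kill both factors, the components of
  second order in the generators obey the same twisted Leibniz rule as \<open>E_2\<close> and
  \<open>F_2\<close>. The powers of \<open>q\<close> come from \<open>K_2\<close> on the right and
  its inverse on the left factor.\<close>

lemma D_mult:
  assumes "charged a X" "charged b Y"
  shows "D c (X * Y) = \<Q> b *\<^sub>R (D c X * Y) + \<Q> (- a) *\<^sub>R (X * D c Y)"
  using chargedD[OF assms(1)] chargedD[OF assms(2)]
  by (auto simp: D_def A_mult A_add A_scaleR split: sum.split)

lemma D_invariant:
  assumes "charged 0 X" "charged 0 Y"
  shows "D c (X * Y) = D c X * Y + X * D c Y"
  using D_mult[OF assms] by (simp add: Q_simps)

end

section \<open>The projection\<close>

lemma exhaust_6: "(k::6) = 1 \<or> k = 2 \<or> k = 3 \<or> k = 4 \<or> k = 5 \<or> k = 6"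
proof (induct k)
  case (of_int z)
  then have "z = 0 \<or> z = 1 \<or> z = 2 \<or> z = 3 \<or> z = 4 \<or> z = 5" by fastforce
  then show ?case by auto
qed

lemma forall_6: "(\<forall>k::6. R k) \<longleftrightarrow> R 1 \<and> R 2 \<and> R 3 \<and> R 4 \<and> R 5 \<and> R 6"
  by (metis exhaust_6)

lemma sum_6: "sum f (UNIV :: 6 set) = f 1 + f 2 + f 3 + f 4 + f 5 + f 6"
proof -
  have U: "(UNIV :: 6 set) = {1, 2, 3, 4, 5, 6}" using exhaust_6 by auto
  show ?thesis unfolding U by (simp add: ac_simps)
qed

lemma vector_6 [simp]:
  "(vector [a, b, c, d, e, f] :: 'a::zero ^ 6) $ 1 = a"
  "(vector [a, b, c, d, e, f] :: 'a ^ 6) $ 2 = b"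
  "(vector [a, b, c, d, e, f] :: 'a ^ 6) $ 3 = c"
  "(vector [a, b, c, d, e, f] :: 'a ^ 6) $ 4 = d"
  "(vector [a, b, c, d, e, f] :: 'a ^ 6) $ 5 = e"
  "(vector [a, b, c, d, e, f] :: 'a ^ 6) $ 6 = f"
  unfolding vector_def by simp_all

text \<open>The linear dependence of \<open>\<psi>\<close> and \<open>\<phi>\<close> on the entries of the third row or of its adjoint.\<close>

definition psiv :: "real \<Rightarrow> (index \<Rightarrow> quot) \<Rightarrow> 6 \<Rightarrow> quot" where
  "psiv \<theta> f k = (vector [cos (2 * \<theta>) *\<^sub>R f I1, cos \<theta> *\<^sub>R f I2, cos \<theta> *\<^sub>R f I3, 0,
     sin \<theta> *\<^sub>R f I3, sin \<theta> *\<^sub>R f I2] :: quot ^ 6) $ k"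

definition phiv :: "real \<Rightarrow> real \<Rightarrow> (index \<Rightarrow> quot) \<Rightarrow> 6 \<Rightarrow> quot" where
  "phiv q \<theta> f k = (vector [0, (- sin \<theta>) *\<^sub>R f I3, (q * sin \<theta>) *\<^sub>R f I2,
     (q\<^sup>2 * cos (2 * \<theta>)) *\<^sub>R f I1, (q * cos \<theta>) *\<^sub>R f I2, (- cos \<theta>) *\<^sub>R f I3] :: quot ^ 6) $ k"

text \<open>Entries 2, 6 and entries 3, 5 each combine to \<open>cos^2 + sin^2 = 1\<close>, so only
  the first coefficient, the square of \<open>cos (2 * \<theta>)\<close>, leaves a
  correction.\<close>

lemma psiv_psiv:
  "(\<Sum>k\<in>UNIV. psiv \<theta> f k * psiv \<theta> g k) = f I1 * g I1 + f I2 * g I2 + f I3 * g I3 - (sin (2 * \<theta>))\<^sup>2 *\<^sub>R (f I1 * g I1)"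
proof -
  have "cos (2 * \<theta>) * cos (2 * \<theta>) = 1 - (sin (2 * \<theta>))\<^sup>2" "sin \<theta> * sin \<theta> = 1 - cos \<theta> * cos \<theta>"
    using sin_cos_squared_add[of "2 * \<theta>"] sin_cos_squared_add[of \<theta>] by algebra+
  then show ?thesis
    by (simp add: sum_6 psiv_def scaleR_left_diff_distrib)
qed

lemma phiv_phiv:
  "(\<Sum>k\<in>UNIV. phiv q \<theta> f k * phiv q \<theta> g k)
    = q ^ 4 *\<^sub>R (f I1 * g I1) + q\<^sup>2 *\<^sub>R (f I2 * g I2) + f I3 * g I3 - ((sin (2 * \<theta>))\<^sup>2 * q ^ 4) *\<^sub>R (f I1 * g I1)"
proof -
  have *: "q\<^sup>2 * cos (2 * \<theta>) * (q\<^sup>2 * cos (2 * \<theta>)) = q ^ 4 - (sin (2 * \<theta>))\<^sup>2 * q ^ 4"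
    "q * sin \<theta> * (q * sin \<theta>) = q\<^sup>2 - q * cos \<theta> * (q * cos \<theta>)" "sin \<theta> * sin \<theta> = 1 - cos \<theta> * cos \<theta>"
    using sin_cos_squared_add[of "2 * \<theta>"] sin_cos_squared_add[of \<theta>] by algebra+
  show ?thesis
    unfolding sum_6 phiv_def vector_6 mult_scaleR_left mult_scaleR_right scaleR_scaleR *
    by (simp add: * scaleR_left_diff_distrib)
qed

text \<open>Each of the two products occurs twice with the factor
  \<open>cos \<theta> * sin \<theta>\<close>; this is where the double angle, and hence
  \<open>t\<close>, enters the mixed terms.\<close>

lemma psiv_phiv:
  "(\<Sum>k\<in>UNIV. psiv \<theta> f k * phiv q \<theta> g k) = sin (2 * \<theta>) *\<^sub>R (q *\<^sub>R (f I3 * g I2) - f I2 * g I3)"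
  and phiv_psiv:
  "(\<Sum>k\<in>UNIV. phiv q \<theta> f k * psiv \<theta> g k) = sin (2 * \<theta>) *\<^sub>R (q *\<^sub>R (f I2 * g I3) - f I3 * g I2)"
proof -
  have "sin (2 * \<theta>) = cos \<theta> * sin \<theta> + cos \<theta> * sin \<theta>"
    by (simp add: sin_double)
  note s = this
  show "(\<Sum>k\<in>UNIV. psiv \<theta> f k * phiv q \<theta> g k) = sin (2 * \<theta>) *\<^sub>R (q *\<^sub>R (f I3 * g I2) - f I2 * g I3)"
    "(\<Sum>k\<in>UNIV. phiv q \<theta> f k * psiv \<theta> g k) = sin (2 * \<theta>) *\<^sub>R (q *\<^sub>R (f I2 * g I3) - f I3 * g I2)"
    unfolding s scaleR_left_distrib by (simp_all add: sum_6 psiv_def phiv_def scaleR_right_diff_distrib mult_ac)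
qed

text \<open>Since \<open>1 - P\<close> is idempotent,
  \<open>X (1 - P) (1 - P) Y = X (1 - P) Y\<close>.\<close>

lemma compress_product:
  fixes X Y :: "'n::finite \<Rightarrow> 'b::ring" and P :: "'n \<Rightarrow> 'n \<Rightarrow> 'b"
  assumes "\<And>k l. (\<Sum>m\<in>UNIV. P k m * P m l) = P k l"
  shows "(\<Sum>m\<in>UNIV. (X m - (\<Sum>k\<in>UNIV. X k * P k m)) * (Y m - (\<Sum>l\<in>UNIV. P m l * Y l)))
    = (\<Sum>m\<in>UNIV. X m * Y m) - (\<Sum>k\<in>UNIV. \<Sum>l\<in>UNIV. X k * P k l * Y l)"
proof -
  have 1: "(\<Sum>m\<in>UNIV. X m * (\<Sum>l\<in>UNIV. P m l * Y l)) = (\<Sum>k\<in>UNIV. \<Sum>l\<in>UNIV. X k * P k l * Y l)"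
    by (simp add: sum_distrib_left mult.assoc)
  have 2: "(\<Sum>m\<in>UNIV. (\<Sum>k\<in>UNIV. X k * P k m) * Y m) = (\<Sum>k\<in>UNIV. \<Sum>l\<in>UNIV. X k * P k l * Y l)"
    by (simp add: sum_distrib_right) (rule sum.swap)
  have "(\<Sum>m\<in>UNIV. (\<Sum>k\<in>UNIV. X k * P k m) * (\<Sum>l\<in>UNIV. P m l * Y l))
    = (\<Sum>m\<in>UNIV. \<Sum>k\<in>UNIV. \<Sum>l\<in>UNIV. X k * (P k m * P m l) * Y l)"
    by (simp add: sum_product mult.assoc)
  also have "\<dots> = (\<Sum>k\<in>UNIV. \<Sum>m\<in>UNIV. \<Sum>l\<in>UNIV. X k * (P k m * P m l) * Y l)"
    by (rule sum.swap)
  also have "\<dots> = (\<Sum>k\<in>UNIV. \<Sum>l\<in>UNIV. \<Sum>m\<in>UNIV. X k * (P k m * P m l) * Y l)"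
    by (intro sum.cong[OF refl] sum.swap)
  also have "\<dots> = (\<Sum>k\<in>UNIV. \<Sum>l\<in>UNIV. X k * (\<Sum>m\<in>UNIV. P k m * P m l) * Y l)"
    by (simp add: sum_distrib_left sum_distrib_right)
  finally have 3: "(\<Sum>m\<in>UNIV. (\<Sum>k\<in>UNIV. X k * P k m) * (\<Sum>l\<in>UNIV. P m l * Y l)) = (\<Sum>k\<in>UNIV. \<Sum>l\<in>UNIV. X k * P k l * Y l)"
    by (simp add: assms)
  show ?thesis
    by (simp add: left_diff_distrib right_diff_distrib sum_subtractf 1 2 3)
qed

context suq_lt
begin

section \<open>Relations between matrix entries modulo null sequences\<close>

abbreviation "e \<equiv> cls 1"

definition u :: "index \<Rightarrow> index \<Rightarrow> quot" where "u i j = quo.P (gen (U i j))"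

definition us :: "index \<Rightarrow> index \<Rightarrow> quot" where "us i j = quo.P (gen (Us i j))"

lemma P_1: "quo.P 1 = e"
  by (simp add: cls_emb[symmetric] emb_hom)

text \<open>The numbering is used through \<open>rel\<close>: 1 to 3 orthogonality, 4 to 9
  commutation in the first column, 10 the balance, 11 and 12 minors, 13 to 15 swaps within a
  row.\<close>

lemmas u_facts = quo.sum_u_us quo.sum_us_u quo.weighted_sum_us_u quo.column_comm quo.column_balance quo.minors
  quo.swap(2)[of I1 I2] quo.swap(2)[of I2 I3] quo.swap(2)[of I1 I3] 

lemmas rel = u_facts[folded u_def us_def, unfolded P_1]

lemma R_P [simp]: "quo.P a \<in> R"
  by (simp flip: cls_emb)

lemma R_u [simp]: "u i j \<in> R" "us i j \<in> R"
  by (simp_all add: u_def us_def)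

lemma A_P: "A h (quo.P a) = quo.P (act q h a)"
proof -
  have "cact q h (emb a) = emb (act q h a)" by (simp add: cact_def emb_def)
  then show ?thesis by (simp add: A_cls flip: cls_emb)
qed

lemma P_qs_mult: "quo.P (qs q a * x) = \<Q> a *\<^sub>R quo.P x"
  by (simp add: quo.P_hom quo.P_qs quo.P_one)

lemma A_u: "A (K n) (u i j) = \<Q> (kexp n i) *\<^sub>R u i j" "A (E n) (u i j) = (if i = hi n then u (lo n) j else 0)"
    "A (F n) (u i j) = (if i = lo n then u (hi n) j else 0)"
  and A_us: "A (K n) (us i j) = \<Q> (- kexp n i) *\<^sub>R us i j"
    "A (E n) (us i j) = (if i = lo n then - (\<Q> 1 *\<^sub>R us (hi n) j) else 0)"
    "A (F n) (us i j) = (if i = hi n then - (\<Q> (- 1) *\<^sub>R us (lo n) j) else 0)"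
  by (simp_all add: u_def us_def A_P act_gen lact_qs[OF q_pos] P_qs_mult quo.P_hom(3,5))

lemma charged_u: "charged (1/2) (u I3 j)" "charged (- 1/2) (us I3 j)"
  by (simp_all add: charged_def A_u A_us kexp_def Q_simps)

lemma D_u: "D (Inl 1) (u I3 j) = u I2 j" "D (Inl 2) (u I3 j) = u I1 j" "D (Inr i) (u I3 j) = 0"
  and D_us: "D (Inr 1) (us I3 j) = \<Q> (- 2) *\<^sub>R us I1 j" "D (Inr 2) (us I3 j) = (- \<Q> (- 1)) *\<^sub>R us I2 j" "D (Inl i) (us I3 j) = 0"
  by (simp_all add: D_def A_u A_us A_uminus A_scaleR Q_simps)

text \<open>The ideal is closed under \<open>fstar\<close>, so the adjoints of the cofactor and row
  relations hold too. They express entries of \<open>u\<close> as minors of adjoint entries without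
  expanding the latter as cofactors.\<close>

lemma star_minors:
  "us I3 I3 * us I2 I2 - \<Q> 1 *\<^sub>R (us I3 I2 * us I2 I3) = u I1 I1"
  "us I3 I3 * us I1 I2 - \<Q> 1 *\<^sub>R (us I3 I2 * us I1 I3) = - (\<Q> 1 *\<^sub>R u I2 I1)"
  "us I3 I3 * us I3 I2 = \<Q> 1 *\<^sub>R (us I3 I2 * us I3 I3)"
proof -
  have S: "quo.P r = 0 \<Longrightarrow> r \<in> suq_relators q \<Longrightarrow> quo.P (fstar r) = 0" for r
    by (intro quo.P_eq_0 suq_ideal.star suq_ideal.base)
  have q1: "\<Q> 1 = q" and qm: "\<Q> (- 1) = 1 / q" using q_pos by (simp_all add: quo.Q_def powr_minus_divide)
  note s = fstar_diff fstar_mult quo.P_hom quo.P_rscal_only quo.P_one P_1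
  have 1: "quo.P (fstar (gen (Us I1 I1) - rscal ((- q) powi (int (ix I1) - int (ix I1)))
       * (gen (U I2 I2) * gen (U I3 I3) - rscal q * gen (U I2 I3) * gen (U I3 I2)))) = 0"
    by (intro quo.P_eq_0 suq_ideal.star suq_ideal.base suq_relators.intros(6)) (auto simp: UNIV_index)
  have 2: "quo.P (fstar (gen (Us I2 I1) - rscal ((- q) powi (int (ix I1) - int (ix I2)))
       * (gen (U I1 I2) * gen (U I3 I3) - rscal q * gen (U I1 I3) * gen (U I3 I2)))) = 0"
    by (intro quo.P_eq_0 suq_ideal.star suq_ideal.base suq_relators.intros(6)) (auto simp: UNIV_index)
  have 3: "quo.P (fstar (gen (U I3 I2) * gen (U I3 I3) - rscal q * gen (U I3 I3) * gen (U I3 I2))) = 0"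
    by (intro quo.P_eq_0 suq_ideal.star suq_ideal.base suq_relators.intros(2)) simp
  have unit: "u i j * e = u i j" "us i j * e = us i j" "X * (us i j * e) = X * us i j" for i j X by simp_all
  show "us I3 I3 * us I2 I2 - \<Q> 1 *\<^sub>R (us I3 I2 * us I2 I3) = u I1 I1"
    using 1 by (simp add: s q1 flip: u_def us_def)
  have "u I2 I1 = ((- q) powi (- 1)) *\<^sub>R (us I3 I3 * us I1 I2 - q *\<^sub>R (us I3 I2 * us I1 I3))"
    using 2 by (simp add: s q1 mult.assoc scaleR_right_diff_distrib left_diff_distrib flip: u_def us_def)
  also have "(- q) powi (- 1) = - (1 / q)"
    by (simp add: power_int_minus divide_inverse)
  finally have "(- q) *\<^sub>R u I2 I1 = us I3 I3 * us I1 I2 - q *\<^sub>R (us I3 I2 * us I1 I3)"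
    using q_pos by simp
  then show "us I3 I3 * us I1 I2 - \<Q> 1 *\<^sub>R (us I3 I2 * us I1 I3) = - (\<Q> 1 *\<^sub>R u I2 I1)"
    by (simp add: q1)
  show "us I3 I3 * us I3 I2 = \<Q> 1 *\<^sub>R (us I3 I2 * us I3 I3)"
    using 3 by (simp add: s q1 mult.assoc flip: u_def us_def)
qed

lemma minors':
  "\<Q> 1 *\<^sub>R (u I3 I3 * u I2 I2) - u I3 I2 * u I2 I3 = \<Q> 1 *\<^sub>R us I1 I1"
  "\<Q> 1 *\<^sub>R (u I3 I3 * u I1 I2) - u I3 I2 * u I1 I3 = - (\<Q> 2 *\<^sub>R us I2 I1)"
  by (simp_all add: u_def us_def quo.normalise)

text \<open>\<open>quot\<close> carries no adjoint. The identities \<open>minors'\<close> are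
  therefore first read as membership in the algebraic ideal, where \<open>fstar\<close> can be
  applied.\<close>

lemma star_minors':
  "\<Q> 1 *\<^sub>R (us I2 I2 * us I3 I3) - us I2 I3 * us I3 I2 = \<Q> 1 *\<^sub>R u I1 I1"
  "\<Q> 1 *\<^sub>R (us I1 I2 * us I3 I3) - us I1 I3 * us I3 I2 = - (\<Q> 2 *\<^sub>R u I2 I1)"
proof -
  interpret I: suq_quotient q "ideal_pair q" by (rule suq_quotient_ideal[OF q_pos])
  have "rscal q * (gen (U I3 I3) * gen (U I2 I2)) - gen (U I3 I2) * gen (U I2 I3) - rscal q * gen (Us I1 I1) \<in> suq_ideal q"
    "rscal q * (gen (U I3 I3) * gen (U I1 I2)) - gen (U I3 I2) * gen (U I1 I3) + rscal (q * q) * gen (Us I2 I1) \<in> suq_ideal q"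
    by (simp_all add: ideal_iff_P[OF q_pos] I.P_hom I.P_rscal_only I.P_one I.scaleR_q(1,3) I.normalise
        del: scaleR_scaleR)
  then have "quo.P (fstar (rscal q * (gen (U I3 I3) * gen (U I2 I2)) - gen (U I3 I2) * gen (U I2 I3) - rscal q * gen (Us I1 I1))) = 0"
    "quo.P (fstar (rscal q * (gen (U I3 I3) * gen (U I1 I2)) - gen (U I3 I2) * gen (U I1 I3) + rscal (q * q) * gen (Us I2 I1))) = 0"
    by (intro quo.P_eq_0 suq_ideal.star; simp)+
  moreover have "\<Q> 1 = q" "\<Q> 2 = q * q" using q_pos by (simp_all add: quo.Q_def power2_eq_square)
  ultimately show "\<Q> 1 *\<^sub>R (us I2 I2 * us I3 I3) - us I2 I3 * us I3 I2 = \<Q> 1 *\<^sub>R u I1 I1"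
    "\<Q> 1 *\<^sub>R (us I1 I2 * us I3 I3) - us I1 I3 * us I3 I2 = - (\<Q> 2 *\<^sub>R u I2 I1)"
    by (simp_all add: fstar_diff fstar_add fstar_mult rscal_comm[symmetric] quo.P_hom quo.P_rscal_only quo.P_one
        P_1 eq_neg_iff_add_eq_0 flip: u_def us_def)
qed


subsection \<open>The columns of \<open>\<Psi>\<close> and anti-selfduality\<close>

definition p :: quot where "p = us I3 I1 * u I3 I1"

lemma p_comm:
  "us I3 I1 * u I3 I1 = p" "u I3 I1 * us I3 I1 = p"
  "p * u I3 I1 = u I3 I1 * p" "p * us I3 I1 = us I3 I1 * p"
  "u I1 I1 * p = \<Q> 2 *\<^sub>R (p * u I1 I1)" "u I2 I1 * p = \<Q> 2 *\<^sub>R (p * u I2 I1)"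
  "us I1 I1 * p = \<Q> (- 2) *\<^sub>R (p * us I1 I1)" "us I2 I1 * p = \<Q> (- 2) *\<^sub>R (p * us I2 I1)"
proof -
  have sw: "u I1 I1 * us I3 I1 = \<Q> 1 *\<^sub>R (us I3 I1 * u I1 I1)" "u I2 I1 * us I3 I1 = \<Q> 1 *\<^sub>R (us I3 I1 * u I2 I1)"
    "u I1 I1 * u I3 I1 = \<Q> 1 *\<^sub>R (u I3 I1 * u I1 I1)" "u I2 I1 * u I3 I1 = \<Q> 1 *\<^sub>R (u I3 I1 * u I2 I1)"
    "us I1 I1 * u I3 I1 = \<Q> (- 1) *\<^sub>R (u I3 I1 * us I1 I1)" "us I2 I1 * u I3 I1 = \<Q> (- 1) *\<^sub>R (u I3 I1 * us I2 I1)"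
    "us I1 I1 * us I3 I1 = \<Q> (- 1) *\<^sub>R (us I3 I1 * us I1 I1)" "us I2 I1 * us I3 I1 = \<Q> (- 1) *\<^sub>R (us I3 I1 * us I2 I1)"
    by (simp_all add: u_def us_def quo.normalise)
  have sw': "u I1 I1 * (us I3 I1 * X) = \<Q> 1 *\<^sub>R (us I3 I1 * (u I1 I1 * X))" "u I2 I1 * (us I3 I1 * X) = \<Q> 1 *\<^sub>R (us I3 I1 * (u I2 I1 * X))"
    "us I1 I1 * (us I3 I1 * X) = \<Q> (- 1) *\<^sub>R (us I3 I1 * (us I1 I1 * X))" "us I2 I1 * (us I3 I1 * X) = \<Q> (- 1) *\<^sub>R (us I3 I1 * (us I2 I1 * X))" for X
    by (simp_all add: sw flip: mult.assoc)
  show n: "us I3 I1 * u I3 I1 = p" "u I3 I1 * us I3 I1 = p"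
    using rel(4) by (simp_all add: p_def)
  show "p * u I3 I1 = u I3 I1 * p" "p * us I3 I1 = us I3 I1 * p"
    by (metis n mult.assoc)+
  show "u I1 I1 * p = \<Q> 2 *\<^sub>R (p * u I1 I1)" "u I2 I1 * p = \<Q> 2 *\<^sub>R (p * u I2 I1)"
    "us I1 I1 * p = \<Q> (- 2) *\<^sub>R (p * us I1 I1)" "us I2 I1 * p = \<Q> (- 2) *\<^sub>R (p * us I2 I1)"
    by (simp_all add: p_def mult.assoc sw sw' Q_simps)
qed

text \<open>From \<open>X (1 - c p) = (1 - c' p) X\<close>, multiplied by the inverses on either
  side.\<close>

lemma inverse_comm:
  assumes M: "(e - c *\<^sub>R p) * M = e" and G: "G * (e - c' *\<^sub>R p) = e" and X: "c *\<^sub>R (X * p) = c' *\<^sub>R (p * X)"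
    and R: "X \<in> R" "G \<in> R" "M \<in> R" "p \<in> R"
  shows "X * M = G * X"
proof -
  have "G * X = G * X * ((e - c *\<^sub>R p) * M)" using R by (simp add: M)
  also have "\<dots> = G * (X - c *\<^sub>R (X * p)) * M" using R by (simp add: algebra_simps)
  also have "\<dots> = G * (e - c' *\<^sub>R p) * X * M" unfolding X using R by (simp add: algebra_simps)
  finally show ?thesis using R by (simp add: G)
qed

lemma R_p [simp]: "p \<in> R"
  by (simp add: p_def)

end

text \<open>\<open>M1\<close> and \<open>M2\<close> invert the squared lengths of the two columns.
  \<open>G\<close> inverts \<open>1 - t^2 q^2 p\<close>: the entries in rows 1 and 2 of the first
  column rescale \<open>p\<close> by \<open>q^2\<close> and their adjoints by \<open>q^{-2}\<close>,
  so \<open>M1\<close> moved past the former and \<open>M2\<close> moved past the latter both become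
  \<open>G\<close>.\<close>

locale instanton = suq_lt +
  fixes t \<theta> :: real and M1 M2 G :: quot
  assumes t: "t = sin (2 * \<theta>)"
    and M1: "(e - t\<^sup>2 *\<^sub>R p) * M1 = e" "M1 * (e - t\<^sup>2 *\<^sub>R p) = e" "M1 \<in> R"
    and M2: "(e - (t\<^sup>2 * q ^ 4) *\<^sub>R p) * M2 = e" "M2 * (e - (t\<^sup>2 * q ^ 4) *\<^sub>R p) = e" "M2 \<in> R"
    and G: "G * (e - (t\<^sup>2 * q\<^sup>2) *\<^sub>R p) = e" "G \<in> R"
begin

lemma q_powers: "q\<^sup>2 = \<Q> 2" "q ^ 4 = \<Q> 4"
  using q_pos by (simp_all add: quo.Q_def)

lemma M_comm:
  "u I3 I1 * M1 = M1 * u I3 I1" "us I3 I1 * M1 = M1 * us I3 I1"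
  "u I3 I1 * M2 = M2 * u I3 I1" "us I3 I1 * M2 = M2 * us I3 I1"
  "u I1 I1 * M1 = G * u I1 I1" "u I2 I1 * M1 = G * u I2 I1"
  "us I1 I1 * M2 = G * us I1 I1" "us I2 I1 * M2 = G * us I2 I1"
proof -
  have "t\<^sup>2 * \<Q> 2 = t\<^sup>2 * q\<^sup>2" "t\<^sup>2 * q ^ 4 * \<Q> (- 2) = t\<^sup>2 * q\<^sup>2"
    by (simp_all add: q_powers Q_simps mult.assoc)
  note Q = this
  show "u I3 I1 * M1 = M1 * u I3 I1" "us I3 I1 * M1 = M1 * us I3 I1"
    by (rule inverse_comm[OF M1(1,2)]; simp add: M1 p_comm)+
  show "u I3 I1 * M2 = M2 * u I3 I1" "us I3 I1 * M2 = M2 * us I3 I1"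
    by (rule inverse_comm[OF M2(1,2)]; simp add: M2 p_comm)+
  show "u I1 I1 * M1 = G * u I1 I1" "u I2 I1 * M1 = G * u I2 I1"
    by (rule inverse_comm[OF M1(1) G(1)]; simp add: M1 G p_comm(5,6) Q)+
  show "us I1 I1 * M2 = G * us I1 I1" "us I2 I1 * M2 = G * us I2 I1"
    by (rule inverse_comm[OF M2(1) G(1)]; simp add: M2 G p_comm(7,8) Q)+
qed

definition V :: "2 \<Rightarrow> 6 \<Rightarrow> quot" where
  "V j k = (if j = 1 then psiv \<theta> (us I3) k else phiv q \<theta> (u I3) k)"

definition W :: "2 \<Rightarrow> 6 \<Rightarrow> quot" where
  "W j k = (if j = 1 then psiv \<theta> (u I3) k else phiv q \<theta> (us I3) k)"

definition M :: "2 \<Rightarrow> quot" where "M j = (if j = 1 then M1 else M2)"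

definition PP :: "6 \<Rightarrow> 6 \<Rightarrow> quot" where
  "PP k m = (\<Sum>j\<in>UNIV. V j k * M j * W j m)"

definition N :: "2 \<Rightarrow> quot" where "N j = (if j = 1 then e - t\<^sup>2 *\<^sub>R p else e - (t\<^sup>2 * q ^ 4) *\<^sub>R p)"

text \<open>The squared lengths come from the orthogonality of row 3, in its plain form for \<psi>
  and its weighted form for \<phi>; the mixed products vanish by the \<open>q\<close>-commutation of
  \<open>z_2\<close> and \<open>z_3\<close> and its adjoint.\<close>

lemma W_V: "(\<Sum>k\<in>UNIV. W i k * V j k) = (if i = j then N j else 0)"
proof -
  have row: "u I3 I1 * us I3 I1 + u I3 I2 * us I3 I2 + u I3 I3 * us I3 I3 = e"
    using rel(1)[of I3 I3] by simp
  note row = this[unfolded p_comm(2)]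
  have col: "\<Q> 4 *\<^sub>R (us I3 I1 * u I3 I1) + \<Q> 2 *\<^sub>R (us I3 I2 * u I3 I2) + us I3 I3 * u I3 I3 = e"
    using rel(3)[of I3 I3] by (simp add: Q_simps)
  have c: "\<Q> 1 *\<^sub>R (u I3 I3 * u I3 I2) = u I3 I2 * u I3 I3"
    by (simp add: u_def quo.normalise)
  consider "i = 1" "j = 1" | "i = 1" "j = 2" | "i = 2" "j = 1" | "i = 2" "j = 2"
    using exhaust_2[of i] exhaust_2[of j] by blast
  then show ?thesis
  proof cases
    case 1
    then show ?thesis by (simp add: W_def V_def N_def psiv_psiv p_comm(2) row flip: t)
  next
    case 2
    then show ?thesis by (simp add: W_def V_def psiv_phiv quo.scaleR_q(1) c)
  next
    case 3
    then show ?thesis by (simp add: W_def V_def phiv_psiv quo.scaleR_q(1) star_minors(3))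
  next
    case 4
    have "q ^ 4 *\<^sub>R (us I3 I1 * u I3 I1) + q\<^sup>2 *\<^sub>R (us I3 I2 * u I3 I2) + us I3 I3 * u I3 I3 = e"
      unfolding q_powers by (rule col)
    note this[unfolded p_comm(1)]
    with 4 show ?thesis by (simp add: W_def V_def N_def phiv_phiv p_comm(1) flip: t)
  qed
qed

lemma R_VWM [simp]: "V j k \<in> R" "W j k \<in> R" "M j \<in> R" "N j \<in> R" "PP k m \<in> R"
proof -
  have "\<forall>k. psiv \<theta> f k \<in> R" "\<forall>k. phiv q \<theta> f k \<in> R" if "\<And>i. f i \<in> R" for f
    using that by (simp_all add: forall_6 psiv_def phiv_def)
  then show "V j k \<in> R" "W j k \<in> R" for j k by (simp_all add: V_def W_def)
  then show "M j \<in> R" "N j \<in> R" "PP k m \<in> R" by (auto simp: M_def N_def M1 M2 PP_def)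
qed

lemma N_M: "N j * M j = e" "M j * N j = e"
  by (simp_all add: N_def M_def M1 M2)

lemma W_PP: "(\<Sum>k\<in>UNIV. W i k * PP k m) = W i m"
proof -
  have "(\<Sum>k\<in>UNIV. W i k * PP k m) = (\<Sum>j\<in>UNIV. (\<Sum>k\<in>UNIV. W i k * V j k) * (M j * W j m))"
    unfolding PP_def sum_distrib_left sum_distrib_right
    by (subst sum.swap) (simp add: mult.assoc)
  also have "\<dots> = (\<Sum>j\<in>UNIV. if j = i then N i * (M i * W i m) else 0)"
    unfolding W_V by (intro sum.cong) auto
  also have "\<dots> = W i m" by (simp add: N_M flip: mult.assoc)
  finally show ?thesis .
qed

lemma PP_V: "(\<Sum>l\<in>UNIV. PP m l * V j l) = V j m"
proof -
  have "(\<Sum>l\<in>UNIV. PP m l * V j l) = (\<Sum>i\<in>UNIV. V i m * M i * (\<Sum>l\<in>UNIV. W i l * V j l))"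
    unfolding PP_def sum_distrib_left sum_distrib_right
    by (subst sum.swap) (simp add: mult.assoc)
  also have "\<dots> = (\<Sum>i\<in>UNIV. if i = j then V j m * M j * N j else 0)"
    unfolding W_V by (intro sum.cong) auto
  also have "\<dots> = V j m" by (simp add: N_M mult.assoc)
  finally show ?thesis .
qed

lemma PP_PP: "(\<Sum>m\<in>UNIV. PP k m * PP m l) = PP k l"
proof -
  have "(\<Sum>m\<in>UNIV. PP k m * PP m l) = (\<Sum>j\<in>UNIV. V j k * M j * (\<Sum>m\<in>UNIV. W j m * PP m l))"
    unfolding PP_def[of k] sum_distrib_left sum_distrib_right
    by (subst sum.swap) (simp add: mult.assoc)
  also have "\<dots> = PP k l" unfolding W_PP by (simp add: PP_def)
  finally show ?thesis .
qed

text \<open>Half of \<open>charges\<close>: the exponent for \<open>K_2\<close>, whereas the charge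
  of a line bundle is that of \<open>K_2^2\<close>.\<close>

definition chg :: "2 \<Rightarrow> real" where "chg j = (if j = 1 then 1/2 else - 1/2)"

lemma charged_VW: "charged (chg j) (W j k)" "charged (- chg j) (V j k)"
proof -
  have "\<forall>k. charged a (psiv \<theta> f k)" "\<forall>k. charged a (phiv q \<theta> f k)" if "\<And>i. charged a (f i)" for f a
    using that by (simp_all add: forall_6 psiv_def phiv_def charged_scaleR charged_uminus charged_0)
  then show "charged (chg j) (W j k)" "charged (- chg j) (V j k)"
    using charged_u by (simp_all add: V_def W_def chg_def)
qed

lemma D_psiv: "(\<And>i. f i \<in> R) \<Longrightarrow> D a (psiv \<theta> f k) = psiv \<theta> (\<lambda>i. D a (f i)) k"
  and D_phiv: "(\<And>i. f i \<in> R) \<Longrightarrow> D a (phiv q \<theta> f k) = phiv q \<theta> (\<lambda>i. D a (f i)) k"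
proof -
  assume f: "\<And>i. f i \<in> R"
  have "\<forall>k. D a (psiv \<theta> f k) = psiv \<theta> (\<lambda>i. D a (f i)) k" "\<forall>k. D a (phiv q \<theta> f k) = phiv q \<theta> (\<lambda>i. D a (f i)) k"
    by (simp_all add: forall_6 psiv_def phiv_def D_scaleR D_uminus f)
  then show "D a (psiv \<theta> f k) = psiv \<theta> (\<lambda>i. D a (f i)) k" "D a (phiv q \<theta> f k) = phiv q \<theta> (\<lambda>i. D a (f i)) k"
    by simp_all
qed

text \<open>The components of \<open>dW (1 - P) dV\<close>.\<close>

definition Z :: "2 \<Rightarrow> 2 \<Rightarrow> 2 + 2 \<Rightarrow> 2 + 2 \<Rightarrow> quot" where
  "Z i j a b = (\<Sum>m\<in>UNIV. D a (W i m) * D b (V j m))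
    - (\<Sum>j'\<in>UNIV. (\<Sum>k\<in>UNIV. D a (W i k) * V j' k) * M j' * (\<Sum>l\<in>UNIV. W j' l * D b (V j l)))"

text \<open>\<open>P\<close> has charge 0, so the Leibniz rules for \<open>W P = W\<close> and
  \<open>P V = V\<close> are twisted only by the charges of \<open>W\<close> and \<open>V\<close>;
  these twists make up the power of \<open>q\<close> on the right.\<close>

lemma sandwich:
  assumes P: "\<And>k m. charged 0 (PP k m)"
  shows "(\<Sum>m\<in>UNIV. (\<Sum>k\<in>UNIV. W i k * D a (PP k m)) * (\<Sum>l\<in>UNIV. D b (PP m l) * V j l))
    = \<Q> (chg i + chg j) *\<^sub>R Z i j a b"
proof -
  have L: "(\<Sum>k\<in>UNIV. W i k * D a (PP k m)) = \<Q> (chg i) *\<^sub>R (D a (W i m) - (\<Sum>k\<in>UNIV. D a (W i k) * PP k m))" for m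
  proof -
    have "D a (W i m) = (\<Sum>k\<in>UNIV. D a (W i k * PP k m))"
      unfolding W_PP[of i m, symmetric] by (simp add: D_sum)
    also have "\<dots> = (\<Sum>k\<in>UNIV. D a (W i k) * PP k m) + \<Q> (- chg i) *\<^sub>R (\<Sum>k\<in>UNIV. W i k * D a (PP k m))"
      by (simp add: D_mult[OF charged_VW(1) P] Q_simps sum.distrib scaleR_sum_right)
    finally show ?thesis by (simp add: Q_simps)
  qed
  have R: "(\<Sum>l\<in>UNIV. D b (PP m l) * V j l) = \<Q> (chg j) *\<^sub>R (D b (V j m) - (\<Sum>l\<in>UNIV. PP m l * D b (V j l)))" for m
  proof -
    have "D b (V j m) = (\<Sum>l\<in>UNIV. D b (PP m l * V j l))"
      unfolding PP_V[of m j, symmetric] by (simp add: D_sum)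
    also have "\<dots> = \<Q> (- chg j) *\<^sub>R (\<Sum>l\<in>UNIV. D b (PP m l) * V j l) + (\<Sum>l\<in>UNIV. PP m l * D b (V j l))"
      by (simp add: D_mult[OF P charged_VW(2)] Q_simps sum.distrib scaleR_sum_right)
    finally show ?thesis by (simp add: Q_simps)
  qed
  have "(\<Sum>k\<in>UNIV. \<Sum>l\<in>UNIV. D a (W i k) * PP k l * D b (V j l))
    = (\<Sum>k\<in>UNIV. \<Sum>l\<in>UNIV. \<Sum>j'\<in>UNIV. D a (W i k) * V j' k * M j' * (W j' l * D b (V j l)))"
    by (simp add: PP_def sum_distrib_left sum_distrib_right mult.assoc)
  also have "\<dots> = (\<Sum>k\<in>UNIV. \<Sum>j'\<in>UNIV. \<Sum>l\<in>UNIV. D a (W i k) * V j' k * M j' * (W j' l * D b (V j l)))"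
    by (intro sum.cong[OF refl] sum.swap)
  also have "\<dots> = (\<Sum>j'\<in>UNIV. \<Sum>k\<in>UNIV. \<Sum>l\<in>UNIV. D a (W i k) * V j' k * M j' * (W j' l * D b (V j l)))"
    by (rule sum.swap)
  also have "\<dots> = (\<Sum>j'\<in>UNIV. (\<Sum>k\<in>UNIV. D a (W i k) * V j' k) * M j' * (\<Sum>l\<in>UNIV. W j' l * D b (V j l)))"
    by (simp add: sum_distrib_left sum_distrib_right mult.assoc) (intro sum.cong[OF refl] sum.swap)
  finally show ?thesis
    unfolding L R Z_def using compress_product[OF PP_PP, of "\<lambda>m. D a (W i m)" "\<lambda>m. D b (V j m)"]
    by (simp add: Q_simps add.commute flip: scaleR_sum_right)
qed


section \<open>The two surviving blocks of the curvature\<close>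

lemma D_W1: "D (Inl 1) (W 1 k) = psiv \<theta> (u I2) k" "D (Inl 2) (W 1 k) = psiv \<theta> (u I1) k" "D (Inr i) (W 1 k) = 0"
  and D_V1: "D (Inr 1) (V 1 k) = psiv \<theta> (\<lambda>j. \<Q> (- 2) *\<^sub>R us I1 j) k" "D (Inr 2) (V 1 k) = psiv \<theta> (\<lambda>j. (- \<Q> (- 1)) *\<^sub>R us I2 j) k"
    "D (Inl i) (V 1 k) = 0"
  and D_W2: "D (Inr 1) (W 2 k) = phiv q \<theta> (\<lambda>j. \<Q> (- 2) *\<^sub>R us I1 j) k" "D (Inr 2) (W 2 k) = phiv q \<theta> (\<lambda>j. (- \<Q> (- 1)) *\<^sub>R us I2 j) k"
    "D (Inl i) (W 2 k) = 0"
  and D_V2: "D (Inl 1) (V 2 k) = phiv q \<theta> (u I2) k" "D (Inl 2) (V 2 k) = phiv q \<theta> (u I1) k" "D (Inr i) (V 2 k) = 0"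
proof -
  have 0: "\<forall>k. psiv \<theta> (\<lambda>i. 0) k = 0" "\<forall>k. phiv q \<theta> (\<lambda>i. 0) k = 0"
    by (simp_all add: forall_6 psiv_def phiv_def)
  show "D (Inl 1) (W 1 k) = psiv \<theta> (u I2) k" "D (Inl 2) (W 1 k) = psiv \<theta> (u I1) k" "D (Inr i) (W 1 k) = 0"
    "D (Inr 1) (V 1 k) = psiv \<theta> (\<lambda>j. \<Q> (- 2) *\<^sub>R us I1 j) k" "D (Inr 2) (V 1 k) = psiv \<theta> (\<lambda>j. (- \<Q> (- 1)) *\<^sub>R us I2 j) k"
    "D (Inl i) (V 1 k) = 0"
    "D (Inr 1) (W 2 k) = phiv q \<theta> (\<lambda>j. \<Q> (- 2) *\<^sub>R us I1 j) k" "D (Inr 2) (W 2 k) = phiv q \<theta> (\<lambda>j. (- \<Q> (- 1)) *\<^sub>R us I2 j) k"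
    "D (Inl i) (W 2 k) = 0"
    "D (Inl 1) (V 2 k) = phiv q \<theta> (u I2) k" "D (Inl 2) (V 2 k) = phiv q \<theta> (u I1) k" "D (Inr i) (V 2 k) = 0"
    by (simp_all add: W_def V_def D_psiv D_phiv D_u D_us 0)
qed

text \<open>The block \<open>Z 1 1\<close> freed of scalars: \<open>r\<close> and \<open>r'\<close>
  are the rows to which differentiation moves row 3 and its adjoint.\<close>

definition T1 :: "index \<Rightarrow> index \<Rightarrow> quot" where
  "T1 r r' = (\<Sum>m\<in>UNIV. psiv \<theta> (u r) m * psiv \<theta> (us r') m)
    - (\<Sum>k\<in>UNIV. psiv \<theta> (u r) k * psiv \<theta> (us I3) k) * M1 * (\<Sum>l\<in>UNIV. psiv \<theta> (u I3) l * psiv \<theta> (us r') l)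
    - (\<Sum>k\<in>UNIV. psiv \<theta> (u r) k * phiv q \<theta> (u I3) k) * M2 * (\<Sum>l\<in>UNIV. phiv q \<theta> (us I3) l * psiv \<theta> (us r') l)"

definition T2 :: "index \<Rightarrow> index \<Rightarrow> quot" where
  "T2 r r' = (\<Sum>m\<in>UNIV. phiv q \<theta> (us r) m * phiv q \<theta> (u r') m)
    - (\<Sum>k\<in>UNIV. phiv q \<theta> (us r) k * psiv \<theta> (us I3) k) * M1 * (\<Sum>l\<in>UNIV. psiv \<theta> (u I3) l * phiv q \<theta> (u r') l)
    - (\<Sum>k\<in>UNIV. phiv q \<theta> (us r) k * phiv q \<theta> (u I3) k) * M2 * (\<Sum>l\<in>UNIV. phiv q \<theta> (us I3) l * phiv q \<theta> (u r') l)"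

lemma psiv_scaleR: "psiv \<theta> (\<lambda>j. c *\<^sub>R f j) k = c *\<^sub>R psiv \<theta> f k"
  and phiv_scaleR: "phiv q \<theta> (\<lambda>j. c *\<^sub>R f j) k = c *\<^sub>R phiv q \<theta> f k"
proof -
  have "\<forall>k. psiv \<theta> (\<lambda>j. c *\<^sub>R f j) k = c *\<^sub>R psiv \<theta> f k" "\<forall>k. phiv q \<theta> (\<lambda>j. c *\<^sub>R f j) k = c *\<^sub>R phiv q \<theta> f k"
    by (simp_all add: forall_6 psiv_def phiv_def mult.commute)
  then show "psiv \<theta> (\<lambda>j. c *\<^sub>R f j) k = c *\<^sub>R psiv \<theta> f k" "phiv q \<theta> (\<lambda>j. c *\<^sub>R f j) k = c *\<^sub>R phiv q \<theta> f k"
    by simp_all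
qed

lemma Z_T1:
  "Z 1 1 (Inl 1) (Inr 1) = \<Q> (- 2) *\<^sub>R T1 I2 I1" "Z 1 1 (Inl 2) (Inr 2) = (- \<Q> (- 1)) *\<^sub>R T1 I1 I2"
  "Z 1 1 (Inl 1) (Inr 2) = (- \<Q> (- 1)) *\<^sub>R T1 I2 I2" "Z 1 1 (Inl 2) (Inr 1) = \<Q> (- 2) *\<^sub>R T1 I1 I1"
  unfolding Z_def T1_def D_W1 D_V1 psiv_scaleR sum_2
  by (simp_all add: V_def W_def M_def scaleR_right_diff_distrib scaleR_right_distrib sum_negf flip: scaleR_sum_right)

lemma Z_T2:
  "Z 2 2 (Inr 1) (Inl 1) = \<Q> (- 2) *\<^sub>R T2 I1 I2" "Z 2 2 (Inr 2) (Inl 2) = (- \<Q> (- 1)) *\<^sub>R T2 I2 I1"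
  "Z 2 2 (Inr 1) (Inl 2) = \<Q> (- 2) *\<^sub>R T2 I1 I1" "Z 2 2 (Inr 2) (Inl 1) = (- \<Q> (- 1)) *\<^sub>R T2 I2 I2"
  unfolding Z_def T2_def D_W2 D_V2 phiv_scaleR sum_2
  by (simp_all add: V_def W_def M_def scaleR_right_diff_distrib scaleR_right_distrib sum_negf flip: scaleR_sum_right)

text \<open>\<open>z_i\<close> is killed by the conjugate operator and \<open>z_i^*\<close> by
  \<open>\<partial>\<close>. Types (\<open>Inl\<close>, \<open>Inr\<close>) thus leave only the
  entry in which both columns are \<psi>, and types (\<open>Inr\<close>, \<open>Inl\<close>) the one
  in which both are \<phi>.\<close>

lemma Z_0:
  "i \<noteq> 1 \<or> j \<noteq> 1 \<Longrightarrow> Z i j (Inl a) (Inr b) = 0"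
  "i \<noteq> 2 \<or> j \<noteq> 2 \<Longrightarrow> Z i j (Inr a) (Inl b) = 0"
  using exhaust_2[of i] exhaust_2[of j] by (auto simp: Z_def D_W1 D_W2 D_V1 D_V2)

text \<open>The resolvent identity \<open>M1 = e + t^2 p M1\<close>, with \<open>p\<close> split
  into \<open>z_1^*\<close> and \<open>z_1\<close> and \<open>M1\<close> moved between the two
  factors.\<close>

lemma fold_M1: "u r I1 * us r' I1 + (t\<^sup>2) *\<^sub>R (u r I1 * us I3 I1 * M1 * (u I3 I1 * us r' I1)) = u r I1 * M1 * us r' I1"
proof -
  have "us I3 I1 * M1 * u I3 I1 = p * M1"
    using M_comm(1) by (metis mult.assoc p_def)
  moreover have "M1 = e + t\<^sup>2 *\<^sub>R (p * M1)"
    using M1 by (simp add: left_diff_distrib algebra_simps)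
  ultimately have "u r I1 * M1 * us r' I1 = u r I1 * (e + t\<^sup>2 *\<^sub>R (us I3 I1 * M1 * u I3 I1)) * us r' I1"
    by simp
  then show ?thesis by (simp add: algebra_simps)
qed

lemma fold_M2: "us r I1 * u r' I1 + (t\<^sup>2 * q ^ 4) *\<^sub>R (us r I1 * u I3 I1 * M2 * (us I3 I1 * u r' I1)) = us r I1 * M2 * u r' I1"
proof -
  have "u I3 I1 * M2 * us I3 I1 = p * M2"
    using M_comm(4) p_comm(2) by (metis mult.assoc)
  moreover have "M2 = e + (t\<^sup>2 * q ^ 4) *\<^sub>R (p * M2)"
    using M2 by (simp add: left_diff_distrib algebra_simps)
  ultimately have "us r I1 * M2 * u r' I1 = us r I1 * (e + (t\<^sup>2 * q ^ 4) *\<^sub>R (u I3 I1 * M2 * us I3 I1)) * u r' I1"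
    by simp
  then show ?thesis by (simp add: algebra_simps)
qed

text \<open>The quantum minor of rows \<open>r\<close> and 3 in columns 2 and 3, rewritten by the
  cofactor relation; \<open>ms\<close> is its adjoint. Only the values at rows 1 and 2 have this
  meaning.\<close>

definition m :: "index \<Rightarrow> quot" where "m r = (if r = I2 then us I1 I1 else - (\<Q> 1 *\<^sub>R us I2 I1))"

definition ms :: "index \<Rightarrow> quot" where "ms r = (if r = I2 then u I1 I1 else - (\<Q> 1 *\<^sub>R u I2 I1))"

text \<open>Orthogonality supplies the unit, the terms from \<psi> alone merge by
  \<open>fold_M1\<close> into one resolvent, and the products of \<psi> with \<phi> are quantum
  minors.\<close>

lemma T1_eq:
  assumes "r \<noteq> I3" "r' \<noteq> I3"
  shows "T1 r r' = (if r = r' then e else 0) - t\<^sup>2 *\<^sub>R (u r I1 * M1 * us r' I1 + m r * M2 * ms r')"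
proof -
  have m: "\<Q> 1 *\<^sub>R (u r I3 * u I3 I2) - u r I2 * u I3 I3 = - m r"
    using assms(1) rel(11,12) by (cases r) (simp_all add: m_def algebra_simps)
  have ms: "\<Q> 1 *\<^sub>R (us I3 I2 * us r' I3) - us I3 I3 * us r' I2 = - ms r'"
    using assms(2) star_minors(1,2) by (cases r') (simp_all add: ms_def algebra_simps)
  have s: "u i I1 * us j I1 + u i I2 * us j I2 + u i I3 * us j I3 = (if i = j then e else 0)" for i j
    by (rule rel(1))
  have "T1 r r' = (if r = r' then e else 0) - t\<^sup>2 *\<^sub>R (u r I1 * us r' I1 + t\<^sup>2 *\<^sub>R (u r I1 * us I3 I1 * M1 * (u I3 I1 * us r' I1)))
      - t\<^sup>2 *\<^sub>R (m r * M2 * ms r')"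
    unfolding T1_def psiv_psiv psiv_phiv phiv_psiv s quo.scaleR_q(1) m ms t[symmetric] using assms
    by (auto simp: scaleR_right_distrib power2_eq_square)
  then show ?thesis unfolding fold_M1 by (simp add: algebra_simps)
qed

lemma T2_eq:
  assumes "r \<noteq> I3" "r' \<noteq> I3"
  shows "T2 r r' = (if r = r' then \<Q> (6 - 2 * ix r) *\<^sub>R e else 0) - t\<^sup>2 *\<^sub>R (\<Q> 4 *\<^sub>R (us r I1 * M2 * u r' I1) + \<Q> 2 *\<^sub>R (ms r * M1 * m r'))"
proof -
  have m: "\<Q> 1 *\<^sub>R (u I3 I3 * u r' I2) - u I3 I2 * u r' I3 = \<Q> 1 *\<^sub>R m r'"
    using assms(2) minors' by (cases r') (simp_all add: m_def Q_simps)
  have ms: "\<Q> 1 *\<^sub>R (us r I2 * us I3 I3) - us r I3 * us I3 I2 = \<Q> 1 *\<^sub>R ms r"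
    using assms(1) star_minors' by (cases r) (simp_all add: ms_def Q_simps)
  have s: "q ^ 4 *\<^sub>R (us i I1 * u j I1) + q\<^sup>2 *\<^sub>R (us i I2 * u j I2) + us i I3 * u j I3 = (if i = j then \<Q> (6 - 2 * ix i) *\<^sub>R e else 0)" for i j
    unfolding q_powers by (rule rel(3))
  have "T2 r r' = (if r = r' then \<Q> (6 - 2 * ix r) *\<^sub>R e else 0)
      - (t\<^sup>2 * q ^ 4) *\<^sub>R (us r I1 * u r' I1 + (t\<^sup>2 * q ^ 4) *\<^sub>R (us r I1 * u I3 I1 * M2 * (us I3 I1 * u r' I1)))
      - (t\<^sup>2 * \<Q> 2) *\<^sub>R (ms r * M1 * m r')"
    unfolding T2_def phiv_phiv psiv_phiv phiv_psiv s quo.scaleR_q(1) m ms t[symmetric] using assms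
    by (auto simp: scaleR_right_distrib power2_eq_square Q_simps mult_ac)
  then show ?thesis unfolding fold_M2 by (simp add: q_powers(2) algebra_simps)
qed

text \<open>Moving \<open>M1\<close> and \<open>M2\<close> to the left turns both into
  \<open>G\<close>. What remains are relations in the first column: \<open>q\<close>-commutation for
  the off-diagonal entries, and the balance relation multiplied by \<open>G\<close> for the diagonal
  ones.\<close>

lemma T_zero: "T1 I2 I1 = 0" "T1 I1 I2 = 0" "T1 I2 I2 = T1 I1 I1"
  "T2 I2 I1 = 0" "T2 I1 I2 = 0" "\<Q> (- 2) *\<^sub>R T2 I1 I1 = T2 I2 I2"
proof -
  note Mc = M_comm(5-8)
  note c = rel(7,9)
  have b: "u I2 I1 * us I2 I1 + us I1 I1 * u I1 I1 = u I1 I1 * us I1 I1 + \<Q> 2 *\<^sub>R (us I2 I1 * u I2 I1)"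
    by (rule rel(10))
  have Gb: "G * (u I2 I1 * us I2 I1) + G * (us I1 I1 * u I1 I1) = G * (u I1 I1 * us I1 I1) + \<Q> 2 *\<^sub>R (G * (us I2 I1 * u I2 I1))"
    using arg_cong[OF b, of "\<lambda>x. G * x"] by (simp add: distrib_left)
  show "T1 I2 I1 = 0" "T1 I1 I2 = 0" "T2 I2 I1 = 0" "T2 I1 I2 = 0"
    by (simp_all add: T1_eq T2_eq m_def ms_def Mc c mult.assoc Q_simps)
  show "T1 I2 I2 = T1 I1 I1"
    using Gb by (simp add: T1_eq m_def ms_def Mc mult.assoc Q_simps)
  have "G * (us I1 I1 * u I1 I1) = G * (u I1 I1 * us I1 I1) + \<Q> 2 *\<^sub>R (G * (us I2 I1 * u I2 I1)) - G * (u I2 I1 * us I2 I1)"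
    using Gb by (simp add: algebra_simps)
  then show "\<Q> (- 2) *\<^sub>R T2 I1 I1 = T2 I2 I2"
    by (simp add: T2_eq m_def ms_def Mc mult.assoc Q_simps scaleR_right_distrib scaleR_right_diff_distrib mult_ac)
qed

text \<open>The pairings that occur in \<open>mu1\<close>, for either order of types: the two outer
  components and the \<open>q\<close>-symmetric combination in the middle.\<close>

lemma Z_asd:
  "Z i j (Inl 1) (Inr 1) = 0" "Z i j (Inl 2) (Inr 2) = 0"
  "\<Q> (- 1/2) *\<^sub>R Z i j (Inl 1) (Inr 2) + \<Q> (1/2) *\<^sub>R Z i j (Inl 2) (Inr 1) = 0"
  "Z i j (Inr 1) (Inl 1) = 0" "Z i j (Inr 2) (Inl 2) = 0"
  "\<Q> (- 1/2) *\<^sub>R Z i j (Inr 1) (Inl 2) + \<Q> (1/2) *\<^sub>R Z i j (Inr 2) (Inl 1) = 0"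
proof -
  show "Z i j (Inl 1) (Inr 1) = 0" "Z i j (Inl 2) (Inr 2) = 0"
    "\<Q> (- 1/2) *\<^sub>R Z i j (Inl 1) (Inr 2) + \<Q> (1/2) *\<^sub>R Z i j (Inl 2) (Inr 1) = 0"
    by (cases "i = 1 \<and> j = 1"; simp add: Z_0 Z_T1 T_zero Q_simps)+
  have T2: "T2 I2 I2 = \<Q> (- 2) *\<^sub>R T2 I1 I1" by (simp add: T_zero)
  show "Z i j (Inr 1) (Inl 1) = 0" "Z i j (Inr 2) (Inl 2) = 0"
    "\<Q> (- 1/2) *\<^sub>R Z i j (Inr 1) (Inl 2) + \<Q> (1/2) *\<^sub>R Z i j (Inr 2) (Inl 1) = 0"
    by (cases "i = 2 \<and> j = 2"; simp add: Z_0 Z_T2 T_zero(1-5) T2 Q_simps)+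
qed

end

section \<open>Modules of forms\<close>

context suq_lt
begin

lemma qnum_2: "qnum q 2 = \<Q> 1 + \<Q> (- 1)"
proof -
  have "\<Q> 1 = q" "\<Q> (- 1) = 1 / q" using q_pos by (simp_all add: quo.Q_def powr_minus_divide)
  moreover from this have "q - 1 / q \<noteq> 0" using Q_diff by simp
  moreover have "q powr 2 - q powr - 2 = (q - 1 / q) * (q + 1 / q)"
    using q_pos by (simp add: powr_minus_divide field_simps power2_eq_square)
  ultimately show ?thesis by (simp add: qnum_def)
qed

lemma rt_qnum: "sqrt (qnum q 2) = rt" "qnum q 2 powr (- 1/2) = 1 / rt"
proof -
  show "sqrt (qnum q 2) = rt" by (simp add: qnum_2 rt_def)
  moreover have "qnum q 2 > 0" by (simp add: qnum_2 add_pos_pos)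
  ultimately show "qnum q 2 powr (- 1/2) = 1 / rt"
    by (metis divide_minus_left less_imp_le powr_half_sqrt powr_minus_divide)
qed

lemma enl_intros [simp, intro]:
  "emb a \<in> enl q t" "x \<in> enl q t \<Longrightarrow> y \<in> enl q t \<Longrightarrow> x + y \<in> enl q t"
  "x \<in> enl q t \<Longrightarrow> y \<in> enl q t \<Longrightarrow> x * y \<in> enl q t" "x \<in> enl q t \<Longrightarrow> cstar x \<in> enl q t"
  "x \<in> enl q t \<Longrightarrow> cact q h x \<in> enl q t" "rsc r \<in> enl q t" "csc c \<in> enl q t" "0 \<in> enl q t" "1 \<in> enl q t"
proof -
  show "rsc r \<in> enl q t" "csc c \<in> enl q t"
    unfolding rsc_def csc_def by (rule enl.intros(1))+
  show "0 \<in> enl q t" "1 \<in> enl q t"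
    using enl.intros(1)[of 0 q t] enl.intros(1)[of 1 q t] by (simp_all only: emb_hom)
qed (fact enl.intros)+

lemma enl_uminus [simp, intro]: "x \<in> enl q t \<Longrightarrow> - x \<in> enl q t"
  using enl_intros(3)[of "rsc (- 1)" t x] enl_intros(6)[of "- 1" t] by (simp add: rsc_simps)

lemma enl_diff [simp, intro]: "x \<in> enl q t \<Longrightarrow> y \<in> enl q t \<Longrightarrow> x - y \<in> enl q t"
  using enl_intros(2)[of x t "- y"] by simp

lemma enl_sum [simp, intro]: "(\<And>i. i \<in> I \<Longrightarrow> f i \<in> enl q t) \<Longrightarrow> sum f I \<in> enl q t"
  by (induction I rule: infinite_finite_induct) simp_all

end

locale forms = suq_lt +
  fixes t :: real
  assumes t_sq: "t\<^sup>2 < 1"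
begin

lemma bdd_enl [simp, intro]: "x \<in> enl q t \<Longrightarrow> x \<in> bdd"
  using enl_bdd t_sq q_lt by blast

lemma ceq_cls: "x \<in> enl q t \<Longrightarrow> y \<in> enl q t \<Longrightarrow> ceq q x y \<longleftrightarrow> cls x = cls y"
  by (simp add: cls_eq_iff)

definition LA :: "uq \<Rightarrow> quot \<Rightarrow> quot" where
  "LA h X = (case h of K i \<Rightarrow> A (Kinv i) X | Kinv i \<Rightarrow> A (K i) X | E i \<Rightarrow> (- \<Q> (- 1)) *\<^sub>R A (E i) X | F i \<Rightarrow> (- \<Q> 1) *\<^sub>R A (F i) X)"

lemma enl_Lact [simp, intro]: "x \<in> enl q t \<Longrightarrow> Lact q h x \<in> enl q t"
  by (cases h) auto

lemma cls_Lact: "x \<in> bdd \<Longrightarrow> cls (Lact q h x) = LA h (cls x)"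
  using q_pos by (cases h) (auto simp: LA_def A_cls cls_rsc quo.Q_def powr_minus_divide)

lemma enl_tens [simp, intro]: "(\<And>j. v $ j \<in> enl q t) \<Longrightarrow> (\<And>x. x \<in> enl q t \<Longrightarrow> L x \<in> enl q t) \<Longrightarrow> tens L M v $ i \<in> enl q t"
  by (auto simp: tens_def)

lemma cls_tens: "(\<And>j. v $ j \<in> enl q t) \<Longrightarrow>
    cls (tens (Lact q h) M v $ i) = (\<Sum>j\<in>UNIV. Cc (M $ i $ j) * LA h (cls (v $ j)))"
  by (simp add: tens_def cls_sum cls_hom Cc_def cls_Lact)

lemma cls_tens3: "(\<And>j. v $ j \<in> enl q t) \<Longrightarrow>
    cls (tens (Lact q h \<circ> Lact q h' \<circ> Lact q h'') M v $ i) = (\<Sum>j\<in>UNIV. Cc (M $ i $ j) * LA h (LA h' (LA h'' (cls (v $ j)))))"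
  by (simp add: tens_def cls_sum cls_hom Cc_def cls_Lact)

lemma module_iff:
  "v \<in> module_of q t \<sigma> \<longleftrightarrow> (\<forall>i. v $ i \<in> enl q t) \<and>
    (\<forall>i. (\<Sum>j\<in>UNIV. Cc (repK \<sigma> $ i $ j) * A (Kinv N1) (cls (v $ j))) = cls (v $ i)) \<and>
    (\<forall>i. (\<Sum>j\<in>UNIV. Cc (repC \<sigma> $ i $ j) * A (Kinv N1) (A (Kinv N2) (A (Kinv N2) (cls (v $ j))))) = cls (v $ i)) \<and>
    (\<forall>i. (\<Sum>j\<in>UNIV. Cc (repK \<sigma> $ i $ j) * (- \<Q> (- 1)) *\<^sub>R A (E N1) (cls (v $ j)))
       + (\<Sum>j\<in>UNIV. Cc (repE \<sigma> $ i $ j) * A (K N1) (cls (v $ j))) = 0) \<and>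
    (\<forall>i. (\<Sum>j\<in>UNIV. Cc (repK \<sigma> $ i $ j) * (- \<Q> 1) *\<^sub>R A (F N1) (cls (v $ j)))
       + (\<Sum>j\<in>UNIV. Cc (repF \<sigma> $ i $ j) * A (K N1) (cls (v $ j))) = 0)"
proof (cases "\<forall>i. v $ i \<in> enl q t")
  case True
  then show ?thesis
    unfolding module_of_def veq_def
    by (simp add: ceq_cls cls_tens cls_tens3 cls_hom LA_def bdd_enl del: Lact.simps)
next
  case False
  then show ?thesis unfolding module_of_def by blast
qed

text \<open>With the weight \<open>b\<close> of \<open>K_1\<close> known, the condition on
  \<open>K_1 K_2^2\<close> becomes one on \<open>K_2^2\<close> alone. The inverses stem from the
  inverse antipode in \<open>Lact\<close>.\<close>

lemma chargeK_iff:
  assumes X: "X \<in> R" "A (K N1) X = \<Q> b *\<^sub>R X"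
  shows "\<Q> a *\<^sub>R A (Kinv N1) (A (Kinv N2) (A (Kinv N2) X)) = X \<longleftrightarrow> A (K N2) (A (K N2) X) = \<Q> (a - b) *\<^sub>R X"
proof
  let ?Y = "A (Kinv N2) (A (Kinv N2) X)"
  have Y: "A (K N2) (A (K N2) ?Y) = X" using X by simp
  {
    assume *: "\<Q> a *\<^sub>R A (Kinv N1) ?Y = X"
    have "\<Q> b *\<^sub>R X = A (K N1) (\<Q> a *\<^sub>R A (Kinv N1) ?Y)" by (simp only: * X)
    also have "\<dots> = \<Q> a *\<^sub>R ?Y" using X by (simp add: A_scaleR)
    finally have **: "?Y = \<Q> (b - a) *\<^sub>R X"
      by (metis (no_types) Q_simps(1,2) add.commute diff_add_cancel diff_minus_eq_add left_minus scaleR_one scaleR_scaleR)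
    have "X = \<Q> (b - a) *\<^sub>R A (K N2) (A (K N2) X)"
      using Y X unfolding ** by (simp add: A_scaleR)
    then have "\<Q> (a - b) *\<^sub>R X = \<Q> (a - b) *\<^sub>R \<Q> (b - a) *\<^sub>R A (K N2) (A (K N2) X)" by simp
    then show "A (K N2) (A (K N2) X) = \<Q> (a - b) *\<^sub>R X" by (simp add: Q_simps)
  }
  {
    assume *: "A (K N2) (A (K N2) X) = \<Q> (a - b) *\<^sub>R X"
    have "X = A (Kinv N2) (A (Kinv N2) (A (K N2) (A (K N2) X)))" using X by simp
    also have "\<dots> = \<Q> (a - b) *\<^sub>R ?Y" using X unfolding * by (simp add: A_scaleR)
    finally have "\<Q> (b - a) *\<^sub>R X = \<Q> (b - a) *\<^sub>R \<Q> (a - b) *\<^sub>R ?Y" by simp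
    then have "?Y = \<Q> (b - a) *\<^sub>R X" by (simp add: Q_simps)
    then show "\<Q> a *\<^sub>R A (Kinv N1) ?Y = X"
      using X Kinv_eigen[OF X] by (simp add: A_scaleR Q_simps)
  }
qed

lemma Cc_simps: "X \<in> R \<Longrightarrow> Cc (complex_of_real (q powr a)) * X = \<Q> a *\<^sub>R X"
  "X \<in> R \<Longrightarrow> Cc (complex_of_real q) * X = \<Q> 1 *\<^sub>R X" "X \<in> R \<Longrightarrow> Cc (1 / complex_of_real q) * X = \<Q> (- 1) *\<^sub>R X"
  "X \<in> R \<Longrightarrow> Cc (complex_of_real rt) * X = rt *\<^sub>R X" "Cc 0 * X = 0" "X \<in> R \<Longrightarrow> Cc 1 * X = X"
  using Cc_real[of X "1 / q"] q_pos by (simp_all add: Cc_real Cc_0 Cc_1 quo.Q_def powr_minus_divide)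

lemma line_bundle_iff: "x \<in> line_bundle q t N \<longleftrightarrow> x \<in> enl q t \<and> LB N (cls x)"
proof (cases "x \<in> enl q t")
  case True
  then have X: "cls x \<in> R" by simp
  have "x \<in> line_bundle q t N \<longleftrightarrow> A (Kinv N1) (cls x) = cls x \<and>
      \<Q> N *\<^sub>R A (Kinv N1) (A (Kinv N2) (A (Kinv N2) (cls x))) = cls x \<and> A (E N1) (cls x) = 0 \<and> A (F N1) (cls x) = 0"
    using True X by (simp add: line_bundle_def module_iff sigma0_def forall_1 mat_def Cc_simps)
  also have "\<dots> \<longleftrightarrow> LB N (cls x)"
    using X scaled_Kinv_iff[OF X, of 0 N1] chargeK_iff[OF X, of 0 N] by (auto simp: LB_def Q_simps)
  finally show ?thesis using True by simp
qed (auto simp: line_bundle_def module_of_def)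

lemma half_memI:
  assumes "v $ 1 \<in> enl q t" "v $ 2 \<in> enl q t" "HALF N (cls (v $ 1)) (cls (v $ 2))"
  shows "v \<in> module_of q t (sigma_half q N)"
proof -
  note H = HALFD[OF assms(3)]
  have "\<Q> N *\<^sub>R A (Kinv N1) (A (Kinv N2) (A (Kinv N2) (cls (v $ 1)))) = cls (v $ 1)"
    "\<Q> N *\<^sub>R A (Kinv N1) (A (Kinv N2) (A (Kinv N2) (cls (v $ 2)))) = cls (v $ 2)"
    using chargeK_iff[OF H(1,3), of N] chargeK_iff[OF H(2,4), of N] H by simp_all
  then show ?thesis
    using assms(1,2) H by (simp add: module_iff sigma_half_def forall_2 sum_2 mat_def Cc_simps Q_simps)
qed

lemma spin_memI:
  assumes "v $ 1 \<in> enl q t" "v $ 2 \<in> enl q t" "v $ 3 \<in> enl q t" "SPIN1 N (cls (v $ 1)) (cls (v $ 2)) (cls (v $ 3))"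
  shows "v \<in> module_of q t (sigma1 q N)"
proof -
  note H = SPIN1D[OF assms(4)]
  have "\<Q> N *\<^sub>R A (Kinv N1) (A (Kinv N2) (A (Kinv N2) (cls (v $ 1)))) = cls (v $ 1)"
    "\<Q> N *\<^sub>R A (Kinv N1) (A (Kinv N2) (A (Kinv N2) (cls (v $ 2)))) = cls (v $ 2)"
    "\<Q> N *\<^sub>R A (Kinv N1) (A (Kinv N2) (A (Kinv N2) (cls (v $ 3)))) = cls (v $ 3)"
    using chargeK_iff[OF H(1,4), of N] chargeK_iff[OF H(2), of 0 N] chargeK_iff[OF H(3,6), of N] H by (simp_all add: Q_simps)
  then show ?thesis
    using assms(1-3) H
    by (simp add: module_iff sigma1_def Let_def rt_qnum forall_3 sum_3 mat_def Cc_simps Q_simps mult.commute)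
qed

text \<open>Membership only says that \<open>K_2^2\<close> acts trivially; \<open>K2_fixed\<close>
  removes the remaining sign, as the Leibniz rule for \<open>E_2\<close> and \<open>F_2\<close>
  demands.\<close>

lemma cp2_charged: "x \<in> cp2 q t \<Longrightarrow> x \<in> enl q t \<and> charged 0 (cls x)"
proof -
  assume "x \<in> cp2 q t"
  then have x: "x \<in> enl q t" "LB 0 (cls x)" by (simp_all add: cp2_def line_bundle_iff)
  then show ?thesis
    using K2_fixed[OF x(1) t_sq q_lt] LBD[OF x(2)] by (simp add: charged_def Q_simps)
qed

definition fc1 :: "form1 \<Rightarrow> 2 + 2 \<Rightarrow> calg" where
  "fc1 \<omega> a = (case a of Inl i \<Rightarrow> fst \<omega> $ i | Inr i \<Rightarrow> snd \<omega> $ i)"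

text \<open>\<open>Inl\<close> runs through the component (1,1)_v, while \<open>Inr\<close> 1, 2, 3
  are the types (2,0), (1,1)_s and (0,2). With a single index, equality and linearity of forms are
  treated once for all types.\<close>

definition fc2 :: "form2 \<Rightarrow> 3 + 3 \<Rightarrow> calg" where
  "fc2 \<omega> k = (case \<omega> of (a, v, b, c) \<Rightarrow> case k of Inl i \<Rightarrow> v $ i | Inr i \<Rightarrow> if i = 1 then a else if i = 2 then b else c)"

lemma all_Plus: "(\<forall>x. S x) \<longleftrightarrow> (\<forall>i. S (Inl i)) \<and> (\<forall>i. S (Inr i))"
  by (metis sum.exhaust)

lemma sum_Plus: "sum f (UNIV :: ('a::finite + 'b::finite) set) = (\<Sum>i\<in>UNIV. f (Inl i)) + (\<Sum>i\<in>UNIV. f (Inr i))"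
  unfolding UNIV_Plus_UNIV[symmetric] by (subst sum.Plus) simp_all

lemma eq1_iff: "eq1 q \<omega> \<omega>' \<longleftrightarrow> (\<forall>a. ceq q (fc1 \<omega> a) (fc1 \<omega>' a))"
  by (simp add: eq1_def veq_def all_Plus fc1_def)

lemma eq2_iff: "eq2 q \<omega> \<omega>' \<longleftrightarrow> (\<forall>k. ceq q (fc2 \<omega> k) (fc2 \<omega>' k))"
  by (cases \<omega>; cases \<omega>') (auto simp: eq2_def veq_def all_Plus fc2_def forall_3)

lemma fc1_simps:
  "fc1 (\<omega> + \<omega>') a = fc1 \<omega> a + fc1 \<omega>' a" "fc1 0 a = 0" "fc1 (lmul1 x \<omega>) a = x * fc1 \<omega> a" "fc1 (rmul1 \<omega> x) a = fc1 \<omega> a * x"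
  by (auto simp: fc1_def lmul1_def rmul1_def case_prod_unfold split: sum.split)

lemma fc1_eqI: "(\<And>a. fc1 \<omega> a = fc1 \<omega>' a) \<Longrightarrow> \<omega> = \<omega>'"
  and fc2_eqI: "(\<And>k. fc2 \<tau> k = fc2 \<tau>' k) \<Longrightarrow> \<tau> = \<tau>'"
proof -
  assume *: "\<And>a. fc1 \<omega> a = fc1 \<omega>' a"
  have "fst \<omega> $ i = fst \<omega>' $ i" "snd \<omega> $ i = snd \<omega>' $ i" for i
    using *[of "Inl i"] *[of "Inr i"] by (simp_all add: fc1_def)
  then show "\<omega> = \<omega>'" by (simp add: prod_eq_iff vec_eq_iff)
next
  assume *: "\<And>k. fc2 \<tau> k = fc2 \<tau>' k"
  show "\<tau> = \<tau>'"
    using *[of "Inr 1"] *[of "Inr 2"] *[of "Inr 3"] *[of "Inl _"]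
    by (cases \<tau>; cases \<tau>') (auto simp: fc2_def vec_eq_iff)
qed

lemma fc1_sum: "fc1 (sum f I) a = (\<Sum>i\<in>I. fc1 (f i) a)"
  by (induction I rule: infinite_finite_induct) (simp_all add: fc1_simps)

lemma fc2_simps:
  "fc2 (\<omega> + \<omega>') k = fc2 \<omega> k + fc2 \<omega>' k" "fc2 (\<omega> - \<omega>') k = fc2 \<omega> k - fc2 \<omega>' k" "fc2 (- \<omega>) k = - fc2 \<omega> k" "fc2 0 k = 0"
  "fc2 (lmul2 x \<omega>) k = x * fc2 \<omega> k" "fc2 (rmul2 \<omega> x) k = fc2 \<omega> k * x"
  by (auto simp: fc2_def lmul2_def rmul2_def case_prod_unfold split: sum.split)

lemma fc2_sum: "fc2 (sum f I) k = (\<Sum>i\<in>I. fc2 (f i) k)"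
  by (induction I rule: infinite_finite_induct) (simp_all add: fc2_simps)

definition dc :: "2 + 2 \<Rightarrow> complex" where
  "dc a = (case a of Inl _ \<Rightarrow> \<i> * complex_of_real (q powr (- 3 / 2)) | Inr _ \<Rightarrow> \<i>)"

lemma enl_d0 [simp, intro]: "x \<in> enl q t \<Longrightarrow> fc1 (d0 q x) a \<in> enl q t"
proof -
  assume x: "x \<in> enl q t"
  have "\<forall>a. fc1 (d0 q x) a \<in> enl q t"
    using x by (simp add: all_Plus forall_2 fc1_def d0_def del_def delbar_def vscale_def)
  then show ?thesis by simp
qed

lemma cls_d0: "x \<in> bdd \<Longrightarrow> cls (fc1 (d0 q x) a) = Cc (dc a) * D a (cls x)"
proof -
  assume x: "x \<in> bdd"
  have "\<forall>a. cls (fc1 (d0 q x) a) = Cc (dc a) * D a (cls x)"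
    using x by (simp add: all_Plus forall_2 fc1_def d0_def del_def delbar_def vscale_def dc_def D_def cls_hom Cc_def A_cls)
  then show ?thesis by simp
qed

lemma d0_Omega1: "x \<in> cp2 q t \<Longrightarrow> d0 q x \<in> Omega1 q t 0"
proof -
  assume "x \<in> cp2 q t"
  then have x: "x \<in> enl q t" "LB 0 (cls x)" by (simp_all add: cp2_def line_bundle_iff)
  have "cls (fc1 (d0 q x) a) = Cc (dc a) * D a (cls x)" for a using x by (simp add: cls_d0)
  from this[of "Inl 1"] this[of "Inl 2"] this[of "Inr 1"] this[of "Inr 2"] show ?thesis
    using enl_d0[OF x(1), of "Inl 1"] enl_d0[OF x(1), of "Inl 2"] enl_d0[OF x(1), of "Inr 1"] enl_d0[OF x(1), of "Inr 2"]
      HALF_Cc[OF LB_HALF_E[OF x(2)], of "dc (Inl 1)"] HALF_Cc[OF LB_HALF_F[OF x(2)], of "dc (Inr 1)"]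
    unfolding Omega1_def mem_Times_iff by (auto simp: fc1_def D_def dc_def intro!: half_memI)
qed

lemma Omega1I:
  assumes "\<And>a. fc1 \<omega> a \<in> enl q t" "HALF (N - 3/2) (cls (fc1 \<omega> (Inl 1))) (cls (fc1 \<omega> (Inl 2)))"
    "HALF (N + 3/2) (cls (fc1 \<omega> (Inr 1))) (cls (fc1 \<omega> (Inr 2)))"
  shows "\<omega> \<in> Omega1 q t N"
  using assms assms(1)[of "Inl 1"] assms(1)[of "Inl 2"] assms(1)[of "Inr 1"] assms(1)[of "Inr 2"]
  unfolding Omega1_def mem_Times_iff by (auto simp: fc1_def intro!: half_memI)

lemma Omega2I:
  assumes "\<And>k. fc2 \<omega> k \<in> enl q t" "SPIN1 N (cls (fc2 \<omega> (Inl 1))) (cls (fc2 \<omega> (Inl 2))) (cls (fc2 \<omega> (Inl 3)))"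
    "LB (N - 3) (cls (fc2 \<omega> (Inr 1)))" "LB N (cls (fc2 \<omega> (Inr 2)))" "LB (N + 3) (cls (fc2 \<omega> (Inr 3)))"
  shows "\<omega> \<in> Omega2 q t N"
proof -
  obtain a v b c where w: "\<omega> = (a, v, b, c)" by (cases \<omega>)
  have "v $ 1 \<in> enl q t" "v $ 2 \<in> enl q t" "v $ 3 \<in> enl q t" "a \<in> enl q t" "b \<in> enl q t" "c \<in> enl q t"
    using assms(1)[of "Inl 1"] assms(1)[of "Inl 2"] assms(1)[of "Inl 3"] assms(1)[of "Inr 1"] assms(1)[of "Inr 2"] assms(1)[of "Inr 3"]
    by (simp_all add: w fc2_def)
  with assms(2-5) show ?thesis
    by (auto simp: w fc2_def Omega2_def line_bundle_iff intro!: spin_memI)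
qed


section \<open>The wedge product in components\<close>

definition m0 :: "2 \<Rightarrow> 2 \<Rightarrow> real" where
  "m0 i j = (if i = 1 \<and> j = 2 then \<Q> (1/2) / rt else if i = 2 \<and> j = 1 then - \<Q> (- 1/2) / rt else 0)"

definition m1 :: "3 \<Rightarrow> 2 \<Rightarrow> 2 \<Rightarrow> real" where
  "m1 n i j = (if n = 1 then of_bool (i = 1 \<and> j = 1) else if n = 3 then of_bool (i = 2 \<and> j = 2)
     else if i = 1 \<and> j = 2 then \<Q> (- 1/2) / rt else if i = 2 \<and> j = 1 then \<Q> (1/2) / rt else 0)"

lemma enl_mu0 [simp, intro]: "(\<And>i. v $ i \<in> enl q t) \<Longrightarrow> (\<And>i. w $ i \<in> enl q t) \<Longrightarrow> mu0 q v w \<in> enl q t"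
  by (simp add: mu0_def)

lemma enl_mu1 [simp, intro]: "(\<And>i. v $ i \<in> enl q t) \<Longrightarrow> (\<And>i. w $ i \<in> enl q t) \<Longrightarrow> mu1 q v w $ n \<in> enl q t"
  using exhaust_3[of n] by (auto simp: mu1_def)

lemma cls_mu0: "(\<And>i. v $ i \<in> enl q t) \<Longrightarrow> (\<And>i. w $ i \<in> enl q t) \<Longrightarrow>
    cls (mu0 q v w) = (\<Sum>i\<in>UNIV. \<Sum>j\<in>UNIV. m0 i j *\<^sub>R (cls (v $ i) * cls (w $ j)))"
proof -
  assume [simp]: "\<And>i. v $ i \<in> enl q t" "\<And>i. w $ i \<in> enl q t"
  have "q powr (1/2) = \<Q> (1/2)" "q powr (- 1/2) = \<Q> (- 1/2)" by (simp_all add: quo.Q_def)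
  note Q = this
  show ?thesis
    unfolding mu0_def rt_qnum Q
    by (simp add: sum_2 m0_def mult.assoc cls_rsc cls_hom cls_rsc_only scaleR_right_diff_distrib)
qed

lemma cls_mu1: "(\<And>i. v $ i \<in> enl q t) \<Longrightarrow> (\<And>i. w $ i \<in> enl q t) \<Longrightarrow>
    cls (mu1 q v w $ n) = (\<Sum>i\<in>UNIV. \<Sum>j\<in>UNIV. m1 n i j *\<^sub>R (cls (v $ i) * cls (w $ j)))"
proof -
  assume [simp]: "\<And>i. v $ i \<in> enl q t" "\<And>i. w $ i \<in> enl q t"
  have "q powr (1/2) = \<Q> (1/2)" "q powr (- 1/2) = \<Q> (- 1/2)" by (simp_all add: quo.Q_def)
  note Q = this
  show ?thesis
    using exhaust_3[of n] unfolding mu1_def rt_qnum Q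
    by (auto simp: sum_2 m1_def mult.assoc cls_rsc cls_hom cls_rsc_only scaleR_right_distrib)
qed

end

locale wedge_forms = forms +
  fixes s c0 c1 c2 :: real
begin

text \<open>The structure constants of the product of forms. In the (1,1)_v part they vanish unless
  the two one-forms have different types.\<close>

definition gam :: "3 + 3 \<Rightarrow> 2 + 2 \<Rightarrow> 2 + 2 \<Rightarrow> real" where
  "gam k a b = (case k of
     Inr n \<Rightarrow> if n = 1 then (case a of Inl i \<Rightarrow> (case b of Inl j \<Rightarrow> c0 * m0 i j | Inr j \<Rightarrow> 0) | Inr i \<Rightarrow> 0)
       else if n = 2 then (case a of Inl i \<Rightarrow> (case b of Inl j \<Rightarrow> 0 | Inr j \<Rightarrow> q powr (- 3 / 2 * s) * c2 * m0 i j)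
          | Inr i \<Rightarrow> (case b of Inl j \<Rightarrow> c2 * m0 i j | Inr j \<Rightarrow> 0))
       else (case a of Inl i \<Rightarrow> 0 | Inr i \<Rightarrow> (case b of Inl j \<Rightarrow> 0 | Inr j \<Rightarrow> c0 * m0 i j))
   | Inl n \<Rightarrow> (case a of Inl i \<Rightarrow> (case b of Inl j \<Rightarrow> 0 | Inr j \<Rightarrow> - (q powr (s / 2)) * c1 * m1 n i j)
          | Inr i \<Rightarrow> (case b of Inl j \<Rightarrow> c1 * m1 n i j | Inr j \<Rightarrow> 0)))"

definition w2 :: "3 + 3 \<Rightarrow> (2 + 2 \<Rightarrow> quot) \<Rightarrow> (2 + 2 \<Rightarrow> quot) \<Rightarrow> quot" where
  "w2 k X Y = (\<Sum>a\<in>UNIV. \<Sum>b\<in>UNIV. gam k a b *\<^sub>R (X a * Y b))"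

abbreviation "wdg \<equiv> wedge q s c0 c1 c2"

lemma enl_wedge [simp, intro]:
  assumes "\<And>a. fc1 \<omega> a \<in> enl q t" "\<And>a. fc1 \<omega>' a \<in> enl q t"
  shows "fc2 (wdg \<omega> \<omega>') k \<in> enl q t"
proof -
  have "fst \<omega> $ i \<in> enl q t" "snd \<omega> $ i \<in> enl q t" "fst \<omega>' $ i \<in> enl q t" "snd \<omega>' $ i \<in> enl q t" for i
    using assms(1)[of "Inl i"] assms(1)[of "Inr i"] assms(2)[of "Inl i"] assms(2)[of "Inr i"] by (simp_all add: fc1_def)
  then have "\<forall>k. fc2 (wdg \<omega> \<omega>') k \<in> enl q t"
    by (simp add: all_Plus fc2_def wedge_def case_prod_unfold vscale_def)
  then show ?thesis by simp
qed

lemma cls_wedge: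
  assumes "\<And>a. fc1 \<omega> a \<in> enl q t" "\<And>a. fc1 \<omega>' a \<in> enl q t"
  shows "cls (fc2 (wdg \<omega> \<omega>') k) = w2 k (\<lambda>a. cls (fc1 \<omega> a)) (\<lambda>a. cls (fc1 \<omega>' a))"
proof -
  have m: "fst \<omega> $ i \<in> enl q t" "snd \<omega> $ i \<in> enl q t" "fst \<omega>' $ i \<in> enl q t" "snd \<omega>' $ i \<in> enl q t" for i
    using assms(1)[of "Inl i"] assms(1)[of "Inr i"] assms(2)[of "Inl i"] assms(2)[of "Inr i"] by (simp_all add: fc1_def)
  have csc: "csc (complex_of_real r) = rsc r" for r by (simp add: csc_def rsc_def rscal_def)
  have csc': "csc (- (complex_of_real r * complex_of_real r')) = rsc (- (r * r'))" for r r'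
    using csc[of "- (r * r')"] by simp
  have "\<forall>k. cls (fc2 (wdg \<omega> \<omega>') k) = w2 k (\<lambda>a. cls (fc1 \<omega> a)) (\<lambda>a. cls (fc1 \<omega>' a))"
    unfolding all_Plus
  proof (intro conjI allI)
    fix n :: 3
    show "cls (fc2 (wdg \<omega> \<omega>') (Inl n)) = w2 (Inl n) (\<lambda>a. cls (fc1 \<omega> a)) (\<lambda>a. cls (fc1 \<omega>' a))"
      using m by (simp add: w2_def sum_Plus gam_def fc2_def fc1_def wedge_def case_prod_unfold vscale_def csc csc'
          cls_hom cls_rsc_only cls_mu1 scaleR_sum_right sum_negf add.commute)
    show "cls (fc2 (wdg \<omega> \<omega>') (Inr n)) = w2 (Inr n) (\<lambda>a. cls (fc1 \<omega> a)) (\<lambda>a. cls (fc1 \<omega>' a))"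
      using m exhaust_3[of n] by (auto simp: w2_def sum_Plus gam_def fc2_def fc1_def wedge_def case_prod_unfold
          cls_hom cls_rsc_only cls_mu0 scaleR_sum_right add.commute)
  qed
  then show ?thesis by simp
qed

lemma w2_sum_left: "w2 k (\<lambda>a. \<Sum>i\<in>I. X i a) Y = (\<Sum>i\<in>I. w2 k (X i) Y)"
proof -
  have "w2 k (\<lambda>a. \<Sum>i\<in>I. X i a) Y = (\<Sum>a\<in>UNIV. \<Sum>i\<in>I. \<Sum>b\<in>UNIV. gam k a b *\<^sub>R (X i a * Y b))"
    by (simp add: w2_def sum_distrib_right scaleR_sum_right) (intro sum.cong[OF refl] sum.swap)
  also have "\<dots> = (\<Sum>i\<in>I. w2 k (X i) Y)" unfolding w2_def by (rule sum.swap)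
  finally show ?thesis .
qed

lemma w2_sum_right: "w2 k X (\<lambda>b. \<Sum>i\<in>I. Y i b) = (\<Sum>i\<in>I. w2 k X (Y i))"
proof -
  have "w2 k X (\<lambda>a. \<Sum>i\<in>I. Y i a) = (\<Sum>a\<in>UNIV. \<Sum>i\<in>I. \<Sum>b\<in>UNIV. gam k a b *\<^sub>R (X a * Y i b))"
    by (simp add: w2_def sum_distrib_left scaleR_sum_right) (intro sum.cong[OF refl] sum.swap)
  also have "\<dots> = (\<Sum>i\<in>I. w2 k X (Y i))" unfolding w2_def by (rule sum.swap)
  finally show ?thesis .
qed

lemma w2_simps:
  "w2 k (\<lambda>a. x * X a) Y = x * w2 k X Y" "w2 k X (\<lambda>b. Y b * x) = w2 k X Y * x"
  "w2 k X (\<lambda>b. x * Y b) = w2 k (\<lambda>a. X a * x) Y" "w2 k X (\<lambda>b. Y b + Y' b) = w2 k X Y + w2 k X Y'"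
  "w2 k (\<lambda>a. 0) Y = 0"
  by (simp_all add: w2_def sum_distrib_left sum_distrib_right mult.assoc distrib_left scaleR_right_distrib sum.distrib)

definition O2 :: "real \<Rightarrow> (3 + 3 \<Rightarrow> quot) \<Rightarrow> bool" where
  "O2 N f \<longleftrightarrow> SPIN1 N (f (Inl 1)) (f (Inl 2)) (f (Inl 3)) \<and> LB (N - 3) (f (Inr 1)) \<and> LB N (f (Inr 2)) \<and> LB (N + 3) (f (Inr 3))"

lemma O2_sum: "(\<And>i. i \<in> I \<Longrightarrow> O2 N (f i)) \<Longrightarrow> O2 N (\<lambda>k. \<Sum>i\<in>I. f i k)"
  unfolding O2_def by (intro conjI SPIN1_sum LB_sum) blast+

lemma O2_mult: "LB M x \<Longrightarrow> O2 N f \<Longrightarrow> O2 (M + N) (\<lambda>k. x * f k)"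
  and O2_mult': "O2 N f \<Longrightarrow> LB M x \<Longrightarrow> O2 (N + M) (\<lambda>k. f k * x)"
proof -
  assume "LB M x" "O2 N f"
  then show "O2 (M + N) (\<lambda>k. x * f k)"
    unfolding O2_def using LB_mult[of M x "N - 3" "f (Inr 1)"] LB_mult[of M x N "f (Inr 2)"] LB_mult[of M x "N + 3" "f (Inr 3)"]
    by (simp add: SPIN1_mult add_diff_eq add.assoc)
next
  assume "O2 N f" "LB M x"
  then show "O2 (N + M) (\<lambda>k. f k * x)"
    unfolding O2_def using LB_mult[of "N - 3" "f (Inr 1)" M x] LB_mult[of N "f (Inr 2)" M x] LB_mult[of "N + 3" "f (Inr 3)" M x]
    by (simp add: SPIN1_mult' diff_add_eq add.assoc add.commute[of 3 M])
qed

lemma O2_w2: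
  assumes X: "HALF (- 3/2) (X (Inl 1)) (X (Inl 2))" "HALF (3/2) (X (Inr 1)) (X (Inr 2))"
    and Y: "HALF (- 3/2) (Y (Inl 1)) (Y (Inl 2))" "HALF (3/2) (Y (Inr 1)) (Y (Inr 2))"
  shows "O2 0 (\<lambda>k. w2 k X Y)"
proof -
  let ?M = "\<lambda>i j. \<Q> (1/2) *\<^sub>R (X (i 1) * Y (j 2)) - \<Q> (- 1/2) *\<^sub>R (X (i 2) * Y (j 1))"
  let ?N = "\<lambda>i j. (1 / rt) *\<^sub>R (\<Q> (- 1/2) *\<^sub>R (X (i 1) * Y (j 2)) + \<Q> (1/2) *\<^sub>R (X (i 2) * Y (j 1)))"
  have "w2 (Inr 1) X Y = (c0 / rt) *\<^sub>R ?M Inl Inl" "w2 (Inr 3) X Y = (c0 / rt) *\<^sub>R ?M Inr Inr"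
    "w2 (Inr 2) X Y = (c2 / rt) *\<^sub>R ?M Inr Inl + (q powr (- 3 / 2 * s) * c2 / rt) *\<^sub>R ?M Inl Inr"
    "w2 (Inl 1) X Y = c1 *\<^sub>R (X (Inr 1) * Y (Inl 1)) + (- (q powr (s / 2)) * c1) *\<^sub>R (X (Inl 1) * Y (Inr 1))"
    "w2 (Inl 2) X Y = c1 *\<^sub>R ?N Inr Inl + (- (q powr (s / 2)) * c1) *\<^sub>R ?N Inl Inr"
    "w2 (Inl 3) X Y = c1 *\<^sub>R (X (Inr 2) * Y (Inl 2)) + (- (q powr (s / 2)) * c1) *\<^sub>R (X (Inl 2) * Y (Inr 2))"
    by (simp_all add: w2_def sum_Plus sum_2 gam_def m0_def m1_def scaleR_right_diff_distrib scaleR_right_distrib algebra_simps)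
  note e = this
  have "SPIN1 0 (w2 (Inl 1) X Y) (w2 (Inl 2) X Y) (w2 (Inl 3) X Y)"
    unfolding e using SPIN1_mu1[OF X(2) Y(1)] SPIN1_mu1[OF X(1) Y(2)]
    by (intro SPIN1_add SPIN1_scaleR) simp_all
  moreover have "LB (- 3) (w2 (Inr 1) X Y)" "LB 0 (w2 (Inr 2) X Y)" "LB 3 (w2 (Inr 3) X Y)"
    unfolding e using LB_mu0[OF X(1) Y(1)] LB_mu0[OF X(2) Y(1)] LB_mu0[OF X(1) Y(2)] LB_mu0[OF X(2) Y(2)]
    by (auto intro!: LB_add LB_scaleR)
  ultimately show ?thesis by (simp add: O2_def)
qed

end

section \<open>The connection\<close>

context suq_lt
begin

lemma act_N1_p11_power: "act q (E N1) (p11 ^ k) = 0" "act q (F N1) (p11 ^ k) = 0"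
proof -
  have "act q (E N1) p11 = 0" "act q (F N1) p11 = 0"
    by (simp_all add: p11_def z_def act_mult act_gen lact_qs[OF q_pos])
  then show "act q (E N1) (p11 ^ k) = 0" "act q (F N1) (p11 ^ k) = 0"
    by (induction k) (simp_all add: act_mult act_1 act_p11_power)
qed

definition B :: "real \<Rightarrow> quot" where "B c = cls (binser c (- 1 / 2))"

lemma charged_B:
  assumes "0 \<le> c" "c < 1"
  shows "charged 0 (B c)"
proof -
  have "cact q (E N1) (binser c (- 1/2)) = 0" "cact q (F N1) (binser c (- 1/2)) = 0"
    by (simp_all add: cact_def binser_def fun_eq_iff act_sum act_rscal_mult act_N1_p11_power)
  then show ?thesis
    using binser_bdd[of "- 1/2" c] assms by (simp add: charged_def B_def A_cls cact_binser cls_hom Q_simps)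
qed

lemma B_inverse:
  assumes "0 \<le> c" "c < 1"
  shows "(e - c *\<^sub>R p) * (B c * B c) = e" "B c * B c * (e - c *\<^sub>R p) = e" "B c * (e - c *\<^sub>R p) * B c = e"
proof -
  \<comment> \<open>The root of \<open>1 - c p\<close> itself: sums of two exponents from 1/2 and
    -1/2, not both negative, stay in the range where \<open>m\<close> applies and evaluate to 1 or
    0.\<close>
  define T where "T = cls (binser c (1/2))"
  have m: "cls (binser c r) * cls (binser c r') = cls (binser c (r + r'))" if "\<bar>r\<bar> \<le> 1" "\<bar>r'\<bar> \<le> 1" "\<bar>r + r'\<bar> \<le> 1" for r r'
    using binser_mult[OF that assms] binser_bdd[OF _ assms] that by (simp add: cls_eq_null flip: cls_hom)
  have p: "cls (emb p11) = p" by (simp add: cls_emb p11_def z_def p_def u_def us_def quo.P_hom)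
  have "cls (binser c 1) = cls (1 - rsc c * emb p11)"
    using binser_1[OF assms] binser_bdd[OF _ assms] by (simp add: cls_eq_null)
  also have "\<dots> = e - c *\<^sub>R p" by (simp add: cls_hom(2) cls_rsc p)
  finally have TT: "T * T = e - c *\<^sub>R p" using m[of "1/2" "1/2"] by (simp add: T_def)
  have BT: "B c * T = e" "T * B c = e" using m[of "- 1/2" "1/2"] m[of "1/2" "- 1/2"] by (simp_all add: B_def T_def binser_0)
  have R: "B c \<in> R" "T \<in> R" using binser_bdd[OF _ assms] by (simp_all add: B_def T_def)
  have "T * T * (B c * B c) = T * (T * B c) * B c" "B c * B c * (T * T) = B c * (B c * T) * T"
    "B c * (T * T) * B c = (B c * T) * (T * B c)"
    by (simp_all only: mult.assoc)
  with R show "(e - c *\<^sub>R p) * (B c * B c) = e" "B c * B c * (e - c *\<^sub>R p) = e" "B c * (e - c *\<^sub>R p) * B c = e"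
    unfolding TT[symmetric] by (simp_all add: BT)
qed

text \<open>Neither sequence is assumed bounded: a difference whose derivatives all tend to zero in
  norm is bounded by itself. This covers the values of an arbitrary differential on one-forms, which
  are known only up to congruence.\<close>

lemma ceq_null: "ceq q x y \<longleftrightarrow> x - y \<in> null"
proof
  assume *: "ceq q x y"
  have "\<exists>C. \<forall>n. cnorm q (acts q hs ((x - y) n)) \<le> C" for hs
  proof -
    have "convergent (\<lambda>n. cnorm q (acts q hs (x n - y n)))"
      using * by (auto simp: ceq_def convergent_def)
    then have "Bseq (\<lambda>n. cnorm q (acts q hs (x n - y n)))" by (rule convergent_imp_Bseq)
    then obtain C where "\<forall>n. norm (cnorm q (acts q hs (x n - y n))) \<le> C" unfolding Bseq_def by blast
    then have "\<forall>n. cnorm q (acts q hs (x n - y n)) \<le> C" by (auto simp: abs_le_iff)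
    then show ?thesis by (auto simp: fun_diff_def)
  qed
  then have "x - y \<in> bdd" unfolding bdd_def by blast
  with * show "x - y \<in> null" by (simp add: null_def ceq_def fun_diff_def)
qed (simp add: null_def ceq_def fun_diff_def)

end

context forms
begin

lemma eq2_trans: "eq2 q \<omega> \<omega>' \<Longrightarrow> eq2 q \<omega>' \<omega>'' \<Longrightarrow> eq2 q \<omega> \<omega>''"
  unfolding eq2_iff ceq_null
proof
  fix k
  assume "\<forall>k. fc2 \<omega> k - fc2 \<omega>' k \<in> null" "\<forall>k. fc2 \<omega>' k - fc2 \<omega>'' k \<in> null"
  then have "(fc2 \<omega> k - fc2 \<omega>' k) + (fc2 \<omega>' k - fc2 \<omega>'' k) \<in> null" by (intro null_add) blast+
  then show "fc2 \<omega> k - fc2 \<omega>'' k \<in> null" by (simp only: diff_add_cancel add_diff_eq)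
qed

lemma eq2_refl: "eq2 q \<omega> \<omega>"
  by (simp add: eq2_iff ceq_null null_0)

lemma eq2_add: "eq2 q \<omega> \<omega>' \<Longrightarrow> eq2 q \<tau> \<tau>' \<Longrightarrow> eq2 q (\<omega> + \<tau>) (\<omega>' + \<tau>')"
  unfolding eq2_iff ceq_null fc2_simps add_diff_add by (simp add: null_add)

lemma eq2_sum: "(\<And>i. i \<in> I \<Longrightarrow> eq2 q (f i) (g i)) \<Longrightarrow> eq2 q (sum f I) (sum g I)"
  by (induction I rule: infinite_finite_induct) (simp_all add: eq2_refl eq2_add)

lemma eq2_lmul2: "x \<in> bdd \<Longrightarrow> eq2 q \<omega> \<omega>' \<Longrightarrow> eq2 q (lmul2 x \<omega>) (lmul2 x \<omega>')"
  unfolding eq2_iff ceq_null fc2_simps right_diff_distrib[symmetric] by (simp add: null_mult)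

lemma HALF_d0:
  assumes "x \<in> cp2 q t"
  shows "HALF (- 3/2) (cls (fc1 (d0 q x) (Inl 1))) (cls (fc1 (d0 q x) (Inl 2)))"
    and "HALF (3/2) (cls (fc1 (d0 q x) (Inr 1))) (cls (fc1 (d0 q x) (Inr 2)))"
proof -
  have x: "x \<in> enl q t" "LB 0 (cls x)" using assms by (simp_all add: cp2_def line_bundle_iff)
  show "HALF (- 3/2) (cls (fc1 (d0 q x) (Inl 1))) (cls (fc1 (d0 q x) (Inl 2)))"
    "HALF (3/2) (cls (fc1 (d0 q x) (Inr 1))) (cls (fc1 (d0 q x) (Inr 2)))"
    using x(1) HALF_Cc[OF LB_HALF_E[OF x(2)], of "dc (Inl 1)"] HALF_Cc[OF LB_HALF_F[OF x(2)], of "dc (Inr 1)"]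
    by (simp_all add: cls_d0 D_def dc_def)
qed

end

locale connection = wedge_forms +
  fixes \<theta> :: real
  assumes t_eq: "t = sin (2 * \<theta>)"
begin

definition cst :: "2 \<Rightarrow> real" where "cst j = (if j = 1 then t\<^sup>2 else t\<^sup>2 * q ^ 4)"

lemma coeff: "0 \<le> t\<^sup>2 * q ^ k" "t\<^sup>2 * q ^ k < 1"
proof -
  show "0 \<le> t\<^sup>2 * q ^ k" using q_pos by simp
  have "t\<^sup>2 * q ^ k \<le> t\<^sup>2 * 1"
    using q_pos q_lt by (intro mult_left_mono power_le_one) simp_all
  then show "t\<^sup>2 * q ^ k < 1" using t_sq by simp
qed

lemma cst: "0 \<le> cst j" "cst j < 1"
  using coeff[of 0] coeff[of 4] by (simp_all add: cst_def)

lemma R_B: "0 \<le> c \<Longrightarrow> c < 1 \<Longrightarrow> B c \<in> R"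
  using charged_B chargedD(1) by blast

sublocale instanton q t \<theta> "B (t\<^sup>2) * B (t\<^sup>2)" "B (t\<^sup>2 * q ^ 4) * B (t\<^sup>2 * q ^ 4)" "B (t\<^sup>2 * q\<^sup>2) * B (t\<^sup>2 * q\<^sup>2)"
  using t_eq t_sq coeff[of 4] coeff[of 2] by unfold_locales (simp_all add: B_inverse R_B)

abbreviation "\<Psi> \<equiv> Psi q t \<theta>"

definition BB :: "2 \<Rightarrow> quot" where "BB j = B (cst j)"

lemma BB: "charged 0 (BB j)" "BB j \<in> R" "BB j * N j * BB j = e" "BB j * BB j = M j"
  using cst[of j] charged_B[of "cst j"] B_inverse(3)[of "cst j"] R_B[of "cst j"]
  by (cases "j = 1"; simp add: BB_def N_def M_def cst_def)+

lemma cstar_mult: "cstar (x * y) = cstar y * cstar x"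
  by (simp add: cstar_def fun_eq_iff times_fun_apply fstar_mult)

lemma cls_scaled: "cls (rsc c * emb a) = c *\<^sub>R quo.P a" "cls (cstar (rsc c * emb a)) = c *\<^sub>R quo.P (fstar a)"
proof -
  have "cstar (rsc c) = rsc c" "cstar (emb a) = emb (fstar a)" by (simp_all add: cstar_def rsc_def emb_def)
  then show "cls (rsc c * emb a) = c *\<^sub>R quo.P a" "cls (cstar (rsc c * emb a)) = c *\<^sub>R quo.P (fstar a)"
    by (simp_all add: cstar_mult cls_rsc cls_emb flip: rsc_comm)
qed

lemma cls_psi: "psi \<theta> $ k \<in> enl q t \<and> cls (psi \<theta> $ k) = psiv \<theta> (us I3) k \<and> cls (cstar (psi \<theta> $ k)) = psiv \<theta> (u I3) k"
  and cls_phi: "phi q \<theta> $ k \<in> enl q t \<and> cls (phi q \<theta> $ k) = phiv q \<theta> (u I3) k \<and> cls (cstar (phi q \<theta> $ k)) = phiv q \<theta> (us I3) k"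
proof -
  have c: "cstar 0 = 0" by (simp add: cstar_def fun_eq_iff)
  note s = psi_def phi_def psiv_def phiv_def cls_scaled z_def u_def us_def cls_hom c
  show "psi \<theta> $ k \<in> enl q t \<and> cls (psi \<theta> $ k) = psiv \<theta> (us I3) k \<and> cls (cstar (psi \<theta> $ k)) = psiv \<theta> (u I3) k"
    "phi q \<theta> $ k \<in> enl q t \<and> cls (phi q \<theta> $ k) = phiv q \<theta> (u I3) k \<and> cls (cstar (phi q \<theta> $ k)) = phiv q \<theta> (us I3) k"
    using exhaust_6[of k] by (auto simp: s)
qed

definition VB :: "6 \<Rightarrow> 2 \<Rightarrow> quot" where "VB k j = V j k * BB j"

definition BW :: "2 \<Rightarrow> 6 \<Rightarrow> quot" where "BW j k = BB j * W j k"

lemma Psi [simp]: "\<Psi> $ k $ j \<in> enl q t" "cls (\<Psi> $ k $ j) = VB k j"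
  and dagger [simp]: "dagger \<Psi> $ j $ k \<in> enl q t" "cls (dagger \<Psi> $ j $ k) = BW j k"
proof -
  have b: "binser (t\<^sup>2) (- 1/2) \<in> enl q t" "binser (t\<^sup>2 * q ^ 4) (- 1/2) \<in> enl q t"
    using enl.intros(3)[of t q 0] enl.intros(3)[of t q 4] by simp_all
  note s = cls_psi cls_phi Psi_def dagger_def VB_def BW_def V_def W_def BB_def B_def cst_def cls_hom cstar_mult cstar_binser
  show "\<Psi> $ k $ j \<in> enl q t" "cls (\<Psi> $ k $ j) = VB k j" "dagger \<Psi> $ j $ k \<in> enl q t" "cls (dagger \<Psi> $ j $ k) = BW j k"
    using exhaust_2[of j] b by (auto simp: s)
qed

lemma VB_BW: "(\<Sum>j\<in>UNIV. VB k j * BW j m) = PP k m" for m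
  by (simp add: PP_def VB_def BW_def mult.assoc flip: BB(4))

lemma BW_VB: "(\<Sum>k\<in>UNIV. BW i k * VB k j) = (if i = j then e else 0)"
proof -
  have "(\<Sum>k\<in>UNIV. BW i k * VB k j) = BB i * (\<Sum>k\<in>UNIV. W i k * V j k) * BB j"
    by (simp add: VB_def BW_def mult.assoc sum_distrib_left sum_distrib_right)
  then show ?thesis by (simp add: W_V BB)
qed

lemma BW_PP: "(\<Sum>k\<in>UNIV. BW i k * PP k m) = BW i m" for m
proof -
  have "(\<Sum>k\<in>UNIV. BW i k * PP k m) = BB i * (\<Sum>k\<in>UNIV. W i k * PP k m)"
    by (simp add: BW_def mult.assoc sum_distrib_left)
  then show ?thesis by (simp add: W_PP BW_def)
qed

lemma PP_VB: "(\<Sum>l\<in>UNIV. PP m l * VB l j) = VB m j" for m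
proof -
  have "(\<Sum>l\<in>UNIV. PP m l * VB l j) = (\<Sum>l\<in>UNIV. PP m l * V j l) * BB j"
    by (simp add: VB_def mult.assoc sum_distrib_right)
  then show ?thesis by (simp add: PP_V VB_def)
qed

lemma charges: "charges $ j = 2 * chg j"
  using exhaust_2[of j] by (auto simp: charges_def chg_def)

lemma charged_VB: "charged (- chg j) (VB k j)" "charged (chg j) (BW j k)"
  using charged_mult[OF charged_VW(2)[of j k] BB(1)[of j]] charged_mult[OF BB(1)[of j] charged_VW(1)[of j k]]
  by (simp_all add: VB_def BW_def)

lemma LB_VB: "LB (- (charges $ j)) (VB k j)" "LB (charges $ j) (BW j k)"
  using charged_LB[OF charged_VB(1)[where j = j and k = k]] charged_LB[OF charged_VB(2)[where j = j and k = k]]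
  by (simp_all add: charges)

lemma charged_PP: "charged 0 (PP k m)" for m
  unfolding VB_BW[symmetric] using charged_mult[OF charged_VB] by (intro charged_sum) (metis add.left_inverse)

lemma Pmat: "Pmat q t \<theta> $ k $ m \<in> cp2 q t" "cls (Pmat q t \<theta> $ k $ m) = PP k m" for m
proof -
  show *: "cls (Pmat q t \<theta> $ k $ m) = PP k m"
    by (simp add: Pmat_def matrix_matrix_mult_def cls_sum cls_hom VB_BW)
  have "Pmat q t \<theta> $ k $ m \<in> enl q t" by (simp add: Pmat_def matrix_matrix_mult_def)
  then show "Pmat q t \<theta> $ k $ m \<in> cp2 q t"
    using charged_LB[OF charged_PP, of k m] by (simp add: cp2_def line_bundle_iff *)
qed

lemma Pmat_enl [simp]: "Pmat q t \<theta> $ k $ m \<in> enl q t" for m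
  using Pmat(1) cp2_charged by blast

definition \<delta>P :: "6 \<Rightarrow> 6 \<Rightarrow> 2 + 2 \<Rightarrow> quot" where "\<delta>P k l a = Cc (dc a) * D a (PP k l)"

lemma cls_d0_Pmat: "cls (fc1 (d0 q (Pmat q t \<theta> $ k $ m)) a) = \<delta>P k m a" for m
  by (simp add: cls_d0 Pmat \<delta>P_def)

lemma LL_D:
  assumes "\<eta> \<in> LL q t"
  shows "\<eta> $ j \<in> enl q t" "LB (charges $ j) (cls (\<eta> $ j))"
  using assms by (simp_all add: LL_def line_bundle_iff)

definition sec :: "calg ^ 2 \<Rightarrow> 6 \<Rightarrow> quot" where "sec \<eta> k = (\<Sum>j\<in>UNIV. VB k j * cls (\<eta> $ j))"

lemma Psi_v:
  assumes "\<eta> \<in> LL q t"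
  shows "(\<Psi> *v \<eta>) $ k \<in> cp2 q t" "(\<Psi> *v \<eta>) $ k \<in> enl q t" "cls ((\<Psi> *v \<eta>) $ k) = sec \<eta> k" "charged 0 (sec \<eta> k)" "sec \<eta> k \<in> R"
proof -
  note \<eta> = LL_D[OF assms]
  show 1: "(\<Psi> *v \<eta>) $ k \<in> enl q t" "cls ((\<Psi> *v \<eta>) $ k) = sec \<eta> k"
    using \<eta> by (simp_all add: matrix_vector_mult_def sec_def cls_sum cls_hom)
  have "LB 0 (sec \<eta> k)"
    unfolding sec_def using LB_mult[OF LB_VB(1) \<eta>(2)] by (intro LB_sum) (metis add.left_inverse)
  with 1 show 2: "(\<Psi> *v \<eta>) $ k \<in> cp2 q t" by (simp add: cp2_def line_bundle_iff)
  \<comment> \<open>The charge of \<eta> fixes only \<open>K_2^2\<close>, so the weight for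
    \<open>K_2\<close> is obtained from positivity on the product instead of factor by
    factor.\<close>
  show "charged 0 (sec \<eta> k)" using cp2_charged[OF 2] by (simp add: 1)
  then show "sec \<eta> k \<in> R" by (rule chargedD)
qed

lemma BW_sec: "\<eta> \<in> LL q t \<Longrightarrow> (\<Sum>k\<in>UNIV. BW i k * sec \<eta> k) = cls (\<eta> $ i)"
proof -
  assume \<eta>: "\<eta> \<in> LL q t"
  have "(\<Sum>k\<in>UNIV. BW i k * sec \<eta> k) = (\<Sum>k\<in>UNIV. \<Sum>j\<in>UNIV. BW i k * VB k j * cls (\<eta> $ j))"
    by (simp add: sec_def sum_distrib_left mult.assoc)
  also have "\<dots> = (\<Sum>j\<in>UNIV. (\<Sum>k\<in>UNIV. BW i k * VB k j) * cls (\<eta> $ j))"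
    by (subst sum.swap) (simp add: sum_distrib_right)
  also have "\<dots> = (\<Sum>j\<in>UNIV. if i = j then cls (\<eta> $ j) else 0)"
    using LL_D[OF \<eta>] by (intro sum.cong) (simp_all add: BW_VB)
  finally show ?thesis by simp
qed

lemma PP_sec: "(\<Sum>l\<in>UNIV. PP m l * sec \<eta> l) = sec \<eta> m" for m
proof -
  have "(\<Sum>l\<in>UNIV. PP m l * sec \<eta> l) = (\<Sum>l\<in>UNIV. \<Sum>j\<in>UNIV. PP m l * VB l j * cls (\<eta> $ j))"
    by (simp add: sec_def sum_distrib_left mult.assoc)
  also have "\<dots> = (\<Sum>j\<in>UNIV. (\<Sum>l\<in>UNIV. PP m l * VB l j) * cls (\<eta> $ j))"
    by (subst sum.swap) (simp add: sum_distrib_right)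
  finally show ?thesis by (simp add: PP_VB sec_def)
qed

definition \<delta>s :: "calg ^ 2 \<Rightarrow> 6 \<Rightarrow> 2 + 2 \<Rightarrow> quot" where "\<delta>s \<eta> k a = Cc (dc a) * D a (sec \<eta> k)"

lemma cls_d0_sec: "\<eta> \<in> LL q t \<Longrightarrow> cls (fc1 (d0 q ((\<Psi> *v \<eta>) $ k)) a) = \<delta>s \<eta> k a"
  by (simp add: cls_d0 Psi_v \<delta>s_def)

lemma nabla:
  assumes "\<eta> \<in> LL q t"
  shows "fc1 (nabla q t \<theta> \<eta> $ i) a \<in> enl q t"
    and "cls (fc1 (nabla q t \<theta> \<eta> $ i) a) = (\<Sum>k\<in>UNIV. BW i k * \<delta>s \<eta> k a)"
  using Psi_v[OF assms]
  by (simp_all add: nabla_def mlmul1_def dvec_def fc1_sum fc1_simps cls_sum cls_hom cls_d0_sec[OF assms])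

lemma is_connection: "is_connection q t (nabla q t \<theta>)"
  unfolding is_connection_def
proof (intro conjI ballI allI impI)
  fix \<eta> assume \<eta>: "\<eta> \<in> LL q t"
  note d = HALF_d0[OF Psi_v(1)[OF \<eta>], unfolded cls_d0_sec[OF \<eta>]]
  have "nabla q t \<theta> \<eta> $ i \<in> Omega1 q t (charges $ i)" for i
    using HALF_mult[OF LB_VB(2) d(1)] HALF_mult[OF LB_VB(2) d(2)]
    by (intro Omega1I) (auto simp: nabla[OF \<eta>] intro!: HALF_sum)
  then show "nabla q t \<theta> \<eta> \<in> Omega1_LL q t" by (simp add: Omega1_LL_def)
  {
    fix \<eta>' i assume \<eta>': "\<eta>' \<in> LL q t"
    {
      assume "veq q \<eta> \<eta>'"
      then have "cls (\<eta> $ j) = cls (\<eta>' $ j)" for j using LL_D[OF \<eta>] LL_D[OF \<eta>'] by (simp add: veq_def ceq_cls)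
      then show "eq1 q (nabla q t \<theta> \<eta> $ i) (nabla q t \<theta> \<eta>' $ i)"
        by (simp add: eq1_iff ceq_cls nabla \<eta> \<eta>' \<delta>s_def sec_def)
    }
    have s: "\<eta> + \<eta>' \<in> LL q t"
      using LL_D[OF \<eta>] LL_D[OF \<eta>'] by (simp add: LL_def line_bundle_iff cls_hom LB_add)
    have "sec (\<eta> + \<eta>') k = sec \<eta> k + sec \<eta>' k" for k
      using LL_D[OF \<eta>] LL_D[OF \<eta>'] by (simp add: sec_def cls_hom distrib_left sum.distrib)
    then show "eq1 q (nabla q t \<theta> (\<eta> + \<eta>') $ i) (nabla q t \<theta> \<eta> $ i + nabla q t \<theta> \<eta>' $ i)"
      using Psi_v[OF \<eta>] Psi_v[OF \<eta>']
      by (simp add: eq1_iff fc1_simps ceq_cls cls_hom nabla \<eta> \<eta>' s \<delta>s_def D_add distrib_left sum.distrib)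
  }
  {
    fix a i assume a: "a \<in> cp2 q t"
    note c = cp2_charged[OF a]
    have s: "(\<chi> j. \<eta> $ j * a) \<in> LL q t"
      using LL_D[OF \<eta>] a LB_mult[OF LL_D(2)[OF \<eta>], of 0 "cls a"] by (simp add: LL_def line_bundle_iff cls_hom cp2_def)
    have "sec (\<chi> j. \<eta> $ j * a) k = sec \<eta> k * cls a" for k
      using LL_D[OF \<eta>] c by (simp add: sec_def cls_hom sum_distrib_right mult.assoc)
    then have "\<delta>s (\<chi> j. \<eta> $ j * a) k x = \<delta>s \<eta> k x * cls a + sec \<eta> k * (Cc (dc x) * D x (cls a))" for k x
      using Psi_v[OF \<eta>] c by (simp add: \<delta>s_def D_invariant distrib_left Cc_left_comm mult.assoc)
    then have "(\<Sum>k\<in>UNIV. BW i k * \<delta>s (\<chi> j. \<eta> $ j * a) k x)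
        = (\<Sum>k\<in>UNIV. BW i k * \<delta>s \<eta> k x) * cls a + (\<Sum>k\<in>UNIV. BW i k * sec \<eta> k) * (Cc (dc x) * D x (cls a))" for x
      by (simp add: distrib_left sum.distrib sum_distrib_right mult.assoc)
    \<comment> \<open>The undifferentiated factor recombines to \<eta>, because the adjoint of
      \<Psi> is a left inverse of \<Psi>.\<close>
    then show "eq1 q (nabla q t \<theta> (\<chi> j. \<eta> $ j * a) $ i) (rmul1 (nabla q t \<theta> \<eta> $ i) a + lmul1 (\<eta> $ i) (d0 q a))"
      using c LL_D[OF \<eta>] by (simp add: eq1_iff fc1_simps ceq_cls cls_hom nabla \<eta> s cls_d0 BW_sec)
  }
qed

section \<open>The curvature\<close>

abbreviation "\<F> \<equiv> curvF q s c0 c1 c2 t \<theta>"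

definition Cv :: "3 + 3 \<Rightarrow> 2 \<Rightarrow> 6 \<Rightarrow> quot" where
  "Cv n i l = (\<Sum>k\<in>UNIV. BW i k * (\<Sum>m\<in>UNIV. w2 n (\<delta>P k m) (\<delta>P m l)))"

lemma curv: "fc2 (\<F> $ i $ j) n \<in> enl q t" "cls (fc2 (\<F> $ i $ j) n) = (\<Sum>l\<in>UNIV. Cv n i l * VB l j)"
proof -
  show "fc2 (\<F> $ i $ j) n \<in> enl q t"
    by (simp add: curvF_def fc2_sum fc2_simps)
  have "cls (fc2 (\<F> $ i $ j) n) = (\<Sum>k\<in>UNIV. \<Sum>l\<in>UNIV. BW i k * ((\<Sum>m\<in>UNIV. w2 n (\<delta>P k m) (\<delta>P m l)) * VB l j))"
    by (simp add: curvF_def fc2_sum fc2_simps cls_sum cls_hom cls_wedge cls_d0_Pmat)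
  also have "\<dots> = (\<Sum>l\<in>UNIV. Cv n i l * VB l j)"
    by (subst sum.swap) (simp add: Cv_def sum_distrib_right mult.assoc)
  finally show "cls (fc2 (\<F> $ i $ j) n) = (\<Sum>l\<in>UNIV. Cv n i l * VB l j)" .
qed

text \<open>From \<open>dP = dP P + P dP\<close> and \<open>W P = W\<close>: the term
  \<open>W P dP\<close> already exhausts \<open>W dP\<close>.\<close>

lemma BW_\<delta>P_PP: "(\<Sum>k\<in>UNIV. BW i k * (\<Sum>m\<in>UNIV. \<delta>P k m a * PP m l)) = 0"
proof -
  have "\<delta>P k l a = (\<Sum>m\<in>UNIV. \<delta>P k m a * PP m l) + (\<Sum>m\<in>UNIV. PP k m * \<delta>P m l a)" for k
  proof -
    have "D a (\<Sum>m\<in>UNIV. PP k m * PP m l) = (\<Sum>m\<in>UNIV. D a (PP k m) * PP m l + PP k m * D a (PP m l))"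
      by (subst D_sum) (simp_all add: D_invariant charged_PP)
    then show ?thesis
      by (simp add: PP_PP \<delta>P_def sum.distrib distrib_left sum_distrib_left Cc_left_comm mult.assoc)
  qed
  then have "(\<Sum>k\<in>UNIV. BW i k * \<delta>P k l a)
      = (\<Sum>k\<in>UNIV. BW i k * ((\<Sum>m\<in>UNIV. \<delta>P k m a * PP m l) + (\<Sum>m\<in>UNIV. PP k m * \<delta>P m l a)))"
    by (intro sum.cong refl arg_cong2[where f = "(*)"])
  also have "\<dots> = (\<Sum>k\<in>UNIV. BW i k * (\<Sum>m\<in>UNIV. \<delta>P k m a * PP m l)) + (\<Sum>k\<in>UNIV. BW i k * (\<Sum>m\<in>UNIV. PP k m * \<delta>P m l a))"
    by (simp add: distrib_left sum.distrib)
  also have "(\<Sum>k\<in>UNIV. BW i k * (\<Sum>m\<in>UNIV. PP k m * \<delta>P m l a)) = (\<Sum>m\<in>UNIV. \<Sum>k\<in>UNIV. BW i k * PP k m * \<delta>P m l a)"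
    by (subst sum.swap) (simp add: sum_distrib_left mult.assoc)
  also have "\<dots> = (\<Sum>m\<in>UNIV. BW i m * \<delta>P m l a)"
    by (simp add: BW_PP flip: sum_distrib_right)
  finally show ?thesis by simp
qed

text \<open>Writing \<sigma> for \<open>\<Psi> \<eta>\<close>, the equation
  \<open>P \<sigma> = \<sigma>\<close> gives \<open>d\<sigma> = dP \<sigma> + P d\<sigma>\<close>.
  The second term disappears by \<open>BW_\<delta>P_PP\<close>, and the first yields the curvature
  applied to \<eta>.\<close>

lemma nabla_sq_curv:
  assumes \<eta>: "\<eta> \<in> LL q t"
  shows "eq2 q (nabla_sq q s c0 c1 c2 t \<theta> \<eta> $ i) (form2_mult \<F> \<eta> $ i)"
proof -
  have \<delta>s: "\<delta>s \<eta> m a = (\<Sum>l\<in>UNIV. \<delta>P m l a * sec \<eta> l) + (\<Sum>l\<in>UNIV. PP m l * \<delta>s \<eta> l a)" for m a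
  proof -
    have "D a (\<Sum>l\<in>UNIV. PP m l * sec \<eta> l) = (\<Sum>l\<in>UNIV. D a (PP m l) * sec \<eta> l + PP m l * D a (sec \<eta> l))"
      using Psi_v[OF \<eta>] by (subst D_sum) (simp_all add: D_invariant charged_PP)
    then show ?thesis
      using Psi_v[OF \<eta>] by (simp add: PP_sec \<delta>s_def \<delta>P_def sum.distrib distrib_left sum_distrib_left Cc_left_comm mult.assoc)
  qed
  have "ceq q (fc2 (nabla_sq q s c0 c1 c2 t \<theta> \<eta> $ i) n) (fc2 (form2_mult \<F> \<eta> $ i) n)" for n
  proof -
    have row: "(\<Sum>m\<in>UNIV. w2 n (\<delta>P k m) (\<delta>s \<eta> m))
      = (\<Sum>l\<in>UNIV. (\<Sum>m\<in>UNIV. w2 n (\<delta>P k m) (\<delta>P m l)) * sec \<eta> l) + (\<Sum>l\<in>UNIV. w2 n (\<lambda>a. \<Sum>m\<in>UNIV. \<delta>P k m a * PP m l) (\<delta>s \<eta> l))" for k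
    proof -
      have "w2 n (\<delta>P k m) (\<delta>s \<eta> m) = (\<Sum>l\<in>UNIV. w2 n (\<delta>P k m) (\<delta>P m l) * sec \<eta> l)
          + (\<Sum>l\<in>UNIV. w2 n (\<lambda>a. \<delta>P k m a * PP m l) (\<delta>s \<eta> l))" for m
      proof -
        have "w2 n (\<delta>P k m) (\<delta>s \<eta> m) = w2 n (\<delta>P k m) (\<lambda>a. (\<Sum>l\<in>UNIV. \<delta>P m l a * sec \<eta> l) + (\<Sum>l\<in>UNIV. PP m l * \<delta>s \<eta> l a))"
          by (rule arg_cong[where f = "w2 n (\<delta>P k m)"]) (rule ext, rule \<delta>s)
        then show ?thesis by (simp only: w2_simps w2_sum_right)
      qed
      then have "(\<Sum>m\<in>UNIV. w2 n (\<delta>P k m) (\<delta>s \<eta> m)) = (\<Sum>m\<in>UNIV. \<Sum>l\<in>UNIV. w2 n (\<delta>P k m) (\<delta>P m l) * sec \<eta> l)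
          + (\<Sum>m\<in>UNIV. \<Sum>l\<in>UNIV. w2 n (\<lambda>a. \<delta>P k m a * PP m l) (\<delta>s \<eta> l))"
        by (simp only: sum.distrib)
      also have "\<dots> = (\<Sum>l\<in>UNIV. \<Sum>m\<in>UNIV. w2 n (\<delta>P k m) (\<delta>P m l) * sec \<eta> l)
          + (\<Sum>l\<in>UNIV. \<Sum>m\<in>UNIV. w2 n (\<lambda>a. \<delta>P k m a * PP m l) (\<delta>s \<eta> l))"
        by (intro arg_cong2[where f = "(+)"] sum.swap)
      finally show ?thesis by (simp only: sum_distrib_right w2_sum_left)
    qed
    have "cls (fc2 (nabla_sq q s c0 c1 c2 t \<theta> \<eta> $ i) n) = (\<Sum>k\<in>UNIV. BW i k * (\<Sum>m\<in>UNIV. w2 n (\<delta>P k m) (\<delta>s \<eta> m)))"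
      using Psi_v[OF \<eta>] by (simp add: nabla_sq_def mlmul2_def d_of_Adb_def fc2_sum fc2_simps cls_sum cls_hom cls_wedge
          cls_d0_sec[OF \<eta>] cls_d0_Pmat flip: Pmat_def)
    also have "\<dots> = (\<Sum>k\<in>UNIV. \<Sum>l\<in>UNIV. BW i k * (\<Sum>m\<in>UNIV. w2 n (\<delta>P k m) (\<delta>P m l)) * sec \<eta> l)
        + (\<Sum>k\<in>UNIV. \<Sum>l\<in>UNIV. w2 n (\<lambda>a. BW i k * (\<Sum>m\<in>UNIV. \<delta>P k m a * PP m l)) (\<delta>s \<eta> l))"
    proof -
      have "x * ((\<Sum>l\<in>UNIV. X l * Y l) + (\<Sum>l\<in>UNIV. X' l)) = (\<Sum>l\<in>UNIV. x * X l * Y l) + (\<Sum>l\<in>UNIV. x * X' l)"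
        for x and X Y X' :: "6 \<Rightarrow> quot"
        by (simp add: distrib_left sum_distrib_left mult.assoc)
      then show ?thesis unfolding row by (simp only: sum.distrib w2_simps(1))
    qed
    also have "\<dots> = (\<Sum>l\<in>UNIV. Cv n i l * sec \<eta> l)
        + (\<Sum>l\<in>UNIV. w2 n (\<lambda>a. \<Sum>k\<in>UNIV. BW i k * (\<Sum>m\<in>UNIV. \<delta>P k m a * PP m l)) (\<delta>s \<eta> l))"
      unfolding Cv_def w2_sum_left sum_distrib_right by (intro arg_cong2[where f = "(+)"] sum.swap)
    also have "\<dots> = (\<Sum>l\<in>UNIV. Cv n i l * sec \<eta> l)"
      by (simp add: BW_\<delta>P_PP w2_simps)
    also have "\<dots> = (\<Sum>j\<in>UNIV. \<Sum>l\<in>UNIV. Cv n i l * VB l j * cls (\<eta> $ j))"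
      unfolding sec_def sum_distrib_left mult.assoc by (rule sum.swap)
    also have "\<dots> = cls (fc2 (form2_mult \<F> \<eta> $ i) n)"
      using LL_D[OF \<eta>] curv(1) by (simp add: form2_mult_def fc2_sum fc2_simps cls_sum cls_hom curv(2) sum_distrib_right)
    finally have "cls (fc2 (nabla_sq q s c0 c1 c2 t \<theta> \<eta> $ i) n) = cls (fc2 (form2_mult \<F> \<eta> $ i) n)" .
    moreover have "fc2 (nabla_sq q s c0 c1 c2 t \<theta> \<eta> $ i) n \<in> enl q t" "fc2 (form2_mult \<F> \<eta> $ i) n \<in> enl q t"
      using Psi_v[OF \<eta>] LL_D[OF \<eta>] curv(1)
      by (simp_all add: nabla_sq_def mlmul2_def d_of_Adb_def form2_mult_def fc2_sum fc2_simps flip: Pmat_def)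
    ultimately show ?thesis by (simp add: ceq_cls)
  qed
  then show ?thesis by (simp add: eq2_iff)
qed

text \<open>The equation \<open>\<Psi> \<nabla>\<eta> = P d(\<Psi> \<eta>)\<close> holds literally
  for sequences; additivity, the Leibniz rule and \<open>d d = 0\<close> then evaluate the given map
  on each summand.\<close>

lemma nabla1_nabla_sq:
  assumes d: "is_d1 q t s c0 c1 c2 d" and \<eta>: "\<eta> \<in> LL q t"
  shows "eq2 q (nabla1 d q t \<theta> (nabla q t \<theta> \<eta>) $ i) (nabla_sq q s c0 c1 c2 t \<theta> \<eta> $ i)"
proof -
  define b where "b = \<Psi> *v \<eta>"
  have b: "b $ k \<in> cp2 q t" for k using Psi_v[OF \<eta>] by (simp add: b_def)
  have add: "eq2 q (d (\<omega> + \<omega>')) (d \<omega> + d \<omega>')" if "\<omega> \<in> Omega1 q t 0" "\<omega>' \<in> Omega1 q t 0" for \<omega> \<omega>'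
    using d that by (simp add: is_d1_def)
  have closed: "eq2 q (d (d0 q a)) 0" if "a \<in> cp2 q t" for a
    using d that by (simp add: is_d1_def)
  have leibniz: "eq2 q (d (lmul1 a \<omega>)) (wdg (d0 q a) \<omega> + lmul2 a (d \<omega>))"
    if "a \<in> cp2 q t" "\<omega> \<in> Omega1 q t 0" for a \<omega>
    using d that unfolding is_d1_def by blast
  have z: "0 \<in> Omega1 q t 0"
    by (intro Omega1I) (simp_all add: fc1_simps cls_hom HALF_0)
  \<comment> \<open>Additivity at 0 makes \<open>d 0\<close> congruent to twice itself.\<close>
  have d0: "eq2 q (d 0) 0"
    using add[OF z z] by (simp add: eq2_iff fc2_simps ceq_null) (metis null_mult(1)[OF bdd_uminus[OF bdd_1]] mult_minus1 minus_minus)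
  define f where "f k m = lmul1 (Pmat q t \<theta> $ k $ m) (d0 q (b $ m))" for k m
  have sum_mem: "sum (f k) I \<in> Omega1 q t 0" for k I
    using HALF_mult[OF charged_LB[OF charged_PP] HALF_d0(1)[OF b]] HALF_mult[OF charged_LB[OF charged_PP] HALF_d0(2)[OF b]] cp2_charged[OF b]
    by (intro Omega1I) (auto simp: f_def fc1_simps fc1_sum cls_sum cls_hom Pmat intro!: HALF_sum)
  have sums: "eq2 q (d (sum (f k) I)) (\<Sum>m\<in>I. d (f k m))" for k and I :: "6 set"
  proof (induction I rule: infinite_finite_induct)
    case (insert x I)
    have "eq2 q (d (f k x + sum (f k) I)) (d (f k x) + d (sum (f k) I))"
      using add[OF sum_mem[of k "{x}"] sum_mem[of k I]] by simp
    then show ?case using insert eq2_trans[OF _ eq2_add[OF eq2_refl]] by simp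
  qed (simp_all add: d0)
  have "eq2 q (d (mlmul1 \<Psi> (nabla q t \<theta> \<eta>) $ k)) (\<Sum>m\<in>UNIV. wdg (d0 q (Pmat q t \<theta> $ k $ m)) (d0 q (b $ m)))" for k
  proof -
    have "mlmul1 \<Psi> (nabla q t \<theta> \<eta>) $ k = (\<Sum>m\<in>UNIV. lmul1 (Pmat q t \<theta> $ k $ m) (d0 q (b $ m)))"
    proof (rule fc1_eqI)
      fix a
      have "fc1 (mlmul1 \<Psi> (nabla q t \<theta> \<eta>) $ k) a = (\<Sum>j\<in>UNIV. \<Sum>m\<in>UNIV. \<Psi> $ k $ j * dagger \<Psi> $ j $ m * fc1 (d0 q (b $ m)) a)"
        by (simp add: nabla_def mlmul1_def dvec_def b_def fc1_sum fc1_simps sum_distrib_left mult.assoc)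
      also have "\<dots> = fc1 (\<Sum>m\<in>UNIV. lmul1 (Pmat q t \<theta> $ k $ m) (d0 q (b $ m))) a"
        by (subst sum.swap) (simp add: Pmat_def matrix_matrix_mult_def fc1_sum fc1_simps sum_distrib_right)
      finally show "fc1 (mlmul1 \<Psi> (nabla q t \<theta> \<eta>) $ k) a = \<dots>" .
    qed
    moreover have "eq2 q (d (lmul1 (Pmat q t \<theta> $ k $ m) (d0 q (b $ m)))) (wdg (d0 q (Pmat q t \<theta> $ k $ m)) (d0 q (b $ m)))" for m
    proof -
      have "lmul2 x 0 = 0" for x by (rule fc2_eqI) (simp add: fc2_simps)
      then have "eq2 q (lmul2 (Pmat q t \<theta> $ k $ m) (d (d0 q (b $ m)))) 0"
        using eq2_lmul2[OF bdd_enl[OF Pmat_enl] closed[OF b]] by metis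
      from eq2_trans[OF leibniz[OF Pmat(1) d0_Omega1[OF b]] eq2_add[OF eq2_refl this]] show ?thesis
        by (simp only: add.right_neutral)
    qed
    ultimately show ?thesis
      using eq2_trans[OF sums[of k UNIV] eq2_sum] by (simp add: f_def)
  qed
  then show ?thesis
    unfolding nabla1_def nabla_sq_def mlmul2_def d_of_Adb_def Pmat_def[symmetric] b_def
    by (simp add: eq2_sum eq2_lmul2)
qed

lemma O2_wedge: "O2 0 (\<lambda>n. w2 n (\<delta>P k m) (\<delta>P m' l))" for m
  using HALF_d0[OF Pmat(1)] unfolding cls_d0_Pmat by (intro O2_w2)

text \<open>Charges add: row \<open>i\<close> of the adjoint of \<Psi> contributes
  \<open>charges $ i\<close>, the form built from \<open>dP\<close> contributes 0, and column
  \<open>j\<close> of \<Psi> the negative of \<open>charges $ j\<close>.\<close>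

lemma curv_Omega2: "\<F> $ i $ j \<in> Omega2 q t (charges $ i - charges $ j)"
proof -
  have "O2 (charges $ i - charges $ j) (\<lambda>n. cls (fc2 (\<F> $ i $ j) n))"
  proof -
    have "O2 (charges $ i + 0 + - (charges $ j)) (\<lambda>n. \<Sum>l\<in>UNIV. Cv n i l * VB l j)"
      unfolding Cv_def by (intro O2_sum O2_mult' O2_mult LB_VB O2_wedge)
    then show ?thesis by (simp add: curv(2))
  qed
  then show ?thesis by (intro Omega2I) (simp_all add: O2_def curv(1))
qed

lemma curv_v: "cls (fc2 (\<F> $ i $ j) (Inl n)) = 0"
proof -
  \<comment> \<open>Contracting \<open>Z\<close> with the coefficients of \<open>mu1\<close> gives,
    for each order of types, a multiple of one of the vanishing combinations in
    \<open>Z_asd\<close>.\<close>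
  have Z0: "(\<Sum>a\<in>UNIV. \<Sum>b\<in>UNIV. gam (Inl n) a b *\<^sub>R Z i j a b) = 0"
  proof -
    have "c *\<^sub>R (\<Q> (- 1/2) *\<^sub>R X + \<Q> (1/2) *\<^sub>R Y) = 0 \<Longrightarrow> (c * \<Q> (- 1/2)) *\<^sub>R X + (c * \<Q> (1/2)) *\<^sub>R Y = 0" for c and X Y :: quot
      by (simp add: scaleR_right_distrib)
    from this[of "c1 / rt" "Z i j (Inr 1) (Inl 2)" "Z i j (Inr 2) (Inl 1)"]
      this[of "- (q powr (s / 2)) * c1 / rt" "Z i j (Inl 1) (Inr 2)" "Z i j (Inl 2) (Inr 1)"]
    show ?thesis
      using exhaust_3[of n] Z_asd[of i j] by (auto simp: sum_Plus sum_2 gam_def m1_def)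
  qed
  have S: "(\<Sum>m\<in>UNIV. (\<Sum>k\<in>UNIV. BW i k * \<delta>P k m a) * (\<Sum>l\<in>UNIV. \<delta>P m l b * VB l j))
      = Cc (dc a * dc b) * (BB i * (\<Q> (chg i + chg j) *\<^sub>R Z i j a b) * BB j)" for a b
  proof -
    have l: "(\<Sum>k\<in>UNIV. BW i k * \<delta>P k m a) = Cc (dc a) * (BB i * (\<Sum>k\<in>UNIV. W i k * D a (PP k m)))" for m
      by (simp add: BW_def \<delta>P_def Cc_left_comm sum_distrib_left mult.assoc BB)
    have r: "(\<Sum>l\<in>UNIV. \<delta>P m l b * VB l j) = Cc (dc b) * ((\<Sum>l\<in>UNIV. D b (PP m l) * V j l) * BB j)" for m
      by (simp add: VB_def \<delta>P_def sum_distrib_left sum_distrib_right mult.assoc)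
    have RR: "BB i * (\<Sum>k\<in>UNIV. W i k * D a (PP k m)) \<in> R" for m by (auto intro!: R_mult R_sum BB)
    have "(\<Sum>m\<in>UNIV. (\<Sum>k\<in>UNIV. BW i k * \<delta>P k m a) * (\<Sum>l\<in>UNIV. \<delta>P m l b * VB l j))
        = (\<Sum>m\<in>UNIV. Cc (dc a) * (Cc (dc b) * ((BB i * (\<Sum>k\<in>UNIV. W i k * D a (PP k m))) * ((\<Sum>l\<in>UNIV. D b (PP m l) * V j l) * BB j))))"
      unfolding l r mult.assoc[of "Cc (dc a)"] using RR by (simp only: Cc_left_comm)
    also have "\<dots> = Cc (dc a * dc b) * (BB i * (\<Sum>m\<in>UNIV. (\<Sum>k\<in>UNIV. W i k * D a (PP k m)) * (\<Sum>l\<in>UNIV. D b (PP m l) * V j l)) * BB j)"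
    proof -
      have *: "BB i * (\<Sum>m\<in>UNIV. X m * Y m) * BB j = (\<Sum>m\<in>UNIV. BB i * X m * (Y m * BB j))" for X Y :: "6 \<Rightarrow> quot"
        by (simp add: sum_distrib_left sum_distrib_right mult.assoc)
      show ?thesis
        unfolding * Cc_mult[symmetric] mult.assoc[of "Cc (dc a)" "Cc (dc b)"]
        by (simp only: sum_distrib_left[of "Cc (dc a)"] sum_distrib_left[of "Cc (dc b)"])
    qed
    finally show ?thesis unfolding sandwich[OF charged_PP] .
  qed
  have "cls (fc2 (\<F> $ i $ j) (Inl n)) = (\<Sum>l\<in>UNIV. \<Sum>k\<in>UNIV. \<Sum>m\<in>UNIV. w2 (Inl n) (\<lambda>a. BW i k * \<delta>P k m a) (\<lambda>b. \<delta>P m l b * VB l j))"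
    by (simp only: curv(2) Cv_def sum_distrib_left sum_distrib_right w2_simps mult.assoc)
  also have "\<dots> = (\<Sum>m\<in>UNIV. \<Sum>k\<in>UNIV. \<Sum>l\<in>UNIV. w2 (Inl n) (\<lambda>a. BW i k * \<delta>P k m a) (\<lambda>b. \<delta>P m l b * VB l j))"
  proof -
    have "(\<Sum>l\<in>UNIV. \<Sum>k\<in>UNIV. \<Sum>m\<in>UNIV. f k l m) = (\<Sum>m\<in>UNIV. \<Sum>k\<in>UNIV. \<Sum>l\<in>UNIV. f k l m)" for f :: "6 \<Rightarrow> 6 \<Rightarrow> 6 \<Rightarrow> quot"
      by (rule trans[OF sum.cong[OF refl sum.swap] trans[OF sum.swap sum.cong[OF refl sum.swap]]])
    then show ?thesis .
  qed
  also have "\<dots> = (\<Sum>m\<in>UNIV. w2 (Inl n) (\<lambda>a. \<Sum>k\<in>UNIV. BW i k * \<delta>P k m a) (\<lambda>b. \<Sum>l\<in>UNIV. \<delta>P m l b * VB l j))"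
    by (simp only: w2_sum_left w2_sum_right)
  also have "\<dots> = (\<Sum>a\<in>UNIV. \<Sum>b\<in>UNIV. gam (Inl n) a b *\<^sub>R (\<Sum>m\<in>UNIV. (\<Sum>k\<in>UNIV. BW i k * \<delta>P k m a) * (\<Sum>l\<in>UNIV. \<delta>P m l b * VB l j)))"
    unfolding w2_def scaleR_sum_right by (subst sum.swap) (intro sum.cong[OF refl] sum.swap)
  \<comment> \<open>Only pairs of opposite type have a coefficient, so the prefactor
    \<open>dc a * dc b\<close> is the same in all contributing terms and can leave the sum.\<close>
  also have "\<dots> = (\<Sum>a\<in>UNIV. \<Sum>b\<in>UNIV. gam (Inl n) a b *\<^sub>R (Cc (dc (Inl 1) * dc (Inr 1)) * (BB i * (\<Q> (chg i + chg j) *\<^sub>R Z i j a b) * BB j)))"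
    unfolding S
  proof (intro sum.cong refl)
    fix a b
    have "gam (Inl n) a b = 0 \<or> dc a * dc b = dc (Inl 1) * dc (Inr 1)"
      by (simp add: gam_def dc_def mult.commute split: sum.split)
    then show "gam (Inl n) a b *\<^sub>R (Cc (dc a * dc b) * (BB i * (\<Q> (chg i + chg j) *\<^sub>R Z i j a b) * BB j))
      = gam (Inl n) a b *\<^sub>R (Cc (dc (Inl 1) * dc (Inr 1)) * (BB i * (\<Q> (chg i + chg j) *\<^sub>R Z i j a b) * BB j))" by auto
  qed
  also have "\<dots> = Cc (dc (Inl 1) * dc (Inr 1)) * (BB i * (\<Q> (chg i + chg j) *\<^sub>R (\<Sum>a\<in>UNIV. \<Sum>b\<in>UNIV. gam (Inl n) a b *\<^sub>R Z i j a b)) * BB j)"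
    by (simp add: sum_distrib_left sum_distrib_right scaleR_sum_right) (simp only: mult.commute)
  finally show ?thesis by (simp add: Z0)
qed

lemma curv_asd: "asd q (\<F> $ i $ j)"
proof -
  have h: "fc2 (hodge_rev \<omega>) (Inl n) = fc2 \<omega> (Inl n)" "fc2 (hodge_rev \<omega>) (Inr n) = - fc2 \<omega> (Inr n)" for \<omega> n
    by (simp_all add: fc2_def hodge_rev_def split: prod.split)
  have "ceq q (fc2 (hodge_rev (\<F> $ i $ j)) n) (fc2 (- (\<F> $ i $ j)) n)" for n
    using curv(1)[of i j n] curv_v[of i j]
    by (cases n) (simp_all add: h fc2_simps ceq_cls cls_hom)
  then show ?thesis by (simp add: asd_def eq2_iff)
qed

end

theorem theorem4p6:
  fixes q s c0 c1 c2 t \<theta> :: real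
  assumes "0 < q" and "q < 1"
    and "s = 1 \<or> s = - 1"
    and "c0 \<noteq> 0" and "c1 \<noteq> 0" and "c2 \<noteq> 0"
    and "\<bar>c1\<bar> = q powr (- s / 4) * qnum q 2 powr (- 1 / 4) * sqrt \<bar>c0\<bar>"
    and "\<bar>c2\<bar> = q powr (3 / 4 * s) * qnum q 2 powr (- 1 / 4) * sqrt \<bar>c0\<bar>"
    and "0 \<le> t" and "t < 1"
    and "0 \<le> \<theta>" and "\<theta> < pi / 4" and "t = sin (2 * \<theta>)"
  shows "is_connection q t (nabla q t \<theta>)
    \<and> (\<forall>\<eta>\<in>LL q t. \<forall>i.
         eq2 q (nabla_sq q s c0 c1 c2 t \<theta> \<eta> $ i) (form2_mult (curvF q s c0 c1 c2 t \<theta>) \<eta> $ i))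
    \<and> (\<forall>D. is_d1 q t s c0 c1 c2 D \<longrightarrow> (\<forall>\<eta>\<in>LL q t. \<forall>i.
         eq2 q (nabla1 D q t \<theta> (nabla q t \<theta> \<eta>) $ i) (form2_mult (curvF q s c0 c1 c2 t \<theta>) \<eta> $ i)))
    \<and> (\<forall>i j. curvF q s c0 c1 c2 t \<theta> $ i $ j \<in> Omega2 q t (charges $ i - charges $ j)
         \<and> asd q (curvF q s c0 c1 c2 t \<theta> $ i $ j))"
proof -
  interpret connection q t s c0 c1 c2 \<theta>
    using assms by unfold_locales (simp_all add: abs_square_less_1)
  show ?thesis
    using is_connection nabla_sq_curv eq2_trans[OF nabla1_nabla_sq nabla_sq_curv] curv_Omega2 curv_asd by blast
qed

end
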